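(* Let $c:\Pi\to\mathbb N$ be a coloring. Then $\mathcal H_c$ is a free $R$-module, and the set $\{\mathcal F^{[r_1,\dots,r_k]}:(r_1,\dots,r_k)\in\mathcal P_c\}$ (with $k=m_c$) is a basis of it.
   Context: **Lie data.** $(a_{ij})_{1\le i,j\le l}$ is the Cartan matrix of a semisimple Lie algebra, $d_i$ positive integers with $(d_ia_{ij})$ symmetric positive definite, $\Pi=\{\alpha_1,\dots,\alpha_l\}$ the simple roots, $(\alpha_i,\alpha_j)=d_ia_{ij}$. $R=\mathbb Z[q^{\pm1/2}]$. **Configuration spaces.** For $c:\Pi\to\mathbb N$, $m_c=\sum_\alpha c(\alpha)$. $D=[-1,1]^2\subset\mathbb C$ (a disk), $\partial^-D$ its two vertical sides. $\mathrm{Conf}_c=\left(D^{m_c}\setminus\bigcup_{i<j}\{z_i=z_j\}\right)/\mathfrak S_{c(\alpha_1)}\times\cdots\times\mathfrak S_{c(\alpha_l)}$: configurations $(\mathbf z^{\alpha_1},\dots,\mathbf z^{\alpha_l})$ with $\mathbf z^{\alpha_i}$ a set of $c(\alpha_i)$ points colored by $\alpha_i$. $S$: configurations with at least one point in $\partial^-D$. **Local system.** $f(\{z_i\})=\prod_{i<j}\left(\frac{z_j-z_i}{|z_j-z_i|}\right)^2$, $g(\{z_i\},\{w_j\})=\prod_{i,j}\left(\frac{w_j-z_i}{|w_j-z_i|}\right)^2$, $\Phi_c(\mathbf z)=\left((f(\mathbf z^{\alpha_i}))_i,(g(\mathbf z^{\alpha_i},\mathbf z^{\alpha_j}))_{i<j}\right)\in(\mathbb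 S^1)^{l+l(l-1)/2}$, $W_c=\Phi_c\circ r$ with $r$ the rotation of all points by $\pi/2$; vertically aligned configurations go to $b=(1,\dots,1)$. $R_c$ is the pullback by $W_c$ of the rank one local system of $R$-modules on the torus with fibre $R$ at $b$ and monodromy $-q^{d_i}$ (coordinate $f(\mathbf z^{\alpha_i})$), $q^{(\alpha_i,\alpha_j)/2}$ (coordinate $g(\mathbf z^{\alpha_i},\mathbf z^{\alpha_j})$) along counterclockwise circles. **Homology.** $\mathcal H_c=H_{m_c}(\mathrm{Conf}_c,S;R_c)$, twisted relative singular homology. **Classes.** $\mathcal P_c$ is the set of words $(r_1,\dots,r_{m_c})\in\{1,\dots,l\}^{m_c}$ in which each $i$ occurs $c(\alpha_i)$ times. $\mathcal F^{[r_1,\dots,r_k]}\in\mathcal H_c$ is the class of the cube $[0,1]^k\to\mathrm{Conf}_c$ sending $(t_1,\dots,t_k)$ to the configuration with points $(-1+2t_j,h_j)$ colored $\alpha_{r_j}$, where $1>h_1>\dots>h_k>-1$ are fixed heights (so $k$ disjoint horizontal arcs, listed from top to bottom, one point on each; its faces lie in $S$). It is lifted to twisted homology using the constant handle at its vertically aligned vertex $t=(1,\dots,1)$ on the right side of $D$ (the fibre of $R_c$ there is canonically $R$). *)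

theory Defs
  imports
    "HOL-Complex_Analysis.Complex_Analysis"
    "HOL-Homology.Homology"
    "HOL-Combinatorics.Permutations"
    "HOL-Algebra.Module"
    "HOL-Algebra.AbelCoset"
begin

section \<open>Free modules and quotient modules\<close>

definition module_basis :: "('r, 'm) ring_scheme \<Rightarrow> ('r, 'a, 'n) module_scheme \<Rightarrow> 'a set \<Rightarrow> bool"
  where "module_basis R M B \<longleftrightarrow> B \<subseteq> carrier M \<and>
    (\<forall>x \<in> carrier M. \<exists>!u. u \<in> B \<rightarrow>\<^sub>E carrier R \<and> finite {b \<in> B. u b \<noteq> \<zero>\<^bsub>R\<^esub>} \<and>
       x = (\<Oplus>\<^bsub>M\<^esub>b \<in> {b \<in> B. u b \<noteq> \<zero>\<^bsub>R\<^esub>}. u b \<odot>\<^bsub>M\<^esub> b))"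

definition free_module :: "('r, 'm) ring_scheme \<Rightarrow> ('r, 'a, 'n) module_scheme \<Rightarrow> bool"
  where "free_module R M \<longleftrightarrow> Module.module R M \<and> (\<exists>B. module_basis R M B)"

text \<open>The fields \<^const>\<open>monoid.mult\<close> and \<^const>\<open>monoid.one\<close> of a module record carry no
  meaning.\<close>

definition quotient_module :: "('r, 'a, 'n) module_scheme \<Rightarrow> 'a set \<Rightarrow> ('r, 'a set) module"
  where "quotient_module M N =
    \<lparr>carrier = a_rcosets\<^bsub>M\<^esub> N, monoid.mult = (\<lambda>_ _. undefined), one = undefined,
     zero = N, add = (\<lambda>X Y. X <+>\<^bsub>M\<^esub> Y),
     smult = (\<lambda>r X. N <+>\<^bsub>M\<^esub> ((\<lambda>x. r \<odot>\<^bsub>M\<^esub> x) ` X))\<rparr>"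

section \<open>Rank one local systems\<close>

definition concat_path :: "(real \<Rightarrow> 'a) \<Rightarrow> (real \<Rightarrow> 'a) \<Rightarrow> real \<Rightarrow> 'a"
  where "concat_path g h t = (if t \<le> 1/2 then g (2 * t) else h (2 * t - 1))"

text \<open>A rank one local system of \<open>'r\<close>-modules with a chosen generator of each fibre is a functor
  from the fundamental groupoid of \<open>X\<close> to the units of \<open>'r\<close>: the parallel transport
  from the fibre at \<open>g 0\<close> to the fibre at \<open>g 1\<close> is multiplication by \<open>L g\<close>.
  That the \<open>L g\<close> are units follows from the axioms by reversing paths.\<close>

definition rank_one_local_system :: "'a topology \<Rightarrow> ((real \<Rightarrow> 'a) \<Rightarrow> 'r::comm_ring_1) \<Rightarrow> bool"
  where "rank_one_local_system X L \<longleftrightarrow>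
    (\<forall>x \<in> topspace X. L (\<lambda>_. x) = 1) \<and>
    (\<forall>g h. pathin X g \<longrightarrow> pathin X h \<longrightarrow> g 1 = h 0 \<longrightarrow> L (concat_path g h) = L h * L g) \<and>
    (\<forall>g h. homotopic_with (\<lambda>k. k 0 = g 0 \<and> k 1 = g 1) (top_of_set {0..1}) X g h \<longrightarrow> L g = L h)"

definition pullback_local_system ::
    "('a \<Rightarrow> 'b) \<Rightarrow> ((real \<Rightarrow> 'b) \<Rightarrow> 'r) \<Rightarrow> (real \<Rightarrow> 'a) \<Rightarrow> 'r"
  where "pullback_local_system w L g = L (w \<circ> g)"

definition torus :: "'e set \<Rightarrow> ('e \<Rightarrow> complex) topology"
  where "torus I = product_topology (\<lambda>_. top_of_set (sphere 0 1)) I"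

definition coordinate_loop :: "'e set \<Rightarrow> 'e \<Rightarrow> real \<Rightarrow> 'e \<Rightarrow> complex"
  where "coordinate_loop I e t = (\<lambda>e' \<in> I. if e' = e then cis (2 * pi * t) else 1)"

definition torus_local_system ::
    "'e set \<Rightarrow> ('e \<Rightarrow> 'r::comm_ring_1) \<Rightarrow> ((real \<Rightarrow> 'e \<Rightarrow> complex) \<Rightarrow> 'r) \<Rightarrow> bool"
  where "torus_local_system I \<rho> L \<longleftrightarrow>
    rank_one_local_system (torus I) L \<and> (\<forall>e \<in> I. L (coordinate_loop I e) = \<rho> e)"

lemma torus_local_system_exists:
  fixes \<rho> :: "'e \<Rightarrow> 'r::comm_ring_1"
  assumes "finite I" and unit: "\<And>e. e \<in> I \<Longrightarrow> \<rho> e dvd 1"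
  shows "\<exists>L. torus_local_system I \<rho> L"
proof -
  obtain \<tau> where \<tau>: "\<And>e. e \<in> I \<Longrightarrow> \<rho> e * \<tau> e = 1"
    using unit unfolding dvd_def by metis
  define P where "P e n = (if n \<ge> 0 then \<rho> e ^ nat n else \<tau> e ^ nat (- n))" for e and n :: int
  have cancel: "\<rho> e ^ (m + k) * \<tau> e ^ k = \<rho> e ^ m" "\<rho> e ^ k * \<tau> e ^ (m + k) = \<tau> e ^ m"
    if "e \<in> I" for e m k
  proof -
    have "\<rho> e ^ k * \<tau> e ^ k = 1" using \<tau>[OF that] by (metis power_mult_distrib power_one)
    then show "\<rho> e ^ (m + k) * \<tau> e ^ k = \<rho> e ^ m" "\<rho> e ^ k * \<tau> e ^ (m + k) = \<tau> e ^ m"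
      by (simp_all add: power_add mult.assoc) (metis mult.left_commute mult_1_right)
  qed
  have P_diff: "P e (int m - int k) = \<rho> e ^ m * \<tau> e ^ k" if "e \<in> I" for e m k
  proof (cases "k \<le> m")
    case True
    then obtain j where "m = j + k" by (metis le_add_diff_inverse2)
    then show ?thesis using cancel(1)[OF that, of j k] by (simp add: P_def)
  next
    case False
    then obtain j where "k = j + m" by (metis le_add_diff_inverse2 nat_le_linear)
    then show ?thesis using cancel(2)[OF that, of m j] False by (auto simp: P_def)
  qed
  have P_add: "P e (m + n) = P e m * P e n" if "e \<in> I" for e m n
  proof -
    obtain m1 m2 where m: "m = int m1 - int m2" using int_diff_cases by blast
    obtain n1 n2 where n: "n = int n1 - int n2" using int_diff_cases by blast
    have "m + n = int (m1 + n1) - int (m2 + n2)" using m n by simp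
    then have "P e (m + n) = \<rho> e ^ (m1 + n1) * \<tau> e ^ (m2 + n2)"
      using P_diff[OF that] by metis
    then show ?thesis using m n P_diff[OF that] by (simp add: power_add mult_ac)
  qed
  have P0: "P e 0 = 1" and P1: "P e 1 = \<rho> e" for e by (simp_all add: P_def)
  define deg where "deg g = Re (winding_number g 0) - (Arg (g 1) - Arg (g 0)) / (2 * pi)" for g
  let ?S = "sphere (0::complex) 1"
  have deg_Ints: "deg g \<in> \<int>" if g: "path g" "path_image g \<subseteq> ?S" for g
  proof -
    define w where "w = winding_number g 0"
    have "0 \<notin> path_image g" using g by auto
    then have e: "g 1 = exp (2 * pi * \<i> * w) * g 0"
      using winding_number_exp_2pi[of g 0] g by (simp add: pathstart_def pathfinish_def w_def)
    have n: "cmod (g 0) = 1" "cmod (g 1) = 1"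
      using g(2) by (force simp: path_image_def image_subset_iff)+
    then have "cmod (exp (2 * pi * \<i> * w)) = 1" using e by (simp add: norm_mult)
    then have "Im w = 0" by (simp add: norm_exp_eq_Re)
    then have "w = of_real (Re w)" by (simp add: complex_eq_iff)
    then have "exp (2 * pi * \<i> * w) = cis (2 * pi * Re w)"
      by (metis cis_conv_exp mult.assoc mult.commute of_real_mult of_real_numeral)
    moreover have "g 0 = cis (Arg (g 0))" "g 1 = cis (Arg (g 1))"
      using n by (metis cis_Arg div_by_1 norm_zero of_real_1 sgn_eq zero_neq_one)+
    ultimately have "cis (Arg (g 1)) = cis (2 * pi * Re w + Arg (g 0))"
      using e by (metis cis_mult)
    then have "cis (2 * pi * Re w + Arg (g 0) - Arg (g 1)) = 1"
      by (metis cis_divide cis_neq_zero divide_self)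
    then have "cos (2 * pi * Re w + Arg (g 0) - Arg (g 1)) = 1"
      by (metis cis.sel(1) one_complex.sel(1))
    then obtain k :: int where "2 * pi * Re w + Arg (g 0) - Arg (g 1) = of_int k * 2 * pi"
      by (auto simp: cos_one_2pi_int)
    then have "deg g = of_int k" by (simp add: deg_def w_def field_simps)
    then show ?thesis by simp
  qed
  define L where "L g = (\<Prod>e \<in> I. P e \<lfloor>deg (\<lambda>t. g t e)\<rfloor>)" for g
  have comp: "path (\<lambda>t. g t e)" "path_image (\<lambda>t. g t e) \<subseteq> ?S"
    if "pathin (torus I) g" "e \<in> I" for g e
    using that by (auto simp: pathin_def torus_def continuous_map_componentwise path_def path_image_def)
  have "rank_one_local_system (torus I) L"
    unfolding rank_one_local_system_def
  proof (intro conjI ballI allI impI)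
    fix x assume x: "x \<in> topspace (torus I)"
    have "deg (\<lambda>t. x e) = 0" if "e \<in> I" for e
    proof -
      have "x e \<noteq> 0" using x that by (auto simp: torus_def PiE_iff)
      then show ?thesis by (simp add: deg_def winding_number_constI)
    qed
    then show "L (\<lambda>_. x) = 1" by (simp add: L_def P0)
  next
    fix g h assume g: "pathin (torus I) g" and h: "pathin (torus I) h" and gh: "g 1 = h 0"
    have "P e \<lfloor>deg (\<lambda>t. concat_path g h t e)\<rfloor> = P e \<lfloor>deg (\<lambda>t. h t e)\<rfloor> * P e \<lfloor>deg (\<lambda>t. g t e)\<rfloor>"
      if e: "e \<in> I" for e
    proof -
      have eq: "(\<lambda>t. concat_path g h t e) = (\<lambda>t. g t e) +++ (\<lambda>t. h t e)"
        by (auto simp: concat_path_def joinpaths_def)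
      have z: "0 \<notin> path_image (\<lambda>t. g t e)" "0 \<notin> path_image (\<lambda>t. h t e)"
        using comp(2)[OF g e] comp(2)[OF h e] by auto
      have "winding_number ((\<lambda>t. g t e) +++ (\<lambda>t. h t e)) 0 =
          winding_number (\<lambda>t. g t e) 0 + winding_number (\<lambda>t. h t e) 0"
        using winding_number_join[OF comp(1)[OF g e] z(1) comp(1)[OF h e] z(2)] gh
        by (simp add: pathstart_def pathfinish_def)
      then have "deg (\<lambda>t. concat_path g h t e) = deg (\<lambda>t. h t e) + deg (\<lambda>t. g t e)"
        unfolding deg_def eq using gh by (simp add: joinpaths_def diff_divide_distrib)
      moreover have "deg (\<lambda>t. h t e) \<in> \<int>" using deg_Ints comp[OF h e] by blast
      ultimately have "\<lfloor>deg (\<lambda>t. concat_path g h t e)\<rfloor> = \<lfloor>deg (\<lambda>t. h t e)\<rfloor> + \<lfloor>deg (\<lambda>t. g t e)\<rfloor>"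
        by (metis Ints_cases floor_of_int floor_add_int add.commute)
      then show ?thesis using P_add[OF e] by simp
    qed
    then show "L (concat_path g h) = L h * L g" by (simp add: L_def prod.distrib)
  next
    fix g h :: "real \<Rightarrow> 'e \<Rightarrow> complex"
    assume H: "homotopic_with (\<lambda>k. k 0 = g 0 \<and> k 1 = g 1) (top_of_set {0..1}) (torus I) g h"
    have "deg (\<lambda>t. g t e) = deg (\<lambda>t. h t e)" if e: "e \<in> I" for e
    proof -
      have "homotopic_with (\<lambda>k. k 0 = g 0 e \<and> k 1 = g 1 e) (top_of_set {0..1})
          (top_of_set ?S) ((\<lambda>x. x e) \<circ> g) ((\<lambda>x. x e) \<circ> h)"
      proof (rule homotopic_with_compose_continuous_map_left[OF H])
        show "continuous_map (torus I) (top_of_set ?S) (\<lambda>x. x e)"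
          unfolding torus_def using e by (rule continuous_map_product_projection)
      qed simp
      then have "homotopic_paths ?S (\<lambda>t. g t e) (\<lambda>t. h t e)"
        by (simp add: homotopic_paths_def pathstart_def pathfinish_def o_def)
      then have "homotopic_paths (- {0}) (\<lambda>t. g t e) (\<lambda>t. h t e)"
        by (rule homotopic_paths_subset) auto
      then have "winding_number (\<lambda>t. g t e) 0 = winding_number (\<lambda>t. h t e) 0"
        by (rule winding_number_homotopic_paths)
      moreover have "h 0 = g 0" "h 1 = g 1" using homotopic_with_imp_property[OF H] by auto
      ultimately show ?thesis by (simp add: deg_def)
    qed
    then show "L g = L h" by (simp add: L_def)
  qed
  moreover have "L (coordinate_loop I e) = \<rho> e" if e: "e \<in> I" for e
  proof -
    have "deg (\<lambda>t. coordinate_loop I e t e') = (if e' = e then 1 else 0)" if "e' \<in> I" for e'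
    proof (cases "e' = e")
      case True
      have "winding_number (\<lambda>t. cis (2 * pi * t)) 0 = winding_number (circlepath 0 1) 0"
        by (rule winding_number_cong) (simp add: circlepath cis_conv_exp mult_ac)
      then have "winding_number (\<lambda>t. cis (2 * pi * t)) 0 = 1"
        by (simp add: winding_number_circlepath_centre)
      then show ?thesis using True e by (simp add: coordinate_loop_def deg_def)
    next
      case False
      have "winding_number (\<lambda>t. 1) 0 = 0" by (rule winding_number_constI[of 1]) auto
      then show ?thesis using that False by (simp add: coordinate_loop_def deg_def)
    qed
    then have "L (coordinate_loop I e) = (\<Prod>e' \<in> I. if e' = e then \<rho> e' else 1)"
      unfolding L_def by (intro prod.cong) (auto simp: P0 P1)
    then show ?thesis using assms(1) e by (simp add: prod.delta)
  qed
  ultimately show ?thesis unfolding torus_local_system_def by blast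
qed

section \<open>Twisted relative singular homology\<close>

text \<open>An \<open>n\<close>-chain is a finite sum of singular simplices \<open>\<sigma>\<close> with coefficients in the fibre at the
  image of vertex 0 of \<open>\<sigma>\<close>, this fibre being identified with \<open>'r\<close>. Only face 0 moves that vertex;
  its coefficient is transported along the edge from vertex 0 to vertex 1.\<close>

type_synonym ('a, 'r) twisted_chain = "((nat \<Rightarrow> real) \<Rightarrow> 'a) \<Rightarrow>\<^sub>0 'r"

definition twisted_chains :: "nat \<Rightarrow> 'a topology \<Rightarrow> ('a, 'r::comm_ring_1) twisted_chain set"
  where "twisted_chains n X = {c. Poly_Mapping.keys c \<subseteq> singular_simplex_set n X}"

definition first_edge :: "((nat \<Rightarrow> real) \<Rightarrow> 'a) \<Rightarrow> real \<Rightarrow> 'a"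
  where "first_edge \<sigma> t = \<sigma> (\<lambda>i. if i = 0 then 1 - t else if i = 1 then t else 0)"

definition twisted_boundary ::
    "((real \<Rightarrow> 'a) \<Rightarrow> 'r) \<Rightarrow> nat \<Rightarrow> ('a, 'r::comm_ring_1) twisted_chain \<Rightarrow> ('a, 'r) twisted_chain"
  where "twisted_boundary L n c =
    (if n = 0 then 0 else
     \<Sum>\<sigma> \<in> Poly_Mapping.keys c. \<Sum>k\<le>n.
       Poly_Mapping.single (singular_face n k \<sigma>)
         ((-1) ^ k * (if k = 0 then L (first_edge \<sigma>) else 1) * Poly_Mapping.lookup c \<sigma>))"

definition twisted_relcycles ::
    "((real \<Rightarrow> 'a) \<Rightarrow> 'r) \<Rightarrow> nat \<Rightarrow> 'a topology \<Rightarrow> 'a set \<Rightarrow> ('a, 'r::comm_ring_1) twisted_chain set"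
  where "twisted_relcycles L n X S =
    {c \<in> twisted_chains n X. twisted_boundary L n c \<in> twisted_chains (n - 1) (subtopology X S)}"

definition twisted_relboundaries ::
    "((real \<Rightarrow> 'a) \<Rightarrow> 'r) \<Rightarrow> nat \<Rightarrow> 'a topology \<Rightarrow> 'a set \<Rightarrow> ('a, 'r::comm_ring_1) twisted_chain set"
  where "twisted_relboundaries L n X S =
    {c. \<exists>b \<in> twisted_chains (Suc n) X.
          twisted_boundary L (Suc n) b - c \<in> twisted_chains n (subtopology X S)}"

definition twisted_relcycle_module ::
    "((real \<Rightarrow> 'a) \<Rightarrow> 'r) \<Rightarrow> nat \<Rightarrow> 'a topology \<Rightarrow> 'a set \<Rightarrow> ('r::comm_ring_1, ('a, 'r) twisted_chain) module"
  where "twisted_relcycle_module L n X S =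
    \<lparr>carrier = twisted_relcycles L n X S, monoid.mult = (\<lambda>_ _. undefined), one = undefined,
     zero = 0, add = (+), smult = (\<lambda>r. Poly_Mapping.map ((*) r))\<rparr>"

definition twisted_homology ::
    "((real \<Rightarrow> 'a) \<Rightarrow> 'r) \<Rightarrow> nat \<Rightarrow> 'a topology \<Rightarrow> 'a set \<Rightarrow> ('r::comm_ring_1, ('a, 'r) twisted_chain set) module"
  where "twisted_homology L n X S =
    quotient_module (twisted_relcycle_module L n X S) (twisted_relboundaries L n X S)"

definition homology_class ::
    "((real \<Rightarrow> 'a) \<Rightarrow> 'r) \<Rightarrow> nat \<Rightarrow> 'a topology \<Rightarrow> 'a set \<Rightarrow> ('a, 'r::comm_ring_1) twisted_chain
      \<Rightarrow> ('a, 'r) twisted_chain set"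
  where "homology_class L n X S c =
    twisted_relboundaries L n X S +>\<^bsub>twisted_relcycle_module L n X S\<^esub> c"

text \<open>The chain of a cube \<open>Q\<close> on the coordinates \<open>t\<^sub>0, \<dots>, t\<^bsub>k-1\<^esub>\<close>: the standard triangulation of
  \<open>[0,1]\<^sup>k\<close> by the \<open>k!\<close> simplices that run from the vertex \<open>(1,\<dots>,1)\<close> down to \<open>(0,\<dots>,0)\<close>, coordinate
  \<open>j\<close> dropping from 1 to 0 at step \<open>\<pi> j\<close>. Hence all of them have \<open>(1,\<dots>,1)\<close> as vertex 0, and the
  coefficient is the generator 1 of the fibre there, up to the sign \<open>(-1)\<^sup>k sign \<pi>\<close> comparing the
  orientation of the simplex with that of the cube.\<close>

definition cube_simplex :: "(nat \<Rightarrow> nat) \<Rightarrow> (nat \<Rightarrow> real) \<Rightarrow> nat \<Rightarrow> real"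
  where "cube_simplex \<pi> x j = (\<Sum>m\<le>\<pi> j. x m)"

definition cube_chain :: "nat \<Rightarrow> ((nat \<Rightarrow> real) \<Rightarrow> 'a) \<Rightarrow> ('a, 'r::comm_ring_1) twisted_chain"
  where "cube_chain k Q =
    (\<Sum>\<pi> | \<pi> permutes {..<k}.
       Poly_Mapping.single (\<lambda>x \<in> standard_simplex k. Q (cube_simplex \<pi> x))
         (of_int ((-1) ^ k * sign \<pi>)))"

section \<open>Configuration spaces\<close>

definition quotient_topology :: "'a topology \<Rightarrow> ('a \<Rightarrow> 'b) \<Rightarrow> 'b topology"
  where "quotient_topology X f =
    topology (\<lambda>U. U \<subseteq> f ` topspace X \<and> openin X {x \<in> topspace X. f x \<in> U})"

lemma openin_quotient_topology:
  "openin (quotient_topology X f) U \<longleftrightarrow> U \<subseteq> f ` topspace X \<and> openin X {x \<in> topspace X. f x \<in> U}"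
proof -
  have "istopology (\<lambda>U. U \<subseteq> f ` topspace X \<and> openin X {x \<in> topspace X. f x \<in> U})"
    unfolding istopology_def
  proof (intro conjI allI impI)
    fix S T
    assume S: "S \<subseteq> f ` topspace X \<and> openin X {x \<in> topspace X. f x \<in> S}"
      and T: "T \<subseteq> f ` topspace X \<and> openin X {x \<in> topspace X. f x \<in> T}"
    show "S \<inter> T \<subseteq> f ` topspace X" using S by blast
    have "{x \<in> topspace X. f x \<in> S \<inter> T} = {x \<in> topspace X. f x \<in> S} \<inter> {x \<in> topspace X. f x \<in> T}"
      by blast
    then show "openin X {x \<in> topspace X. f x \<in> S \<inter> T}" using S T by (simp add: openin_Int)
  next
    fix K
    assume K: "\<forall>S\<in>K. S \<subseteq> f ` topspace X \<and> openin X {x \<in> topspace X. f x \<in> S}"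
    show "\<Union> K \<subseteq> f ` topspace X" using K by blast
    have "{x \<in> topspace X. f x \<in> \<Union> K} = (\<Union>S\<in>K. {x \<in> topspace X. f x \<in> S})" by blast
    then show "openin X {x \<in> topspace X. f x \<in> \<Union> K}" using K by auto
  qed
  then show ?thesis by (simp add: quotient_topology_def)
qed

lemma quotient_map_quotient_topology: "quotient_map X (quotient_topology X f) f"
proof -
  have "openin (quotient_topology X f) (f ` topspace X)"
    unfolding openin_quotient_topology by (auto intro: back_subst[of "openin X", OF openin_topspace])
  then have "topspace (quotient_topology X f) = f ` topspace X"
    by (metis openin_quotient_topology openin_subset openin_topspace subset_antisym)
  then show ?thesis unfolding quotient_map_def openin_quotient_topology by blast
qed

text \<open>Colours are the indices \<open>1, \<dots>, l\<close> of the simple roots; \<open>c i\<close> is the number of points of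
  colour \<open>i\<close>. A configuration maps each colour to its set of points (and every other index to the
  empty set).\<close>

definition num_points :: "nat \<Rightarrow> (nat \<Rightarrow> nat) \<Rightarrow> nat"
  where "num_points l c = (\<Sum>i = 1..l. c i)"

definition disk :: "complex set"
  where "disk = {z. \<bar>Re z\<bar> \<le> 1 \<and> \<bar>Im z\<bar> \<le> 1}"

definition vertical_sides :: "complex set"
  where "vertical_sides = {z \<in> disk. \<bar>Re z\<bar> = 1}"

definition point_labels :: "nat \<Rightarrow> (nat \<Rightarrow> nat) \<Rightarrow> (nat \<times> nat) set"
  where "point_labels l c = (SIGMA i:{1..l}. {..<c i})"

definition ordered_conf :: "nat \<Rightarrow> (nat \<Rightarrow> nat) \<Rightarrow> (nat \<times> nat \<Rightarrow> complex) topology"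
  where "ordered_conf l c =
    subtopology (product_topology (\<lambda>_. top_of_set disk) (point_labels l c))
      {z. inj_on z (point_labels l c)}"

text \<open>The fibres of the following map are the orbits of the product of the symmetric groups.\<close>

definition forget_order ::
    "nat \<Rightarrow> (nat \<Rightarrow> nat) \<Rightarrow> (nat \<times> nat \<Rightarrow> complex) \<Rightarrow> nat \<Rightarrow> complex set"
  where "forget_order l c z i = {z (i, k) | k. (i, k) \<in> point_labels l c}"

definition conf :: "nat \<Rightarrow> (nat \<Rightarrow> nat) \<Rightarrow> (nat \<Rightarrow> complex set) topology"
  where "conf l c = quotient_topology (ordered_conf l c) (forget_order l c)"

definition conf_sides :: "nat \<Rightarrow> (nat \<Rightarrow> nat) \<Rightarrow> (nat \<Rightarrow> complex set) set"
  where "conf_sides l c =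
    {z \<in> topspace (conf l c). \<exists>i \<in> {1..l}. z i \<inter> vertical_sides \<noteq> {}}"

section \<open>The local system on configuration spaces\<close>

definition dir_sq :: "complex \<Rightarrow> complex \<Rightarrow> complex"
  where "dir_sq z w = ((w - z) / of_real (cmod (w - z)))\<^sup>2"

text \<open>The product over \<open>i < j\<close> does not depend on the numbering of the points, since
  \<^const>\<open>dir_sq\<close> is symmetric; in the definition the points are listed lexicographically.\<close>

definition lex_less :: "complex \<Rightarrow> complex \<Rightarrow> bool"
  where "lex_less z w \<longleftrightarrow> Re z < Re w \<or> (Re z = Re w \<and> Im z < Im w)"

definition f_map :: "complex set \<Rightarrow> complex"
  where "f_map Z = (\<Prod>(z, w) \<in> {(z, w) \<in> Z \<times> Z. lex_less z w}. dir_sq z w)"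

definition g_map :: "complex set \<Rightarrow> complex set \<Rightarrow> complex"
  where "g_map Z W = (\<Prod>z \<in> Z. \<Prod>w \<in> W. dir_sq z w)"

lemma dir_sq_commute: "dir_sq z w = dir_sq w z"
proof -
  have "w - z = - (z - w)" by simp
  then show ?thesis unfolding dir_sq_def by (metis minus_divide_left norm_minus_cancel power2_minus)
qed

lemma f_map_enumeration:
  fixes n :: nat
  assumes "bij_betw z {..<n} Z"
  shows "f_map Z = (\<Prod>(i, j) \<in> {(i, j). i < j \<and> j < n}. dir_sq (z i) (z j))"
proof -
  define y where "y = inv_into {..<n} z"
  have inj: "inj_on z {..<n}" and im: "z ` {..<n} = Z"
    using assms by (auto simp: bij_betw_def)
  have yz: "y (z i) = i" if "i < n" for i
    using inj that by (simp add: y_def)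
  have zy: "z (y w) = w" "y w < n" if "w \<in> Z" for w
    using that f_inv_into_f[of w z "{..<n}"] inv_into_into[of w z "{..<n}"] im
    unfolding y_def by simp_all
  have total: "lex_less u v \<or> lex_less v u" if "u \<noteq> v" for u v
    using that by (auto simp: lex_less_def complex_eq_iff)
  have asym: "\<not> lex_less v u" if "lex_less u v" for u v
    using that by (auto simp: lex_less_def)
  have irr: "\<not> lex_less u u" for u by (simp add: lex_less_def)
  have zne: "z i \<noteq> z j" if "i < j" "j < n" for i j
  proof
    assume "z i = z j"
    moreover have "i < n" using that by simp
    ultimately show False using yz[of i] yz[of j] that by simp
  qed
  have zZ: "z i \<in> Z" if "i < n" for i using im that by auto
  show ?thesis unfolding f_map_def
  proof (rule prod.reindex_bij_witness[where
        i = "\<lambda>(i, j). if lex_less (z i) (z j) then (z i, z j) else (z j, z i)" and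
        j = "\<lambda>(u, v). if y u < y v then (y u, y v) else (y v, y u)"])
    fix p assume p: "p \<in> {(i, j). i < j \<and> j < n}"
    then obtain i j where ij: "p = (i, j)" "i < j" "j < n" by auto
    then have "i < n" by simp
    show "(case case p of (i, j) \<Rightarrow> if lex_less (z i) (z j) then (z i, z j) else (z j, z i) of
        (u, v) \<Rightarrow> if y u < y v then (y u, y v) else (y v, y u)) = p"
      using ij \<open>i < n\<close> by (simp add: yz)
    show "(case p of (i, j) \<Rightarrow> if lex_less (z i) (z j) then (z i, z j) else (z j, z i))
        \<in> {(z, w) \<in> Z \<times> Z. lex_less z w}"
      using ij \<open>i < n\<close> zne[of i j] total[of "z i" "z j"] by (auto simp: zZ)
  next
    fix p assume "p \<in> {(z, w) \<in> Z \<times> Z. lex_less z w}"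
    then obtain u v where uv: "p = (u, v)" "u \<in> Z" "v \<in> Z" "lex_less u v" by auto
    then have "y u \<noteq> y v" using zy irr by metis
    with uv show "(case case p of (u, v) \<Rightarrow> if y u < y v then (y u, y v) else (y v, y u) of
        (i, j) \<Rightarrow> if lex_less (z i) (z j) then (z i, z j) else (z j, z i)) = p"
      using asym by (simp add: zy)
    show "(case p of (u, v) \<Rightarrow> if y u < y v then (y u, y v) else (y v, y u))
        \<in> {(i, j). i < j \<and> j < n}"
      using uv \<open>y u \<noteq> y v\<close> by (simp add: zy)
    show "(case case p of (u, v) \<Rightarrow> if y u < y v then (y u, y v) else (y v, y u) of
        (i, j) \<Rightarrow> dir_sq (z i) (z j)) = (case p of (z, w) \<Rightarrow> dir_sq z w)"
      using uv by (simp add: zy dir_sq_commute)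
  qed
qed

text \<open>The torus has the coordinate \<open>(i, i)\<close> for \<open>f\<close> on the points of colour \<open>i\<close>, and \<open>(i, j)\<close>
  with \<open>i < j\<close> for \<open>g\<close> on the points of colours \<open>i\<close> and \<open>j\<close>.\<close>

definition torus_coords :: "nat \<Rightarrow> (nat \<times> nat) set"
  where "torus_coords l = {(i, j). 1 \<le> i \<and> i \<le> j \<and> j \<le> l}"

definition Phi :: "nat \<Rightarrow> (nat \<Rightarrow> complex set) \<Rightarrow> nat \<times> nat \<Rightarrow> complex"
  where "Phi l z = (\<lambda>(i, j) \<in> torus_coords l. if i = j then f_map (z i) else g_map (z i) (z j))"

definition rotate_conf :: "(nat \<Rightarrow> complex set) \<Rightarrow> nat \<Rightarrow> complex set"
  where "rotate_conf z i = (\<lambda>w. \<i> * w) ` z i"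

definition W_map :: "nat \<Rightarrow> (nat \<Rightarrow> complex set) \<Rightarrow> nat \<times> nat \<Rightarrow> complex"
  where "W_map l = Phi l \<circ> rotate_conf"

definition cartan_datum :: "nat \<Rightarrow> (nat \<Rightarrow> nat \<Rightarrow> int) \<Rightarrow> (nat \<Rightarrow> nat) \<Rightarrow> bool"
  where "cartan_datum l a d \<longleftrightarrow>
    (\<forall>i \<in> {1..l}. a i i = 2) \<and>
    (\<forall>i \<in> {1..l}. \<forall>j \<in> {1..l}. i \<noteq> j \<longrightarrow> a i j \<le> 0 \<and> (a i j = 0 \<longleftrightarrow> a j i = 0)) \<and>
    (\<forall>i \<in> {1..l}. d i > 0) \<and>
    (\<forall>i \<in> {1..l}. \<forall>j \<in> {1..l}. int (d i) * a i j = int (d j) * a j i) \<and>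
    (\<forall>x :: nat \<Rightarrow> real. (\<exists>i \<in> {1..l}. x i \<noteq> 0) \<longrightarrow>
       (\<Sum>i = 1..l. \<Sum>j = 1..l. x i * (real (d i) * of_int (a i j)) * x j) > 0)"

text \<open>The ring of Laurent polynomials in \<open>q\<^bsup>1/2\<^esup>\<close> over the integers is the group ring of the additive
  group of integers; \<open>q_half_pow n\<close> is \<open>q\<^bsup>n/2\<^esup>\<close>.\<close>

type_synonym laurent = "int \<Rightarrow>\<^sub>0 int"

definition q_half_pow :: "int \<Rightarrow> laurent"
  where "q_half_pow n = Poly_Mapping.single n 1"

definition laurent_ring :: "laurent ring"
  where "laurent_ring =
    \<lparr>carrier = UNIV, monoid.mult = (*), one = 1, zero = 0, add = (+)\<rparr>"

lemma cring_laurent_ring: "cring laurent_ring"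
proof -
  have "\<exists>y. x + y = 0" for x :: laurent
    using add.right_inverse by blast
  then show ?thesis
    unfolding laurent_ring_def using add.right_inverse
    by unfold_locales (auto simp: algebra_simps Units_def)
qed

definition root_form :: "(nat \<Rightarrow> nat \<Rightarrow> int) \<Rightarrow> (nat \<Rightarrow> nat) \<Rightarrow> nat \<Rightarrow> nat \<Rightarrow> int"
  where "root_form a d i j = int (d i) * a i j"

definition monodromy :: "(nat \<Rightarrow> nat \<Rightarrow> int) \<Rightarrow> (nat \<Rightarrow> nat) \<Rightarrow> nat \<times> nat \<Rightarrow> laurent"
  where "monodromy a d = (\<lambda>(i, j).
    if i = j then - q_half_pow (2 * int (d i)) else q_half_pow (root_form a d i j))"

lemma monodromy_local_system_exists: "\<exists>L. torus_local_system (torus_coords l) (monodromy a d) L"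
proof (rule torus_local_system_exists)
  have "torus_coords l \<subseteq> {..l} \<times> {..l}" by (auto simp: torus_coords_def)
  then show "finite (torus_coords l)" by (rule finite_subset) simp
  have "1 = q_half_pow n * q_half_pow (- n)" for n
    by (simp add: q_half_pow_def mult_single)
  then have "q_half_pow n dvd 1" for n by (metis dvd_triv_left)
  then show "monodromy a d e dvd 1" for e
    by (cases e) (simp add: monodromy_def)
qed

abbreviation conf_homology ::
    "nat \<Rightarrow> (nat \<Rightarrow> nat) \<Rightarrow> ((real \<Rightarrow> nat \<times> nat \<Rightarrow> complex) \<Rightarrow> laurent)
      \<Rightarrow> (laurent, (nat \<Rightarrow> complex set, laurent) twisted_chain set) module"
  where "conf_homology l c L \<equiv>
    twisted_homology (pullback_local_system (W_map l) L) (num_points l c) (conf l c) (conf_sides l c)"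

section \<open>The classes of the horizontal arcs\<close>

definition colour_words :: "nat \<Rightarrow> (nat \<Rightarrow> nat) \<Rightarrow> nat list set"
  where "colour_words l c =
    {r. length r = num_points l c \<and> set r \<subseteq> {1..l} \<and> (\<forall>i \<in> {1..l}. count_list r i = c i)}"

text \<open>The arcs are numbered from 0, so that \<open>r ! j\<close>, \<open>h j\<close> and \<open>t j\<close> belong together.\<close>

definition arc_cube :: "(nat \<Rightarrow> real) \<Rightarrow> nat list \<Rightarrow> (nat \<Rightarrow> real) \<Rightarrow> nat \<Rightarrow> complex set"
  where "arc_cube h r t i = {Complex (-1 + 2 * t j) (h j) | j. j < length r \<and> r ! j = i}"

definition F_class ::
    "nat \<Rightarrow> (nat \<Rightarrow> nat) \<Rightarrow> ((real \<Rightarrow> nat \<times> nat \<Rightarrow> complex) \<Rightarrow> laurent) \<Rightarrow> (nat \<Rightarrow> real)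
      \<Rightarrow> nat list \<Rightarrow> (nat \<Rightarrow> complex set, laurent) twisted_chain set"
  where "F_class l c L h r =
    homology_class (pullback_local_system (W_map l) L) (num_points l c) (conf l c) (conf_sides l c)
      (cube_chain (length r) (arc_cube h r))"

definition arc_heights :: "nat \<Rightarrow> (nat \<Rightarrow> real) \<Rightarrow> bool"
  where "arc_heights k h \<longleftrightarrow>
    (\<forall>j < k. -1 < h j \<and> h j < 1) \<and> (\<forall>i j. i < j \<longrightarrow> j < k \<longrightarrow> h j < h i)"

end

theory Submission
  imports Defs
begin

text \<open>Spreading the points of a configuration horizontally pushes one of them to a vertical side unless
  the real parts are small compared to the vertical gaps. In that case the configuration can first be
  straightened, which puts its points at the prescribed heights, that is, into the cell swept out by
  the arcs of one word. This homotopy starts at the identity, preserves \<open>S\<close> and the cells, and ends with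
  an open cover of \<open>Conf\<close> mapped into \<open>S\<close> and the cells. By barycentric subdivision the relative
  homology is generated by chains in single cells. Distinct cells meet only inside \<open>S\<close>, the local system
  is trivial on each of them because a cube is convex, and the top relative homology of a cube modulo
  its frontier is generated by the fundamental class, by induction over the dimension.\<close>

section \<open>Linear algebra of finitely supported functions\<close>

text \<open>Local coefficients are handled by naturality. Over a convex set, transport from a base
  point trivialises the system, so an untwisted integral chain on a simplex, prism or cube can be
  pushed forward to a twisted chain. Boundary identities are therefore proved once, integrally, on
  the model. The rank of a point by height jumps where two heights meet, so moving points to the
  arcs cannot be continuous everywhere. At such configurations the vertical gap is 0, while the
  width is positive because the points are distinct. Straightening is therefore complete up to width
  gap / 2 and fades out until the width equals the gap. Spreading reaches a side when width >= gap /
  3; since 1/3 < 1/2, the open conditions width > gap / 3 and width < gap / 2 together cover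
  everything. The cells have half the dimension of the configuration space and are not open. So
  smallness is measured by the open cover, and only the end of the homotopy maps into the cells. The
  same scheme serves a second time in the induction for the cube, for its frontier modulo all faces
  but one.\<close>

abbreviation "keys \<equiv> Poly_Mapping.keys"
abbreviation "lookup \<equiv> Poly_Mapping.lookup"
abbreviation "single \<equiv> Poly_Mapping.single"

definition pm_scale :: "'r::comm_ring_1 \<Rightarrow> ('a \<Rightarrow>\<^sub>0 'r) \<Rightarrow> 'a \<Rightarrow>\<^sub>0 'r"
  where "pm_scale r = Poly_Mapping.map ((*) r)"

lemma lookup_pm_scale [simp]: "lookup (pm_scale r c) k = r * lookup c k"
  by (simp add: pm_scale_def Poly_Mapping.map.rep_eq when_def)

lemma pm_scale_simps [simp]:
  "pm_scale r 0 = 0" "pm_scale 0 c = 0" "pm_scale 1 c = c"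
  "pm_scale r (pm_scale s c) = pm_scale (r * s) c"
  "pm_scale r (single a s) = single a (r * s)"
  by (rule poly_mapping_eqI; simp add: lookup_single when_def mult_ac)+

lemma pm_scale_distrib:
  "pm_scale r (c + d) = pm_scale r c + pm_scale r d"
  "pm_scale r (c - d) = pm_scale r c - pm_scale r d"
  "pm_scale r (- c) = - pm_scale r c"
  "pm_scale (r + s) c = pm_scale r c + pm_scale s c"
  "pm_scale (r - s) c = pm_scale r c - pm_scale s c"
  by (rule poly_mapping_eqI; simp add: lookup_add lookup_minus algebra_simps)+

lemma pm_scale_sum: "pm_scale r (\<Sum>i\<in>I. f i) = (\<Sum>i\<in>I. pm_scale r (f i))"
  by (induction I rule: infinite_finite_induct) (auto simp: pm_scale_distrib)

lemma keys_pm_scale: "keys (pm_scale r c) \<subseteq> keys c"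
  by (auto simp: in_keys_iff)

text \<open>The linear map of free modules with prescribed values on the basis, the analogue of
  \<open>frag_extend\<close> over an arbitrary ring. The chain operators below have this shape, so
  \<open>pm_extend_extend\<close> reduces identities between composites to single simplices.\<close>

definition pm_extend :: "('a \<Rightarrow> ('b \<Rightarrow>\<^sub>0 'r)) \<Rightarrow> ('a \<Rightarrow>\<^sub>0 'r::comm_ring_1) \<Rightarrow> ('b \<Rightarrow>\<^sub>0 'r)"
  where "pm_extend g c = (\<Sum>a\<in>keys c. pm_scale (lookup c a) (g a))"

lemma pm_extend_superset:
  assumes "finite A" "keys c \<subseteq> A"
  shows "pm_extend g c = (\<Sum>a\<in>A. pm_scale (lookup c a) (g a))"
  unfolding pm_extend_def
  by (rule sum.mono_neutral_left) (use assms in \<open>auto simp: in_keys_iff\<close>)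

lemma pm_extend_0 [simp]: "pm_extend g 0 = 0"
  by (simp add: pm_extend_def)

lemma pm_extend_single [simp]: "pm_extend g (single a r) = pm_scale r (g a)"
  by (simp add: pm_extend_def)

lemma pm_extend_add: "pm_extend g (c + d) = pm_extend g c + pm_extend g d"
proof -
  have "keys (c + d) \<subseteq> keys c \<union> keys d" by (rule keys_add)
  then show ?thesis
    by (simp add: pm_extend_superset[of "keys c \<union> keys d"] lookup_add pm_scale_distrib sum.distrib)
qed

lemma pm_extend_scale: "pm_extend g (pm_scale r c) = pm_scale r (pm_extend g c)"
  using pm_extend_superset[OF finite_keys keys_pm_scale, of g r c]
  by (simp add: pm_extend_def pm_scale_sum)

lemma pm_scale_minus_one: "pm_scale (- 1) d = - d"
  by (rule poly_mapping_eqI) simp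

lemma pm_extend_minus: "pm_extend g (- c) = - pm_extend g c"
  by (metis pm_extend_scale pm_scale_minus_one)

lemma pm_extend_diff: "pm_extend g (c - d) = pm_extend g c - pm_extend g d"
  using pm_extend_add[of g c "- d"] by (simp add: pm_extend_minus)

lemma pm_extend_sum: "pm_extend g (\<Sum>i\<in>I. f i) = (\<Sum>i\<in>I. pm_extend g (f i))"
  by (induction I rule: infinite_finite_induct) (auto simp: pm_extend_add)

lemma pm_expand: "c = (\<Sum>a\<in>keys c. single a (lookup c a))"
  by (rule poly_mapping_eqI) (simp add: lookup_sum lookup_single when_def in_keys_iff)

lemma pm_extend_ident [simp]: "pm_extend (\<lambda>a. single a 1) c = c"
  by (subst (2) pm_expand[of c]) (simp add: pm_extend_def)

lemma pm_extend_cong: "(\<And>a. a \<in> keys c \<Longrightarrow> f a = g a) \<Longrightarrow> pm_extend f c = pm_extend g c"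
  by (simp add: pm_extend_def)

lemma pm_extend_extend: "pm_extend f (pm_extend g c) = pm_extend (\<lambda>a. pm_extend f (g a)) c"
  by (simp add: pm_extend_def[of g] pm_extend_def[of "\<lambda>a. pm_extend f (g a)"] pm_extend_sum pm_extend_scale)

lemma pm_extend_fun:
  "pm_extend (\<lambda>a. f a + g a) c = pm_extend f c + pm_extend g c"
  "pm_extend (\<lambda>a. f a - g a) c = pm_extend f c - pm_extend g c"
  "pm_extend (\<lambda>a. - f a) c = - pm_extend f c"
  "pm_extend (\<lambda>a. pm_scale r (f a)) c = pm_scale r (pm_extend f c)"
  by (simp_all add: pm_extend_def pm_scale_distrib sum.distrib sum_subtractf sum_negf pm_scale_sum mult.commute)

lemma keys_pm_extend: "keys (pm_extend g c) \<subseteq> (\<Union>a\<in>keys c. keys (g a))"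
proof -
  have "keys (pm_extend g c) \<subseteq> (\<Union>a\<in>keys c. keys (pm_scale (lookup c a) (g a)))"
    unfolding pm_extend_def by (rule keys_sum)
  also have "\<dots> \<subseteq> (\<Union>a\<in>keys c. keys (g a))" by (intro UN_mono keys_pm_scale) simp
  finally show ?thesis .
qed

text \<open>Change of coefficients; through it the theory of \<open>chain_boundary\<close>,
  \<open>chain_map\<close> and \<open>singular_subdivision\<close> becomes available for twisted
  chains.\<close>

definition pm_of_int :: "('a \<Rightarrow>\<^sub>0 int) \<Rightarrow> 'a \<Rightarrow>\<^sub>0 'r::comm_ring_1"
  where "pm_of_int = Poly_Mapping.map of_int"

lemma lookup_pm_of_int [simp]: "lookup (pm_of_int c) k = of_int (lookup c k)"
  by (simp add: pm_of_int_def Poly_Mapping.map.rep_eq when_def)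

lemma pm_of_int_simps [simp]:
  "pm_of_int 0 = 0" "pm_of_int (c + d) = pm_of_int c + pm_of_int d"
  "pm_of_int (c - d) = pm_of_int c - pm_of_int d" "pm_of_int (- c) = - pm_of_int c"
  "pm_of_int (frag_cmul n c) = pm_scale (of_int n) (pm_of_int c)"
  "pm_of_int (single a n) = single a (of_int n)"
  by (rule poly_mapping_eqI; simp add: lookup_add lookup_minus lookup_single when_def)+

lemma pm_of_int_sum: "pm_of_int (\<Sum>i\<in>I. f i) = (\<Sum>i\<in>I. pm_of_int (f i))"
  by (induction I rule: infinite_finite_induct) auto

lemma pm_of_int_extend:
  "(pm_of_int (frag_extend f c) :: _ \<Rightarrow>\<^sub>0 'r::comm_ring_1) = pm_extend (\<lambda>a. pm_of_int (f a)) (pm_of_int c)"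
proof -
  have "keys (pm_of_int c :: _ \<Rightarrow>\<^sub>0 'r) \<subseteq> keys c" by (auto simp: in_keys_iff)
  then show ?thesis
    by (subst pm_extend_superset[of "keys c"]) (simp_all add: frag_extend_def pm_of_int_sum)
qed

lemma keys_pm_of_int: "keys (pm_of_int c) \<subseteq> keys c"
  by (auto simp: in_keys_iff)

section \<open>Twisted chains\<close>

lemma twisted_chains_0 [simp]: "0 \<in> twisted_chains n X"
  by (simp add: twisted_chains_def)

lemma twisted_chains_add [intro]:
  "c \<in> twisted_chains n X \<Longrightarrow> d \<in> twisted_chains n X \<Longrightarrow> c + d \<in> twisted_chains n X"
  using keys_add[of c d] by (auto simp: twisted_chains_def)

lemma twisted_chains_diff [intro]:
  "c \<in> twisted_chains n X \<Longrightarrow> d \<in> twisted_chains n X \<Longrightarrow> c - d \<in> twisted_chains n X"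
  using keys_diff[of c d] by (auto simp: twisted_chains_def)

lemma twisted_chains_minus [simp]: "- c \<in> twisted_chains n X \<longleftrightarrow> c \<in> twisted_chains n X"
  by (simp add: twisted_chains_def keys_minus)

lemma twisted_chains_sum:
  "(\<And>i. i \<in> I \<Longrightarrow> f i \<in> twisted_chains n X) \<Longrightarrow> (\<Sum>i\<in>I. f i) \<in> twisted_chains n X"
  by (induction I rule: infinite_finite_induct) auto

lemma twisted_chains_scale: "c \<in> twisted_chains n X \<Longrightarrow> pm_scale r c \<in> twisted_chains n X"
  using keys_pm_scale[of r c] by (auto simp: twisted_chains_def)

lemma twisted_chains_single:
  "r = 0 \<or> singular_simplex n X \<sigma> \<Longrightarrow> single \<sigma> r \<in> twisted_chains n X"
  by (auto simp: twisted_chains_def)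

lemma twisted_chains_extend:
  "(\<And>a. a \<in> keys c \<Longrightarrow> g a \<in> twisted_chains n X) \<Longrightarrow> pm_extend g c \<in> twisted_chains n X"
  unfolding pm_extend_def by (intro twisted_chains_sum twisted_chains_scale)

lemma twisted_chains_of_int: "singular_chain n X c \<Longrightarrow> pm_of_int c \<in> twisted_chains n X"
  using keys_pm_of_int by (fastforce simp: twisted_chains_def singular_chain_def)

lemma twisted_chains_subtopology:
  "c \<in> twisted_chains n (subtopology X S) \<longleftrightarrow>
    c \<in> twisted_chains n X \<and> (\<forall>\<sigma>\<in>keys c. \<sigma> ` standard_simplex n \<subseteq> S)"
  by (auto simp: twisted_chains_def singular_simplex_subtopology subset_iff)

definition simplex_boundary ::
    "((real \<Rightarrow> 'a) \<Rightarrow> 'r) \<Rightarrow> nat \<Rightarrow> ((nat \<Rightarrow> real) \<Rightarrow> 'a) \<Rightarrow> ('a, 'r::comm_ring_1) twisted_chain"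
  where "simplex_boundary L n \<sigma> =
    (if n = 0 then 0 else
     \<Sum>k\<le>n. single (singular_face n k \<sigma>) ((-1) ^ k * (if k = 0 then L (first_edge \<sigma>) else 1)))"

lemma twisted_boundary_extend: "twisted_boundary L n = pm_extend (simplex_boundary L n)"
  by (rule ext) (simp add: twisted_boundary_def simplex_boundary_def pm_extend_def pm_scale_sum mult_ac)

lemma twisted_boundary_linear:
  "twisted_boundary L n (c + d) = twisted_boundary L n c + twisted_boundary L n d"
  "twisted_boundary L n (c - d) = twisted_boundary L n c - twisted_boundary L n d"
  "twisted_boundary L n (- c) = - twisted_boundary L n c"
  "twisted_boundary L n 0 = 0"
  "twisted_boundary L n (pm_scale r c) = pm_scale r (twisted_boundary L n c)"
  by (simp_all add: twisted_boundary_extend pm_extend_add pm_extend_diff pm_extend_minus pm_extend_scale)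

lemma twisted_boundary_sum:
  "twisted_boundary L n (\<Sum>i\<in>I. f i) = (\<Sum>i\<in>I. twisted_boundary L n (f i))"
  by (simp add: twisted_boundary_extend pm_extend_sum)

lemma twisted_boundary_chain:
  assumes "c \<in> twisted_chains n X"
  shows "twisted_boundary L n c \<in> twisted_chains (n - 1) X"
  unfolding twisted_boundary_extend
proof (rule twisted_chains_extend)
  fix \<sigma> assume "\<sigma> \<in> keys c"
  then have "singular_simplex n X \<sigma>" using assms by (auto simp: twisted_chains_def)
  then have "n \<noteq> 0 \<Longrightarrow> k \<le> n \<Longrightarrow> singular_simplex (n - Suc 0) X (singular_face n k \<sigma>)" for k
    by (intro singular_simplex_singular_face) auto
  then show "simplex_boundary L n \<sigma> \<in> twisted_chains (n - 1) X"
    by (auto simp: simplex_boundary_def intro!: twisted_chains_sum twisted_chains_single)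
qed

lemma simplex_boundary_of_int:
  "n \<noteq> 0 \<Longrightarrow> simplex_boundary (\<lambda>_. 1) n \<sigma> =
    pm_of_int (\<Sum>k\<le>n. frag_cmul ((-1) ^ k) (frag_of (singular_face n k \<sigma>)))"
  by (simp add: simplex_boundary_def pm_of_int_sum)

text \<open>With trivial transport the faces carry the signs of the ordinary boundary. Degree 0 is
  treated apart because both boundaries are set to zero there.\<close>

lemma twisted_boundary_of_int:
  "twisted_boundary (\<lambda>_. 1 :: 'r::comm_ring_1) n (pm_of_int c) = pm_of_int (chain_boundary n c)"
proof (cases "n = 0")
  case True
  then show ?thesis by (simp add: twisted_boundary_def chain_boundary_def)
next
  case False
  then show ?thesis
    by (simp add: twisted_boundary_extend chain_boundary_def pm_of_int_extend)
      (rule pm_extend_cong, simp add: simplex_boundary_of_int)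
qed

section \<open>Parallel transport over convex sets\<close>

text \<open>The ambient space of the standard simplices of the homology library. Prisms and cubes
  are placed in the same function space, so that one push-forward construction serves all of
  them.\<close>

abbreviation "real_top Z \<equiv> subtopology (powertop_real (UNIV::nat set)) Z"

definition seg :: "(nat \<Rightarrow> real) \<Rightarrow> (nat \<Rightarrow> real) \<Rightarrow> real \<Rightarrow> nat \<Rightarrow> real"
  where "seg x y u = (\<lambda>i. (1 - u) * x i + u * y i)"

definition seg_convex :: "(nat \<Rightarrow> real) set \<Rightarrow> bool"
  where "seg_convex Z \<longleftrightarrow> (\<forall>x\<in>Z. \<forall>y\<in>Z. \<forall>u\<in>{0..1}. seg x y u \<in> Z)"

lemma seg_simps [simp]: "seg x y 0 = x" "seg x y 1 = y" "seg x x u = x"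
  by (auto simp: seg_def algebra_simps)

text \<open>A path is a function on all reals, but only its values on \<open>{0..1}\<close> count:
  functions agreeing there are related by the constant homotopy.\<close>

lemma local_system_cong:
  assumes "rank_one_local_system X L" "pathin X g" "\<And>t. t \<in> {0..1} \<Longrightarrow> g t = h t"
  shows "L g = L h"
proof -
  have "homotopic_with (\<lambda>k. k 0 = g 0 \<and> k 1 = g 1) (top_of_set {0..1}) X g h"
    using assms(2,3) by (intro homotopic_with_equal) (auto simp: pathin_def)
  then show ?thesis using assms(1) unfolding rank_one_local_system_def by blast
qed

lemma pathin_compose: "pathin X g \<Longrightarrow> continuous_map X Y f \<Longrightarrow> pathin Y (f \<circ> g)"
  unfolding pathin_def by (rule continuous_map_compose)

lemma continuous_map_real_top:
  "continuous_map X (real_top Z) f \<longleftrightarrow>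
    (\<forall>i. continuous_map X euclideanreal (\<lambda>x. f x i)) \<and> f \<in> topspace X \<rightarrow> Z"
  by (simp add: continuous_map_in_subtopology continuous_map_componentwise_UNIV)

lemma continuous_map_real_top_coord: "continuous_map (real_top Z) euclideanreal (\<lambda>x. x i)"
  by (rule continuous_map_from_subtopology) (rule continuous_map_product_projection, simp)

lemma pathin_seg:
  assumes "seg_convex Z" "x \<in> Z" "y \<in> Z"
  shows "pathin (real_top Z) (seg x y)"
  using assms
  by (auto simp: pathin_def continuous_map_real_top seg_def[abs_def] seg_convex_def intro!: continuous_intros)

lemma pathin_concat:
  assumes "pathin (real_top Z) g" "pathin (real_top Z) h" "g 1 = h 0"
  shows "pathin (real_top Z) (concat_path g h)"
proof -
  have "concat_path g h = g +++ h" by (auto simp: concat_path_def joinpaths_def)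
  moreover have "path (\<lambda>t. g t i)" "path (\<lambda>t. h t i)" for i
    using assms by (auto simp: path_def pathin_def continuous_map_real_top)
  then have "path ((\<lambda>t. g t i) +++ (\<lambda>t. h t i))" for i
    using assms by (intro path_join_imp) (auto simp: pathstart_def pathfinish_def)
  then have "continuous_on {0..1} (\<lambda>t. (g +++ h) t i)" for i
    by (simp add: path_def joinpaths_def if_distrib if_distribR cong: if_cong)
  moreover have "(g +++ h) t \<in> Z" if "t \<in> {0..1}" for t
    using assms that by (auto simp: pathin_def continuous_map_real_top joinpaths_def Pi_iff)
  ultimately show ?thesis by (auto simp: pathin_def continuous_map_real_top)
qed

text \<open>The straight-line homotopy stays in \<open>Z\<close> and fixes the common
  endpoints.\<close>

lemma homotopic_paths_seg_convex:
  assumes "seg_convex Z" "pathin (real_top Z) g" "pathin (real_top Z) h" "g 0 = h 0" "g 1 = h 1"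
  shows "homotopic_with (\<lambda>k. k 0 = g 0 \<and> k 1 = g 1) (top_of_set {0..1}) (real_top Z) g h"
proof -
  let ?I = "top_of_set {0..1::real}"
  have c: "continuous_map ?I euclideanreal (\<lambda>t. k t i)" if "k \<in> {g, h}" for k i
    using assms that by (auto simp: pathin_def continuous_map_real_top)
  have "continuous_map (prod_topology ?I ?I) euclideanreal (\<lambda>p. k (snd p) i)" if "k \<in> {g, h}" for k i
    using continuous_map_compose[OF continuous_map_snd c[OF that]] unfolding o_def .
  moreover have "continuous_map (prod_topology ?I ?I) euclideanreal fst"
    using continuous_map_fst continuous_map_into_fulltopology by blast
  ultimately have "continuous_map (prod_topology ?I ?I) euclideanreal (\<lambda>p. seg (g (snd p)) (h (snd p)) (fst p) i)" for i
    unfolding seg_def by (intro continuous_intros) auto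
  moreover have "seg (g t) (h t) s \<in> Z" if "s \<in> {0..1}" "t \<in> {0..1}" for s t
    using assms that by (auto simp: pathin_def continuous_map_real_top Pi_iff seg_convex_def)
  ultimately have "continuous_map (prod_topology ?I ?I) (real_top Z) (\<lambda>p. seg (g (snd p)) (h (snd p)) (fst p))"
    by (auto simp: continuous_map_real_top)
  then show ?thesis
    unfolding homotopic_with_def
    by (intro exI[of _ "\<lambda>p. seg (g (snd p)) (h (snd p)) (fst p)"]) (use assms in auto)
qed

text \<open>The broken path from \<open>z\<close> through \<open>g 0\<close> to \<open>g 1\<close>
  and the direct segment are homotopic in the convex set. Hence transport from \<open>z\<close>
  trivialises the system along \<open>F\<close>.\<close>

lemma local_system_segment:
  assumes L: "rank_one_local_system X L" and F: "continuous_map (real_top Z) X F"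
    and Z: "seg_convex Z" "z \<in> Z" and g: "pathin (real_top Z) g"
  shows "L (F \<circ> g) * L (F \<circ> seg z (g 0)) = L (F \<circ> seg z (g 1))"
proof -
  have gZ: "g 0 \<in> Z" "g 1 \<in> Z" using g by (auto simp: pathin_def continuous_map_real_top Pi_iff)
  let ?s = "seg z (g 0)"
  have s: "pathin (real_top Z) ?s" using Z gZ by (intro pathin_seg)
  have "homotopic_with (\<lambda>k. k 0 = seg z (g 1) 0 \<and> k 1 = seg z (g 1) 1) (top_of_set {0..1}) (real_top Z)
      (seg z (g 1)) (concat_path ?s g)"
    using Z gZ s g by (intro homotopic_paths_seg_convex pathin_seg pathin_concat) (auto simp: concat_path_def)
  then have "homotopic_with (\<lambda>k. k 0 = (F \<circ> seg z (g 1)) 0 \<and> k 1 = (F \<circ> seg z (g 1)) 1) (top_of_set {0..1}) X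
      (F \<circ> seg z (g 1)) (F \<circ> concat_path ?s g)"
    by (rule homotopic_with_compose_continuous_map_left[OF _ F]) auto
  then have "L (F \<circ> seg z (g 1)) = L (F \<circ> concat_path ?s g)"
    using L unfolding rank_one_local_system_def by blast
  also have "F \<circ> concat_path ?s g = concat_path (F \<circ> ?s) (F \<circ> g)"
    by (auto simp: concat_path_def)
  also have "L \<dots> = L (F \<circ> g) * L (F \<circ> ?s)"
    using L pathin_compose[OF s F] pathin_compose[OF g F]
    unfolding rank_one_local_system_def by simp
  finally show ?thesis by (simp add: o_def)
qed

lemma local_system_const:
  assumes "rank_one_local_system X L" "x \<in> topspace X"
  shows "L (\<lambda>_. x) = 1"
  using assms unfolding rank_one_local_system_def by blast

lemma local_system_segment_self:
  assumes "rank_one_local_system X L" "continuous_map (real_top Z) X F" "z \<in> Z"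
  shows "L (F \<circ> seg z z) = 1"
proof -
  have "F \<circ> seg z z = (\<lambda>_. F z)" by auto
  then show ?thesis using assms local_system_const[of X L "F z"] by (auto simp: continuous_map_def Pi_iff)
qed

lemma local_system_segment_inverse:
  assumes "rank_one_local_system X L" "continuous_map (real_top Z) X F" "seg_convex Z" "z \<in> Z" "w \<in> Z"
  shows "L (F \<circ> seg w z) * L (F \<circ> seg z w) = 1"
  using local_system_segment[OF assms(1-4), of "seg w z"] pathin_seg[of Z w z] assms
    local_system_segment_self[of X L Z F z] by simp

lemma rank_one_trivial: "rank_one_local_system X (\<lambda>_. 1)"
  by (simp add: rank_one_local_system_def)

section \<open>Push-forward of untwisted chains on a convex set\<close>

definition vertex :: "nat \<Rightarrow> nat \<Rightarrow> real"
  where "vertex k = (\<lambda>i. if i = k then 1 else 0)"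

lemma first_edge_seg: "first_edge \<sigma> = \<sigma> \<circ> seg (vertex 0) (vertex 1)"
  unfolding first_edge_def seg_def vertex_def o_def
  by (intro ext arg_cong[of _ _ \<sigma>]) auto

lemma vertex_in_simplex [simp]: "vertex k \<in> standard_simplex n \<longleftrightarrow> k \<le> n"
  by (simp add: vertex_def)

lemma seg_convex_simplex: "seg_convex (standard_simplex n)"
  unfolding seg_convex_def seg_def using convex_standard_simplex[of _ n] by (metis atLeastAtMost_iff)

lemma simplical_face_vertex: "simplical_face k (vertex j) = vertex (if j < k then j else Suc j)"
  by (auto simp: simplical_face_def vertex_def fun_eq_iff)

text \<open>A coefficient lives in the fibre over vertex 0, so the generator over the base point
  \<open>z\<close> is carried there along the straight segment.\<close>

definition push_simplex where
  "push_simplex L F z k \<tau> = single (simplex_map k F \<tau>) (L (F \<circ> seg z (\<tau> (vertex 0))))"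

definition push :: "((real \<Rightarrow> 'a) \<Rightarrow> 'r::comm_ring_1) \<Rightarrow> ((nat \<Rightarrow> real) \<Rightarrow> 'a) \<Rightarrow> (nat \<Rightarrow> real) \<Rightarrow> nat
    \<Rightarrow> (nat \<Rightarrow> real, 'r) twisted_chain \<Rightarrow> ('a, 'r) twisted_chain"
  where "push L F z k = pm_extend (push_simplex L F z k)"

lemma push_linear:
  "push L F z k (c + d) = push L F z k c + push L F z k d"
  "push L F z k (c - d) = push L F z k c - push L F z k d"
  "push L F z k (- c) = - push L F z k c"
  "push L F z k 0 = 0"
  "push L F z k (pm_scale r c) = pm_scale r (push L F z k c)"
  by (simp_all add: push_def pm_extend_add pm_extend_diff pm_extend_minus pm_extend_scale)

lemma push_sum: "push L F z k (\<Sum>i\<in>I. f i) = (\<Sum>i\<in>I. push L F z k (f i))"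
  by (simp add: push_def pm_extend_sum)

lemma push_chain:
  assumes "continuous_map (real_top Z) X F" "c \<in> twisted_chains k (real_top Z)"
  shows "push L F z k c \<in> twisted_chains k X"
  unfolding push_def
proof (rule twisted_chains_extend)
  fix \<tau> assume "\<tau> \<in> keys c"
  then have "singular_simplex k X (simplex_map k F \<tau>)"
    using assms by (intro singular_simplex_simplex_map) (auto simp: twisted_chains_def)
  then show "push_simplex L F z k \<tau> \<in> twisted_chains k X"
    by (simp add: push_simplex_def twisted_chains_single)
qed

lemma keys_push: "\<sigma> \<in> keys (push L F z k c) \<Longrightarrow> \<exists>\<tau>\<in>keys c. \<sigma> = simplex_map k F \<tau>"
  using keys_pm_extend[of "push_simplex L F z k" c]
  by (auto simp: push_def push_simplex_def split: if_splits)

lemma singular_simplex_path: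
  assumes "singular_simplex k X \<tau>" "x \<in> standard_simplex k" "y \<in> standard_simplex k"
  shows "pathin X (\<tau> \<circ> seg x y)"
  using assms by (intro pathin_compose[OF pathin_seg[OF seg_convex_simplex]]) (auto simp: singular_simplex_def)

lemma singular_face_apply:
  "x \<in> standard_simplex (k - Suc 0) \<Longrightarrow> singular_face k j \<tau> x = \<tau> (simplical_face j x)"
  by (simp add: singular_face_def)

text \<open>Only face 0 changes vertex 0, and the factor that it carries in the twisted boundary
  turns the transport from \<open>z\<close> to the old vertex 0 into the transport to the new
  one.\<close>

lemma push_simplex_boundary:
  assumes L: "rank_one_local_system X L" and F: "continuous_map (real_top Z) X F"
    and Z: "seg_convex Z" "z \<in> Z" and \<tau>: "singular_simplex k (real_top Z) \<tau>"
  shows "twisted_boundary L k (push_simplex L F z k \<tau>) = push L F z (k - 1) (simplex_boundary (\<lambda>_. 1) k \<tau>)"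
proof (cases "k = 0")
  case True
  then show ?thesis by (simp add: twisted_boundary_def simplex_boundary_def push_linear)
next
  case False
  let ?\<sigma> = "simplex_map k F \<tau>"
  let ?u = "\<lambda>x. L (F \<circ> seg z x)"
  have e: "L (first_edge ?\<sigma>) * ?u (\<tau> (vertex 0)) = ?u (\<tau> (vertex 1))"
  proof -
    have p: "pathin (real_top Z) (first_edge \<tau>)"
      unfolding first_edge_seg using False by (intro singular_simplex_path[OF \<tau>]) auto
    \<comment> \<open>The two paths differ outside \<open>{0..1}\<close>, where the edge leaves the
      simplex and \<open>simplex_map\<close> is undefined.\<close>
    have "L (F \<circ> first_edge \<tau>) = L (first_edge ?\<sigma>)"
    proof (rule local_system_cong[OF L pathin_compose[OF p F]])
      fix t :: real assume "t \<in> {0..1}"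
      then have "seg (vertex 0) (vertex 1) t \<in> standard_simplex k"
        using seg_convex_simplex[of k] False by (auto simp: seg_convex_def)
      then show "(F \<circ> first_edge \<tau>) t = first_edge ?\<sigma> t"
        by (simp add: first_edge_seg simplex_map_def)
    qed
    then show ?thesis
      using local_system_segment[OF L F Z p] by (simp add: first_edge_seg)
  qed
  \<comment> \<open>Face 0 omits vertex 0 and so starts at vertex 1; every other face keeps vertex
    0.\<close>
  have face: "push_simplex L F z (k - 1) (singular_face k j \<tau>) =
      single (singular_face k j ?\<sigma>) (?u (\<tau> (vertex (if j = 0 then 1 else 0))))" if "j \<le> k" for j
  proof -
    have "simplex_map (k - Suc 0) F (singular_face k j \<tau>) = singular_face k j ?\<sigma>"
      using that False by (auto simp: simplex_map_def singular_face_def simplical_face_in_standard_simplex fun_eq_iff)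
    moreover have "singular_face k j \<tau> (vertex 0) = \<tau> (vertex (if j = 0 then 1 else 0))"
      by (subst singular_face_apply) (auto simp: simplical_face_vertex)
    ultimately show ?thesis by (simp add: push_simplex_def)
  qed
  have "twisted_boundary L k (push_simplex L F z k \<tau>) =
      (\<Sum>j\<le>k. single (singular_face k j ?\<sigma>) ((-1) ^ j * (if j = 0 then L (first_edge ?\<sigma>) else 1) * ?u (\<tau> (vertex 0))))"
    using False by (simp add: twisted_boundary_extend push_simplex_def simplex_boundary_def pm_scale_sum mult_ac)
  also have "\<dots> = (\<Sum>j\<le>k. pm_scale ((-1) ^ j) (push_simplex L F z (k - 1) (singular_face k j \<tau>)))"
    by (rule sum.cong[OF refl]) (simp add: face e del: One_nat_def)
  also have "\<dots> = push L F z (k - 1) (simplex_boundary (\<lambda>_. 1) k \<tau>)"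
    using False by (simp add: push_sum simplex_boundary_def) (simp add: push_def)
  finally show ?thesis .
qed

lemma push_boundary:
  assumes "rank_one_local_system X L" "continuous_map (real_top Z) X F" "seg_convex Z" "z \<in> Z"
    and "c \<in> twisted_chains k (real_top Z)"
  shows "twisted_boundary L k (push L F z k c) = push L F z (k - 1) (twisted_boundary (\<lambda>_. 1) k c)"
proof -
  have "twisted_boundary L k (push L F z k c) = pm_extend (\<lambda>\<tau>. twisted_boundary L k (push_simplex L F z k \<tau>)) c"
    by (simp add: push_def twisted_boundary_extend pm_extend_extend)
  also have "\<dots> = pm_extend (\<lambda>\<tau>. push L F z (k - 1) (simplex_boundary (\<lambda>_. 1) k \<tau>)) c"
    by (rule pm_extend_cong, rule push_simplex_boundary[OF assms(1-4)]) (use assms(5) in \<open>auto simp: twisted_chains_def\<close>)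
  also have "\<dots> = push L F z (k - 1) (twisted_boundary (\<lambda>_. 1) k c)"
    by (simp add: push_def twisted_boundary_extend pm_extend_extend)
  finally show ?thesis .
qed

definition iota :: "nat \<Rightarrow> (nat \<Rightarrow> real) chain"
  where "iota n = frag_of (restrict id (standard_simplex n))"

lemma singular_chain_iota [simp]: "singular_chain n (real_top (standard_simplex n)) (iota n)"
  unfolding iota_def singular_chain_of by (rule simplicial_imp_singular_simplex) simp

lemma push_iota:
  assumes "rank_one_local_system X L" "singular_simplex n X \<sigma>"
  shows "push L \<sigma> (vertex 0) n (pm_of_int (iota n)) = single \<sigma> 1"
proof -
  have "simplex_map n \<sigma> (restrict id (standard_simplex n)) = \<sigma>"
    using assms(2) by (auto simp: simplex_map_def singular_simplex_def extensional_def fun_eq_iff)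
  moreover have "L (\<sigma> \<circ> seg (vertex 0) (vertex 0)) = 1"
    using assms by (intro local_system_segment_self[of X L "standard_simplex n"]) (auto simp: singular_simplex_def)
  ultimately show ?thesis by (simp add: push_def push_simplex_def iota_def)
qed

text \<open>By \<open>push_iota\<close> a simplex is the push-forward, along itself and from vertex
  0, of the identity simplex \<open>iota n\<close>. Naturality reduces the claim to the integral
  identity on the standard simplex.\<close>

lemma twisted_boundary_boundary:
  assumes L: "rank_one_local_system X L" and c: "c \<in> twisted_chains n X"
  shows "twisted_boundary L (n - 1) (twisted_boundary L n c) = 0"
proof -
  have "twisted_boundary L (n - 1) (simplex_boundary L n \<sigma>) = 0" if "\<sigma> \<in> keys c" for \<sigma>
  proof -
    have \<sigma>: "singular_simplex n X \<sigma>" using c that by (auto simp: twisted_chains_def)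
    let ?Z = "standard_simplex n"
    have F: "continuous_map (real_top ?Z) X \<sigma>" using \<sigma> by (simp add: singular_simplex_def)
    note b = push_boundary[OF L F seg_convex_simplex, of "vertex 0"]
    have i: "pm_of_int (iota n) \<in> twisted_chains n (real_top ?Z)"
      by (simp add: twisted_chains_of_int)
    have i': "pm_of_int (chain_boundary n (iota n)) \<in> twisted_chains (n - 1) (real_top ?Z)"
      by (metis twisted_boundary_of_int twisted_boundary_chain i)
    have "simplex_boundary L n \<sigma> = twisted_boundary L n (push L \<sigma> (vertex 0) n (pm_of_int (iota n)))"
      by (simp add: push_iota[OF L \<sigma>] twisted_boundary_extend)
    also have "\<dots> = push L \<sigma> (vertex 0) (n - 1) (pm_of_int (chain_boundary n (iota n)))"
      using b[OF _ i] by (simp add: twisted_boundary_of_int)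
    finally have "twisted_boundary L (n - 1) (simplex_boundary L n \<sigma>) =
        push L \<sigma> (vertex 0) (n - 1 - 1) (pm_of_int (chain_boundary (n - 1) (chain_boundary n (iota n))))"
      using b[OF _ i'] by (simp add: twisted_boundary_of_int)
    also have "chain_boundary (n - 1) (chain_boundary n (iota n)) = 0"
      using chain_boundary_boundary[OF singular_chain_iota, of n] by simp
    finally show ?thesis by (simp add: push_linear)
  qed
  then show ?thesis
    by (simp add: twisted_boundary_extend pm_extend_extend) (simp add: pm_extend_def)
qed

section \<open>Universal chains on the prisms over the standard simplices\<close>

text \<open>Contraction to \<open>a\<close> makes the cycle homologous to one in a single point, and
  there cycles of positive degree bound. This acyclicity is what produces the prism chains
  below.\<close>

lemma singular_cycle_seg_convex_bounds:
  assumes Z: "seg_convex Z" "a \<in> Z" and c: "singular_chain (Suc n) (real_top Z) c" "chain_boundary (Suc n) c = 0"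
  shows "\<exists>b. singular_chain (Suc (Suc n)) (real_top Z) b \<and> chain_boundary (Suc (Suc n)) b = c"
proof -
  let ?X = "real_top Z" and ?k = "\<lambda>_. a"
  let ?I = "top_of_set {0..1::real}"
  have cyc: "singular_relcycle (Suc n) ?X {} c" using c by (simp add: singular_cycle)
  have "homotopic_with (\<lambda>h. h \<in> {} \<rightarrow> {}) ?X ?X id ?k"
    unfolding homotopic_with_def
  proof (intro exI[of _ "\<lambda>p. seg (snd p) a (fst p)"] conjI)
    have "continuous_map (prod_topology ?I ?X) euclideanreal (\<lambda>p. snd p i)" for i
      using continuous_map_compose[OF continuous_map_snd continuous_map_real_top_coord] unfolding o_def .
    moreover have "continuous_map (prod_topology ?I ?X) euclideanreal fst"
      using continuous_map_fst continuous_map_into_fulltopology by blast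
    ultimately have "continuous_map (prod_topology ?I ?X) euclideanreal (\<lambda>p. seg (snd p) a (fst p) i)" for i
      unfolding seg_def by (intro continuous_intros) auto
    then show "continuous_map (prod_topology ?I ?X) ?X (\<lambda>p. seg (snd p) a (fst p))"
      using Z by (auto simp: continuous_map_real_top seg_convex_def)
  qed auto
  then have hom: "homologous_rel (Suc n) ?X {} (chain_map (Suc n) id c) (chain_map (Suc n) ?k c)"
    by (rule homotopic_imp_homologous_rel_chain_maps[OF _ cyc])
  have "singular_relcycle (Suc n) (real_top {a}) {} (chain_map (Suc n) ?k c)"
    by (rule singular_relcycle_chain_map[OF cyc]) auto
  then have "singular_relboundary (Suc n) (real_top {a}) {} (chain_map (Suc n) ?k c)"
    by (subst singular_boundary_eq_cycle_singleton[of _ a]) auto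
  then have "singular_relboundary (Suc n) ?X {} (chain_map (Suc n) ?k c)"
    by (rule singular_boundary_mono[rotated]) (use Z in auto)
  with hom have "singular_relboundary (Suc n) ?X {} (chain_map (Suc n) id c)"
    unfolding homologous_rel_def using singular_relboundary_add by fastforce
  then show ?thesis
    using chain_map_ident[OF c(1)] by (simp add: singular_boundary)
qed

text \<open>Coordinate 0 is the time, the remaining coordinates are the point of the simplex. The
  product is flattened into one function so that it is again a convex subset of the space used for
  push-forwards.\<close>

definition prism :: "nat \<Rightarrow> (nat \<Rightarrow> real) set"
  where "prism n = {x. x 0 \<in> {0..1} \<and> x \<circ> Suc \<in> standard_simplex n}"

definition prism_level :: "real \<Rightarrow> (nat \<Rightarrow> real) \<Rightarrow> nat \<Rightarrow> real"
  where "prism_level s x = case_nat s x"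

definition prism_face :: "nat \<Rightarrow> (nat \<Rightarrow> real) \<Rightarrow> nat \<Rightarrow> real"
  where "prism_face k x = case_nat (x 0) (simplical_face k (x \<circ> Suc))"

text \<open>\<open>vertex 1\<close> is the corner over vertex 0 of the simplex at time 0; it serves
  as base point of the transport on every prism.\<close>

lemma prism_simps [simp]:
  "prism_level s x 0 = s" "prism_level s x \<circ> Suc = x" "prism_face k x 0 = x 0"
  "prism_face k x \<circ> Suc = simplical_face k (x \<circ> Suc)" "vertex 1 \<in> prism n"
  "vertex (Suc 0) \<in> prism n"
proof -
  have "vertex 1 \<circ> Suc = vertex 0" by (auto simp: vertex_def)
  then show "vertex 1 \<in> prism n" "vertex (Suc 0) \<in> prism n"
    by (auto simp: prism_def) (simp_all add: vertex_def)
qed (auto simp: prism_level_def prism_face_def)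

lemma prism_eqI: "x 0 = y 0 \<Longrightarrow> x \<circ> Suc = y \<circ> Suc \<Longrightarrow> x = (y :: nat \<Rightarrow> 'a)"
  by (auto simp: fun_eq_iff) (metis not0_implies_Suc)

lemma prism_face_level: "prism_face k (prism_level s x) = prism_level s (simplical_face k x)"
  by (rule prism_eqI) auto

lemma simplical_face_face:
  "j < k \<Longrightarrow> simplical_face k \<circ> simplical_face j = simplical_face j \<circ> simplical_face (k - 1)"
  by (auto simp: simplical_face_def fun_eq_iff)

lemma prism_face_face:
  assumes "j < k" shows "prism_face k \<circ> prism_face j = prism_face j \<circ> prism_face (k - 1)"
proof
  fix x
  have "simplical_face k (simplical_face j y) = simplical_face j (simplical_face (k - 1) y)" for y :: "nat \<Rightarrow> real"
    using simplical_face_face[OF assms] by (metis comp_apply)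
  then show "(prism_face k \<circ> prism_face j) x = (prism_face j \<circ> prism_face (k - 1)) x"
    by - (rule prism_eqI, simp_all)
qed

lemma seg_convex_prism: "seg_convex (prism n)"
proof -
  have "seg x y u \<circ> Suc = seg (x \<circ> Suc) (y \<circ> Suc) u" for x y u by (auto simp: seg_def)
  moreover have "seg x y u 0 \<in> {0..1}" if "x 0 \<in> {0..1}" "y 0 \<in> {0..1}" "u \<in> {0..1}" for x y u
    using that convexD_alt[of "{0..1::real}" "x 0" "y 0" u] by (auto simp: seg_def convex_real_interval)
  ultimately show ?thesis using seg_convex_simplex[of n] by (auto simp: seg_convex_def prism_def)
qed

lemma continuous_map_simplical_face_coord:
  "continuous_map X euclideanreal (\<lambda>x. simplical_face k (f x) i)" if "\<And>j. continuous_map X euclideanreal (\<lambda>x. f x j)"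
  using that by (auto simp: simplical_face_def)

lemma continuous_map_prism_face:
  assumes "k \<le> Suc n" shows "continuous_map (real_top (prism n)) (real_top (prism (Suc n))) (prism_face k)"
proof -
  have "continuous_map (real_top (prism n)) euclideanreal (\<lambda>x. prism_face k x i)" for i
    by (cases i) (auto simp: prism_face_def continuous_map_real_top_coord intro!: continuous_map_simplical_face_coord)
  moreover have "prism_face k x \<in> prism (Suc n)" if "x \<in> prism n" for x
    using that assms simplical_face_in_standard_simplex[of "Suc n" k "x \<circ> Suc"] by (auto simp: prism_def)
  ultimately show ?thesis by (auto simp: continuous_map_real_top)
qed

lemma continuous_map_prism_level:
  assumes "s \<in> {0..1}"
  shows "continuous_map (real_top (standard_simplex n)) (real_top (prism n)) (prism_level s)"
proof -
  have "continuous_map (real_top (standard_simplex n)) euclideanreal (\<lambda>x. prism_level s x i)" for i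
    by (cases i) (auto simp: prism_level_def continuous_map_real_top_coord)
  then show ?thesis using assms by (auto simp: continuous_map_real_top prism_def)
qed

lemma frag_cmul_diff: "frag_cmul a (c - d) = frag_cmul a c - frag_cmul a d"
  by (rule poly_mapping_eqI) (simp add: lookup_minus algebra_simps)

text \<open>The cancellation behind the vanishing of a double boundary: \<open>(k, j)\<close> with
  \<open>j < k\<close> has the same term as \<open>(j, k - 1)\<close> and the opposite sign. The
  hypothesis is the simplicial identity for faces.\<close>

lemma frag_alternating_double_sum:
  assumes "\<And>j k. j < k \<Longrightarrow> k \<le> Suc n \<Longrightarrow> G k j = G j (k - 1)"
  shows "(\<Sum>k\<le>Suc n. \<Sum>j\<le>n. frag_cmul ((-1) ^ (k + j)) (G k j)) = (0 :: 'a \<Rightarrow>\<^sub>0 int)"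
proof -
  let ?f = "\<lambda>(k, j). frag_cmul ((-1) ^ (k + j)) (G k j)"
  let ?A = "{(k, j). k \<le> Suc n \<and> j < k}" and ?B = "{(k, j). k \<le> j \<and> j \<le> n}"
  have fin: "finite ?A" "finite ?B"
    by (rule finite_subset[of _ "{..Suc n} \<times> {..Suc n}"]; auto)+
  have "(\<Sum>k\<le>Suc n. \<Sum>j\<le>n. frag_cmul ((-1) ^ (k + j)) (G k j)) = sum ?f ({..Suc n} \<times> {..n})"
    by (rule sum.cartesian_product)
  also have "{..Suc n} \<times> {..n} = ?A \<union> ?B"
  proof (rule Set.set_eqI)
    fix p :: "nat \<times> nat"
    obtain k j where "p = (k, j)" by (cases p)
    moreover have "k \<le> Suc n \<and> j \<le> n \<longleftrightarrow> (k \<le> Suc n \<and> j < k) \<or> (k \<le> j \<and> j \<le> n)" by arith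
    ultimately show "p \<in> {..Suc n} \<times> {..n} \<longleftrightarrow> p \<in> ?A \<union> ?B"
      by (simp only: mem_Times_iff Un_iff mem_Collect_eq atMost_iff fst_conv snd_conv prod.case)
  qed
  also have "sum ?f (?A \<union> ?B) = sum ?f ?A + sum ?f ?B"
    by (rule sum.union_disjoint[OF fin]) fastforce
  also have "sum ?f ?A = (\<Sum>p\<in>?B. - ?f p)"
  proof (rule sum.reindex_bij_witness[where i = "\<lambda>(k, j). (Suc j, k)" and j = "\<lambda>(k, j). (j, k - 1)"])
    fix p assume "p \<in> ?A"
    then obtain k j where p: "p = (k, j)" "k \<le> Suc n" "j < k" by auto
    then show "(case case p of (k, j) \<Rightarrow> (j, k - 1) of (k, j) \<Rightarrow> (Suc j, k)) = p"
      "(case p of (k, j) \<Rightarrow> (j, k - 1)) \<in> ?B" by auto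
    have "(-1 :: int) ^ (k + j) = - ((-1) ^ (j + (k - 1)))"
      using p by (cases k) (auto simp: add.commute)
    then show "- ?f (case p of (k, j) \<Rightarrow> (j, k - 1)) = ?f p"
      using p assms[of j k] by simp
  next
    fix p assume "p \<in> ?B"
    then obtain k j where p: "p = (k, j)" "k \<le> j" "j \<le> n" by auto
    then show "(case case p of (k, j) \<Rightarrow> (Suc j, k) of (k, j) \<Rightarrow> (j, k - 1)) = p"
      "(case p of (k, j) \<Rightarrow> (Suc j, k)) \<in> ?A" by auto
  qed
  also have "(\<Sum>p\<in>?B. - ?f p) = - sum ?f ?B" by (rule sum_negf)
  finally show ?thesis by (simp only: add.left_inverse)
qed

section \<open>Iterated barycentric subdivision of the universal simplex\<close>

definition subdivided :: "nat \<Rightarrow> nat \<Rightarrow> (nat \<Rightarrow> real) chain"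
  where "subdivided N n = (singular_subdivision n ^^ N) (iota n)"

lemma singular_chain_subdivision_power:
  "singular_chain n X c \<Longrightarrow> singular_chain n X ((singular_subdivision n ^^ N) c)"
  by (induction N) (auto simp: singular_chain_singular_subdivision)

lemma chain_boundary_subdivision_power:
  assumes "singular_chain n X c"
  shows "chain_boundary n ((singular_subdivision n ^^ N) c) = (singular_subdivision (n - 1) ^^ N) (chain_boundary n c)"
  by (induction N)
    (simp_all add: chain_boundary_singular_subdivision[OF singular_chain_subdivision_power[OF assms]])

lemma subdivision_power_chain_map:
  assumes "singular_chain n X c"
  shows "(singular_subdivision n ^^ N) (chain_map n g c) = chain_map n g ((singular_subdivision n ^^ N) c)"
  by (induction N)
    (simp_all add: naturality_singular_subdivision[OF singular_chain_subdivision_power[OF assms]])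

lemma subdivision_power_linear:
  "(singular_subdivision n ^^ N) (\<Sum>i\<in>I. frag_cmul (a i) (c i)) =
    (\<Sum>i\<in>I. frag_cmul (a i) ((singular_subdivision n ^^ N) (c i)))"
proof (induction N)
  case (Suc N)
  have "singular_subdivision n (\<Sum>i\<in>I. frag_cmul (a i) (d i)) = (\<Sum>i\<in>I. frag_cmul (a i) (singular_subdivision n (d i)))" for d
    by (induction I rule: infinite_finite_induct)
      (auto simp: singular_subdivision_add singular_subdivision_def frag_extend_add frag_extend_cmul)
  with Suc show ?case by simp
qed auto

lemma chain_boundary_iota:
  "chain_boundary (Suc n) (iota (Suc n)) = (\<Sum>k\<le>Suc n. frag_cmul ((-1) ^ k) (chain_map n (simplical_face k) (iota n)))"
proof -
  have "singular_face (Suc n) k (restrict id (standard_simplex (Suc n))) =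
      simplex_map n (simplical_face k) (restrict id (standard_simplex n))" if "k \<le> Suc n" for k
    using that simplical_face_in_standard_simplex[of "Suc n" k]
    by (auto simp: singular_face_def simplex_map_def fun_eq_iff)
  then show ?thesis by (auto simp: iota_def chain_boundary_of simp del: sum.atMost_Suc intro!: sum.cong)
qed

text \<open>Subdivision is natural and commutes with the boundary, so subdividing a simplex
  subdivides its faces equally often. This compatibility lets one \<open>N\<close> serve in all
  degrees.\<close>

lemma chain_boundary_subdivided:
  "chain_boundary (Suc n) (subdivided N (Suc n)) =
    (\<Sum>k\<le>Suc n. frag_cmul ((-1) ^ k) (chain_map n (simplical_face k) (subdivided N n)))"
  by (simp add: subdivided_def chain_boundary_subdivision_power[OF singular_chain_iota] chain_boundary_iota
      subdivision_power_linear subdivision_power_chain_map[OF singular_chain_iota] del: sum.atMost_Suc)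

lemma singular_chain_subdivided: "singular_chain n (real_top (standard_simplex n)) (subdivided N n)"
  unfolding subdivided_def by (rule singular_chain_subdivision_power) simp

lemma subdivided_zero: "subdivided N 0 = iota 0"
  unfolding subdivided_def
  by (induction N) (simp_all add: singular_subdivision_zero[OF singular_chain_iota])

definition prism_sub :: "real \<Rightarrow> nat \<Rightarrow> nat \<Rightarrow> (nat \<Rightarrow> real) chain"
  where "prism_sub s N n = chain_map n (prism_level s) (subdivided N n)"

lemma singular_chain_prism_sub: "s \<in> {0..1} \<Longrightarrow> singular_chain n (real_top (prism n)) (prism_sub s N n)"
  unfolding prism_sub_def by (rule singular_chain_chain_map[OF singular_chain_subdivided continuous_map_prism_level])

lemma chain_map_sum_cmul:
  "finite I \<Longrightarrow> chain_map n g (\<Sum>i\<in>I. frag_cmul (a i) (c i)) = (\<Sum>i\<in>I. frag_cmul (a i) (chain_map n g (c i)))"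
  by (simp add: chain_map_sum o_def)

lemma chain_boundary_prism_sub:
  "chain_boundary (Suc n) (prism_sub s N (Suc n)) =
    (\<Sum>k\<le>Suc n. frag_cmul ((-1) ^ k) (chain_map n (prism_face k) (prism_sub s N n)))"
proof -
  have "prism_level s \<circ> simplical_face k = prism_face k \<circ> prism_level s" for k
    by (auto simp: prism_face_level)
  then have "chain_map n (prism_level s) (chain_map n (simplical_face k) c) = chain_map n (prism_face k) (chain_map n (prism_level s) c)" for k c
    by (metis chain_map_compose comp_apply)
  then show ?thesis
    by (simp add: prism_sub_def chain_boundary_chain_map[OF singular_chain_subdivided] chain_boundary_subdivided
        chain_map_sum_cmul del: sum.atMost_Suc)
qed

text \<open>Acyclic models: what \<open>P (Suc n)\<close> has to bound is a cycle in a convex prism.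
  The bottom is left whole and the top is subdivided \<open>N\<close> times, so the same chain
  carries both the homotopy and the subdivision.\<close>

lemma prism_homotopy_exists:
  obtains P :: "nat \<Rightarrow> (nat \<Rightarrow> real) chain"
  where "\<And>n. singular_chain (Suc n) (real_top (prism n)) (P n)"
    and "chain_boundary 1 (P 0) = prism_sub 1 N 0 - prism_sub 0 0 0"
    and "\<And>n. chain_boundary (Suc (Suc n)) (P (Suc n)) = prism_sub 1 N (Suc n) - prism_sub 0 0 (Suc n)
      - (\<Sum>k\<le>Suc n. frag_cmul ((-1) ^ k) (chain_map (Suc n) (prism_face k) (P n)))"
proof -
  \<comment> \<open>The boundary of a prism has the two ends, collected in \<open>D\<close>, and the
    sides, which are prisms over the faces of the simplex, collected in \<open>F\<close>.\<close>
  define D where "D n = prism_sub 1 N n - prism_sub 0 0 n" for n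
  define F where "F m n c = (\<Sum>k\<le>Suc n. frag_cmul ((-1) ^ k) (chain_map m (prism_face k) c))" for m n c
  have D_chain: "singular_chain n (real_top (prism n)) (D n)" for n
    by (simp add: D_def singular_chain_diff singular_chain_prism_sub)
  have F_diff: "F m n (c - d) = F m n c - F m n d" for m n c d
    by (simp add: F_def chain_map_diff frag_cmul_diff sum_subtractf del: sum.atMost_Suc)
  have F_chain: "singular_chain m (real_top (prism (Suc n))) (F m n c)" if "singular_chain m (real_top (prism n)) c" for m n c
    unfolding F_def
    by (intro singular_chain_sum singular_chain_cmul singular_chain_chain_map[OF that continuous_map_prism_face]) simp
  have bd_F: "chain_boundary m (F m n c) = F (m - 1) n (chain_boundary m c)" if "singular_chain m (real_top (prism n)) c" for m n c
    unfolding F_def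
    by (simp add: chain_boundary_chain_map[OF that] chain_boundary_sum chain_boundary_cmul o_def del: sum.atMost_Suc)
  have F_F: "F m (Suc n) (F m n c) = 0" for m n c
  proof -
    have "F m (Suc n) (F m n c) = (\<Sum>k\<le>Suc (Suc n). \<Sum>j\<le>Suc n.
        frag_cmul ((-1) ^ (k + j)) (chain_map m (prism_face k) (chain_map m (prism_face j) c)))"
      by (simp add: F_def chain_map_sum_cmul frag_cmul_sum power_add del: sum.atMost_Suc)
    also have "\<dots> = 0"
    proof (rule frag_alternating_double_sum)
      fix j k :: nat assume "j < k"
      from prism_face_face[OF this]
      show "chain_map m (prism_face k) (chain_map m (prism_face j) c) = chain_map m (prism_face j) (chain_map m (prism_face (k - 1)) c)"
        by (metis chain_map_compose comp_apply)
    qed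
    finally show ?thesis .
  qed
  have bd_D: "chain_boundary (Suc n) (D (Suc n)) = F n n (D n)" for n
    by (simp add: D_def chain_boundary_diff chain_boundary_prism_sub F_diff) (simp add: F_def)
  \<comment> \<open>For the step it suffices that the boundary of \<open>p\<close> is
    \<open>D n\<close> up to some \<open>F\<close>-image, because \<open>F_F\<close> kills that
    image. The earlier members of the sequence need not be remembered.\<close>
  define Good where "Good n p \<longleftrightarrow> singular_chain (Suc n) (real_top (prism n)) p \<and>
    (if n = 0 then chain_boundary 1 p = D 0
     else \<exists>c. singular_chain n (real_top (prism (n - 1))) c \<and> chain_boundary (Suc n) p = D n - F n (n - 1) c)" for n p
  have "\<exists>P. \<forall>n. Good n (P n) \<and> chain_boundary (Suc (Suc n)) (P (Suc n)) = D (Suc n) - F (Suc n) n (P n)"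
  proof (rule dependent_nat_choice)
    let ?p = "\<lambda>s. restrict (prism_level s) (standard_simplex 0)"
    have eq: "prism_sub s M 0 = frag_of (?p s)" for s M
      by (simp add: prism_sub_def subdivided_zero iota_def simplex_map_def) (auto simp: fun_eq_iff intro!: arg_cong[of _ _ frag_of])
    \<comment> \<open>In degree 0 both ends are single points and acyclicity in positive degrees
      does not apply; a path between them gives the 1-chain.\<close>
    have "path_connected_space (real_top (prism 0))"
      unfolding path_connected_space_def
    proof (intro ballI)
      fix x y assume "x \<in> topspace (real_top (prism 0))" "y \<in> topspace (real_top (prism 0))"
      then have "pathin (real_top (prism 0)) (seg x y)" by (intro pathin_seg seg_convex_prism) auto
      then show "\<exists>g. pathin (real_top (prism 0)) g \<and> g 0 = x \<and> g 1 = y"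
        by (intro exI[of _ "seg x y"]) simp
    qed
    moreover have "singular_simplex 0 (real_top (prism 0)) (?p s)" if "s \<in> {0..1}" for s
      using singular_chain_prism_sub[OF that, of 0 0] by (simp add: eq singular_chain_of)
    ultimately have "homologous_rel 0 (real_top (prism 0)) {} (frag_of (?p 1)) (frag_of (?p 0))"
      by (intro iso_integer_zeroth_homology_group_aux) auto
    then show "\<exists>p. Good 0 p"
      by (simp add: homologous_rel_def singular_boundary Good_def D_def eq)
  next
    fix p n assume good: "Good n p"
    then have p: "singular_chain (Suc n) (real_top (prism n)) p" by (simp add: Good_def)
    let ?z = "D (Suc n) - F (Suc n) n p"
    have z: "singular_chain (Suc n) (real_top (prism (Suc n))) ?z"
      by (intro singular_chain_diff D_chain F_chain p)
    have "F n n (chain_boundary (Suc n) p) = F n n (D n)"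
    proof (cases n)
      case 0
      then show ?thesis using good by (simp add: Good_def)
    next
      case (Suc m)
      then show ?thesis using good by (auto simp: Good_def F_diff F_F)
    qed
    \<comment> \<open>Both terms of \<open>?z\<close> have the boundary
      \<open>F n n (D n)\<close>.\<close>
    then have "chain_boundary (Suc n) ?z = 0"
      by (simp add: chain_boundary_diff bd_D bd_F[OF p])
    from singular_cycle_seg_convex_bounds[OF seg_convex_prism prism_simps(5) z this]
    obtain b where "singular_chain (Suc (Suc n)) (real_top (prism (Suc n))) b" "chain_boundary (Suc (Suc n)) b = ?z"
      by blast
    then show "\<exists>q. Good (Suc n) q \<and> chain_boundary (Suc (Suc n)) q = ?z"
      using p by (auto simp: Good_def)
  qed
  then obtain P where P: "\<And>n. Good n (P n)"
      "\<And>n. chain_boundary (Suc (Suc n)) (P (Suc n)) = D (Suc n) - F (Suc n) n (P n)" by blast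
  show ?thesis
  proof (rule that[of P])
    show "singular_chain (Suc n) (real_top (prism n)) (P n)" for n using P(1) by (simp add: Good_def)
    show "chain_boundary 1 (P 0) = prism_sub 1 N 0 - prism_sub 0 0 0" using P(1)[of 0] by (simp add: Good_def D_def)
  qed (use P(2) in \<open>simp add: D_def F_def\<close>)
qed

section \<open>Chain homotopies from homotopies and subdivision\<close>

definition slide :: "(real \<Rightarrow> 'a \<Rightarrow> 'a) \<Rightarrow> ((nat \<Rightarrow> real) \<Rightarrow> 'a) \<Rightarrow> (nat \<Rightarrow> real) \<Rightarrow> 'a"
  where "slide H \<sigma> x = H (x 0) (\<sigma> (x \<circ> Suc))"

locale homotopy_from_identity =
  fixes X :: "'a topology" and L :: "(real \<Rightarrow> 'a) \<Rightarrow> 'r::comm_ring_1" and H :: "real \<Rightarrow> 'a \<Rightarrow> 'a"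
  assumes local_system: "rank_one_local_system X L"
    and homotopy: "continuous_map (prod_topology (top_of_set {0..1}) X) X (\<lambda>(s, x). H s x)"
    and homotopy_0: "x \<in> topspace X \<Longrightarrow> H 0 x = x"
begin

lemma continuous_map_slide:
  assumes \<sigma>: "singular_simplex n X \<sigma>"
  shows "continuous_map (real_top (prism n)) X (slide H \<sigma>)"
proof -
  have "continuous_map (real_top (prism n)) (real_top (standard_simplex n)) (\<lambda>x. x \<circ> Suc)"
    by (auto simp: continuous_map_real_top continuous_map_real_top_coord prism_def)
  then have "continuous_map (real_top (prism n)) X (\<sigma> \<circ> (\<lambda>x. x \<circ> Suc))"
    using \<sigma> by (intro continuous_map_compose) (auto simp: singular_simplex_def)
  moreover have "continuous_map (real_top (prism n)) (top_of_set {0..1}) (\<lambda>x. x 0)"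
    by (auto simp: continuous_map_in_subtopology continuous_map_real_top_coord prism_def)
  ultimately have "continuous_map (real_top (prism n)) (prod_topology (top_of_set {0..1}) X) (\<lambda>x. (x 0, \<sigma> (x \<circ> Suc)))"
    by (simp add: continuous_map_paired o_def)
  from continuous_map_compose[OF this homotopy] show ?thesis
    by (simp add: o_def slide_def[abs_def])
qed

lemma singular_simplex_topspace: "singular_simplex n X \<sigma> \<Longrightarrow> x \<in> standard_simplex n \<Longrightarrow> \<sigma> x \<in> topspace X"
  by (auto simp: singular_simplex_def continuous_map_def Pi_iff)

text \<open>Turns a chain on the model prism into an operator that is natural in the simplex. The
  base point \<open>vertex 1\<close> goes to vertex 0 of the simplex because \<open>H 0\<close> is
  the identity, so coefficients enter unchanged.\<close>

definition prism_op :: "nat \<Rightarrow> (nat \<Rightarrow> real) chain \<Rightarrow> ('a, 'r) twisted_chain \<Rightarrow> ('a, 'r) twisted_chain"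
  where "prism_op q w = pm_extend (\<lambda>\<sigma>. push L (slide H \<sigma>) (vertex 1) q (pm_of_int w))"

lemma prism_op_linear:
  "prism_op q w (c + d) = prism_op q w c + prism_op q w d"
  "prism_op q w (c - d) = prism_op q w c - prism_op q w d"
  "prism_op q (v - w) c = prism_op q v c - prism_op q w c"
  by (simp_all add: prism_op_def pm_extend_add pm_extend_diff push_linear pm_extend_fun)

lemma prism_op_chain:
  assumes "singular_chain q (real_top (prism n)) w" "c \<in> twisted_chains n X"
  shows "prism_op q w c \<in> twisted_chains q X"
  unfolding prism_op_def
  by (intro twisted_chains_extend push_chain[OF continuous_map_slide] twisted_chains_of_int)
    (use assms in \<open>auto simp: twisted_chains_def\<close>)

lemma keys_prism_op:
  assumes "\<tau> \<in> keys (prism_op q w c)"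
  shows "\<exists>\<sigma>\<in>keys c. \<exists>\<rho>\<in>keys w. \<tau> = simplex_map q (slide H \<sigma>) \<rho>"
proof -
  obtain \<sigma> where "\<sigma> \<in> keys c" "\<tau> \<in> keys (push L (slide H \<sigma>) (vertex 1) q (pm_of_int w))"
    using assms keys_pm_extend unfolding prism_op_def by fastforce
  then show ?thesis using keys_push keys_pm_of_int by fastforce
qed

lemma prism_op_boundary:
  assumes w: "singular_chain q (real_top (prism n)) w" and c: "c \<in> twisted_chains n X"
  shows "twisted_boundary L q (prism_op q w c) = prism_op (q - 1) (chain_boundary q w) c"
  unfolding prism_op_def twisted_boundary_extend pm_extend_extend
proof (rule pm_extend_cong)
  fix \<sigma> assume "\<sigma> \<in> keys c"
  then have "singular_simplex n X \<sigma>" using c by (auto simp: twisted_chains_def)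
  from push_boundary[OF local_system continuous_map_slide[OF this] seg_convex_prism prism_simps(5) twisted_chains_of_int[OF w]]
  show "pm_extend (simplex_boundary L q) (push L (slide H \<sigma>) (vertex 1) q (pm_of_int w)) =
      push L (slide H \<sigma>) (vertex 1) (q - 1) (pm_of_int (chain_boundary q w))"
    by (simp add: twisted_boundary_of_int flip: twisted_boundary_extend)
qed

text \<open>\<open>vertex 1\<close> and \<open>vertex 2\<close> are the corners over vertices 0 and
  1 at time 0, where the homotopy has not yet moved anything.\<close>

lemma slide_seg_vertices:
  assumes "singular_simplex (Suc n) X \<sigma>" "t \<in> {0..1}"
  shows "slide H \<sigma> (seg (vertex 1) (vertex 2) t) = first_edge \<sigma> t"
proof -
  have "seg (vertex 1) (vertex 2) t \<circ> Suc = seg (vertex 0) (vertex 1) t" "seg (vertex 1) (vertex 2) t 0 = 0"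
    by (auto simp: seg_def vertex_def)
  moreover have "seg (vertex 0) (vertex 1) t \<in> standard_simplex (Suc n)"
    using seg_convex_simplex[of "Suc n"] assms(2) by (auto simp: seg_convex_def)
  ultimately show ?thesis
    using assms(1) by (simp add: slide_def first_edge_seg homotopy_0 singular_simplex_topspace)
qed

text \<open>Face 0 takes the base corner \<open>vertex 1\<close> to \<open>vertex 2\<close>, all
  other faces fix it. The triangle with the image of \<open>x\<close> then contributes the transport
  along the first edge precisely for \<open>k = 0\<close>, as in the twisted boundary.\<close>

lemma slide_prism_face_transport:
  assumes \<sigma>: "singular_simplex (Suc n) X \<sigma>" and k: "k \<le> Suc n" and x: "x \<in> prism n"
  shows "L (slide H \<sigma> \<circ> seg (vertex 1) (prism_face k x)) =
    (if k = 0 then L (first_edge \<sigma>) else 1) * L (slide H (singular_face (Suc n) k \<sigma>) \<circ> seg (vertex 1) x)"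
proof -
  let ?F = "slide H \<sigma>" and ?G = "slide H (singular_face (Suc n) k \<sigma>)"
  let ?g = "prism_face k \<circ> seg (vertex 1) x"
  have F: "continuous_map (real_top (prism (Suc n))) X ?F"
    using \<sigma> by (rule continuous_map_slide)
  have face: "singular_simplex n X (singular_face (Suc n) k \<sigma>)"
    using singular_simplex_singular_face[OF \<sigma>, of k] k by simp
  have s: "pathin (real_top (prism n)) (seg (vertex 1) x)"
    by (intro pathin_seg seg_convex_prism x) simp
  then have g: "pathin (real_top (prism (Suc n))) ?g"
    by (rule pathin_compose[OF _ continuous_map_prism_face[OF k]])
  have "L (?F \<circ> ?g) * L (?F \<circ> seg (vertex 1) (?g 0)) = L (?F \<circ> seg (vertex 1) (?g 1))"
    by (rule local_system_segment[OF local_system F seg_convex_prism _ g]) simp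
  moreover have "L (?F \<circ> ?g) = L (?G \<circ> seg (vertex 1) x)"
  proof (rule local_system_cong[OF local_system, symmetric])
    show "pathin X (?G \<circ> seg (vertex 1) x)"
      by (rule pathin_compose[OF s continuous_map_slide[OF face]])
    fix t :: real assume "t \<in> {0..1}"
    then have "seg (vertex 1) x t \<in> prism n"
      using s by (auto simp: pathin_def continuous_map_real_top Pi_iff)
    then show "(?G \<circ> seg (vertex 1) x) t = (?F \<circ> ?g) t"
      by (auto simp: slide_def prism_def singular_face_apply)
  qed
  moreover have "L (?F \<circ> seg (vertex 1) (?g 0)) = (if k = 0 then L (first_edge \<sigma>) else 1)"
  proof -
    have vs: "vertex (Suc m) \<circ> Suc = vertex m" for m by (auto simp: vertex_def)
    have v: "prism_face k (vertex 1) = vertex (if k = 0 then 2 else 1)"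
    proof (rule prism_eqI)
      show "prism_face k (vertex 1) 0 = vertex (if k = 0 then 2 else 1) 0" by (simp add: vertex_def)
      show "prism_face k (vertex 1) \<circ> Suc = vertex (if k = 0 then 2 else 1) \<circ> Suc"
        by (simp add: vs simplical_face_vertex numeral_2_eq_2)
    qed
    show ?thesis
    proof (cases "k = 0")
      case True
      have "L (first_edge \<sigma>) = L (?F \<circ> seg (vertex 1) (vertex 2))"
      proof (rule local_system_cong[OF local_system])
        show "pathin X (first_edge \<sigma>)"
          unfolding first_edge_seg by (rule singular_simplex_path[OF \<sigma>]) auto
      qed (simp add: slide_seg_vertices[OF \<sigma>] del: One_nat_def)
      then show ?thesis using True v by simp
    next
      case False
      then show ?thesis
        using v local_system_segment_self[OF local_system F prism_simps(5)] by simp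
    qed
  qed
  ultimately show ?thesis by (simp add: mult.commute)
qed

lemma push_slide_prism_face:
  assumes \<sigma>: "singular_simplex (Suc n) X \<sigma>" and k: "k \<le> Suc n" and w: "singular_chain q (real_top (prism n)) w"
  shows "push L (slide H \<sigma>) (vertex 1) q (pm_of_int (chain_map q (prism_face k) w)) =
    pm_scale (if k = 0 then L (first_edge \<sigma>) else 1)
      (push L (slide H (singular_face (Suc n) k \<sigma>)) (vertex 1) q (pm_of_int w))"
  unfolding chain_map_def pm_of_int_extend push_def pm_extend_extend pm_extend_fun(4)[symmetric]
proof (rule pm_extend_cong)
  fix \<tau> assume "\<tau> \<in> keys (pm_of_int w :: _ \<Rightarrow>\<^sub>0 'r)"
  then have \<tau>: "singular_simplex q (real_top (prism n)) \<tau>"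
    using w keys_pm_of_int by (fastforce simp: singular_chain_def)
  then have "\<tau> x \<in> prism n" if "x \<in> standard_simplex q" for x
    using that by (auto simp: singular_simplex_def continuous_map_real_top Pi_iff)
  then have "simplex_map q (slide H \<sigma>) (simplex_map q (prism_face k) \<tau>) =
      simplex_map q (slide H (singular_face (Suc n) k \<sigma>)) \<tau>" and v: "\<tau> (vertex 0) \<in> prism n"
    by (auto simp: simplex_map_def slide_def prism_def singular_face_apply fun_eq_iff)
  moreover have "simplex_map q (prism_face k) \<tau> (vertex 0) = prism_face k (\<tau> (vertex 0))"
    by (simp add: simplex_map_def)
  ultimately show "pm_extend (push_simplex L (slide H \<sigma>) (vertex 1) q) (pm_of_int ((frag_of \<circ> simplex_map q (prism_face k)) \<tau>)) =
      pm_scale (if k = 0 then L (first_edge \<sigma>) else 1)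
        (push_simplex L (slide H (singular_face (Suc n) k \<sigma>)) (vertex 1) q \<tau>)"
    using slide_prism_face_transport[OF \<sigma> k v]
    by (cases "k = 0") (simp_all add: push_simplex_def)
qed

text \<open>Face relations of the model chain become composition with the twisted boundary. Together
  with \<open>prism_op_boundary\<close> this turns the recursion for the prism chains into a chain
  homotopy formula.\<close>

lemma prism_op_faces:
  assumes w: "singular_chain q (real_top (prism n)) w" and c: "c \<in> twisted_chains (Suc n) X"
  shows "prism_op q (\<Sum>k\<le>Suc n. frag_cmul ((-1) ^ k) (chain_map q (prism_face k) w)) c =
    prism_op q w (twisted_boundary L (Suc n) c)"
  unfolding prism_op_def twisted_boundary_extend pm_extend_extend
proof (rule pm_extend_cong)
  fix \<sigma> assume "\<sigma> \<in> keys c"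
  then have \<sigma>: "singular_simplex (Suc n) X \<sigma>" using c by (auto simp: twisted_chains_def)
  show "push L (slide H \<sigma>) (vertex 1) q (pm_of_int (\<Sum>k\<le>Suc n. frag_cmul ((-1) ^ k) (chain_map q (prism_face k) w))) =
      pm_extend (\<lambda>\<sigma>. push L (slide H \<sigma>) (vertex 1) q (pm_of_int w)) (simplex_boundary L (Suc n) \<sigma>)"
    by (simp add: pm_of_int_sum push_sum push_linear simplex_boundary_def pm_extend_sum
        del: sum.atMost_Suc One_nat_def)
      (rule sum.cong[OF refl], simp add: push_slide_prism_face[OF \<sigma> _ w] del: One_nat_def)
qed

lemma prism_op_bottom:
  assumes c: "c \<in> twisted_chains n X"
  shows "prism_op n (prism_sub 0 0 n) c = c"
proof -
  have "push L (slide H \<sigma>) (vertex 1) n (pm_of_int (prism_sub 0 0 n)) = single \<sigma> 1" if "\<sigma> \<in> keys c" for \<sigma>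
  proof -
    have \<sigma>: "singular_simplex n X \<sigma>" using c that by (auto simp: twisted_chains_def)
    let ?b = "restrict (prism_level 0) (standard_simplex n)"
    have "prism_sub 0 0 n = frag_of ?b"
      by (simp add: prism_sub_def subdivided_def iota_def simplex_map_def)
        (auto simp: fun_eq_iff intro!: arg_cong[of _ _ frag_of])
    moreover have "prism_level 0 (vertex 0) = vertex 1"
      by (rule prism_eqI) (auto simp: vertex_def)
    moreover have "simplex_map n (slide H \<sigma>) ?b = \<sigma>"
      using \<sigma> by (auto simp: simplex_map_def slide_def fun_eq_iff homotopy_0 singular_simplex_topspace)
        (auto simp: singular_simplex_def extensional_def)
    ultimately show ?thesis
      using local_system_segment_self[OF local_system continuous_map_slide[OF \<sigma>] prism_simps(5)]
      by (simp add: push_def push_simplex_def)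
  qed
  then show ?thesis
    unfolding prism_op_def by (subst pm_extend_cong[where g = "\<lambda>\<sigma>. single \<sigma> 1"]) auto
qed

text \<open>The cover is pulled back along \<open>\<sigma>\<close> and the standard simplex itself
  is subdivided. The bound holds for all larger \<open>M\<close>, so that a maximum over finitely
  many simplices can be taken.\<close>

lemma subdivision_eventually_small:
  assumes \<C>: "\<And>V. V \<in> \<C> \<Longrightarrow> openin X V" "topspace X \<subseteq> \<Union>\<C>" and \<sigma>: "singular_simplex n X \<sigma>"
  shows "\<exists>N. \<forall>M\<ge>N. \<forall>\<rho>\<in>keys (subdivided M n). \<exists>V\<in>\<C>. \<forall>x\<in>standard_simplex n. \<rho> x \<in> standard_simplex n \<and> \<sigma> (\<rho> x) \<in> V"
proof -
  let ?T = "real_top (standard_simplex n)"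
  let ?\<D> = "(\<lambda>V. {x \<in> topspace ?T. \<sigma> x \<in> V}) ` \<C>"
  have ope: "openin ?T D" if "D \<in> ?\<D>" for D
    using that \<sigma> \<C>(1) openin_continuous_map_preimage[of ?T X \<sigma>] unfolding singular_simplex_def by blast
  have cov: "topspace ?T \<subseteq> \<Union>?\<D>"
    using \<C>(2) singular_simplex_topspace[OF \<sigma>] by fastforce
  obtain N where N: "\<And>M \<rho>. N \<le> M \<Longrightarrow> \<rho> \<in> keys ((singular_subdivision n ^^ M) (iota n)) \<Longrightarrow>
      \<exists>D\<in>?\<D>. \<rho> \<in> standard_simplex n \<rightarrow> D"
    by (rule sufficient_iterated_singular_subdivision_exists[OF ope cov singular_chain_iota]) blast+
  show ?thesis
  proof (intro exI[of _ N] allI impI ballI)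
    fix M \<rho> assume "N \<le> M" "\<rho> \<in> keys (subdivided M n)"
    then obtain V where "V \<in> \<C>" "\<rho> \<in> standard_simplex n \<rightarrow> {x \<in> topspace ?T. \<sigma> x \<in> V}"
      using N[of M \<rho>] unfolding subdivided_def by blast
    then show "\<exists>V\<in>\<C>. \<forall>x\<in>standard_simplex n. \<rho> x \<in> standard_simplex n \<and> \<sigma> (\<rho> x) \<in> V"
      by (intro bexI[of _ V]) (auto simp: Pi_iff)
  qed
qed

text \<open>Controls the support of new chains: each of their simplices runs inside the track of a
  single old simplex, hence stays in every piece that the homotopy preserves.\<close>

definition carried_by_homotopy :: "nat \<Rightarrow> ('a, 'r) twisted_chain \<Rightarrow> nat \<Rightarrow> ('a, 'r) twisted_chain \<Rightarrow> bool"
  where "carried_by_homotopy m d n c \<longleftrightarrow> (\<forall>\<tau>\<in>keys d. \<exists>\<sigma>\<in>keys c. \<forall>y\<in>standard_simplex m.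
    \<exists>s\<in>{0..1}. \<exists>x\<in>standard_simplex n. \<tau> y = H s (\<sigma> x))"

lemma carried_by_homotopy_prism_op:
  assumes "singular_chain q (real_top (prism n)) w"
  shows "carried_by_homotopy q (prism_op q w c) n c"
  unfolding carried_by_homotopy_def
proof
  fix \<tau> assume "\<tau> \<in> keys (prism_op q w c)"
  then obtain \<sigma> \<rho> where *: "\<sigma> \<in> keys c" "\<rho> \<in> keys w" "\<tau> = simplex_map q (slide H \<sigma>) \<rho>"
    using keys_prism_op by blast
  have "\<exists>s\<in>{0..1}. \<exists>x\<in>standard_simplex n. \<tau> y = H s (\<sigma> x)" if y: "y \<in> standard_simplex q" for y
  proof (intro bexI)
    show "\<tau> y = H (\<rho> y 0) (\<sigma> (\<rho> y \<circ> Suc))" using * y by (simp add: simplex_map_def slide_def)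
    have "\<rho> y \<in> prism n"
      using assms *(2) y by (force simp: singular_chain_def singular_simplex_def continuous_map_real_top Pi_iff)
    then show "\<rho> y \<circ> Suc \<in> standard_simplex n" "\<rho> y 0 \<in> {0..1}" by (simp_all add: prism_def)
  qed
  with *(1) show "\<exists>\<sigma>\<in>keys c. \<forall>y\<in>standard_simplex q. \<exists>s\<in>{0..1}. \<exists>x\<in>standard_simplex n. \<tau> y = H s (\<sigma> x)"
    by blast
qed

text \<open>\<open>A\<close> is subdivision followed by \<open>H 1\<close>, and \<open>P\<close> is
  the chain homotopy from the identity to it. The number of subdivisions depends on \<open>b\<close>
  but is the same in all degrees, which makes \<open>A\<close> a chain map.\<close>

proposition subdivision_homotopy:
  assumes \<C>: "\<And>V. V \<in> \<C> \<Longrightarrow> openin X V" "topspace X \<subseteq> \<Union>\<C>" and b: "b \<in> twisted_chains m X"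
  obtains A P :: "nat \<Rightarrow> ('a, 'r) twisted_chain \<Rightarrow> ('a, 'r) twisted_chain"
  where "\<And>n c d. A n (c - d) = A n c - A n d"
    and "\<And>n c. c \<in> twisted_chains n X \<Longrightarrow> A n c \<in> twisted_chains n X"
    and "\<And>n c. c \<in> twisted_chains n X \<Longrightarrow> P n c \<in> twisted_chains (Suc n) X"
    and "\<And>n c. c \<in> twisted_chains n X \<Longrightarrow> carried_by_homotopy n (A n c) n c"
    and "\<And>n c. c \<in> twisted_chains n X \<Longrightarrow> carried_by_homotopy (Suc n) (P n c) n c"
    and "\<And>n c. c \<in> twisted_chains (Suc n) X \<Longrightarrow> twisted_boundary L (Suc n) (A (Suc n) c) = A n (twisted_boundary L (Suc n) c)"
    and "\<And>n c. c \<in> twisted_chains n X \<Longrightarrow>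
      twisted_boundary L (Suc n) (P n c) = A n c - c - (if n = 0 then 0 else P (n - 1) (twisted_boundary L n c))"
    and "\<And>\<tau>. \<tau> \<in> keys (A m b) \<Longrightarrow> \<exists>V\<in>\<C>. \<tau> ` standard_simplex m \<subseteq> H 1 ` (V \<inter> topspace X)"
proof -
  have "\<exists>N. \<forall>\<sigma>\<in>keys b. \<forall>\<rho>\<in>keys (subdivided N m). \<exists>V\<in>\<C>.
      \<forall>x\<in>standard_simplex m. \<rho> x \<in> standard_simplex m \<and> \<sigma> (\<rho> x) \<in> V"
  proof -
    have "\<forall>\<sigma>\<in>keys b. \<exists>N. \<forall>M\<ge>N. \<forall>\<rho>\<in>keys (subdivided M m). \<exists>V\<in>\<C>.
        \<forall>x\<in>standard_simplex m. \<rho> x \<in> standard_simplex m \<and> \<sigma> (\<rho> x) \<in> V"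
      using subdivision_eventually_small[OF \<C>] b by (auto simp: twisted_chains_def)
    then obtain f where f: "\<forall>\<sigma>\<in>keys b. \<forall>M\<ge>f \<sigma>. \<forall>\<rho>\<in>keys (subdivided M m). \<exists>V\<in>\<C>.
        \<forall>x\<in>standard_simplex m. \<rho> x \<in> standard_simplex m \<and> \<sigma> (\<rho> x) \<in> V"
      by metis
    \<comment> \<open>The maximum is a number of subdivisions that works for all simplices of
      \<open>b\<close>; the inserted 0 covers \<open>b = 0\<close>.\<close>
    have "f \<sigma> \<le> Max (insert 0 (f ` keys b))" if "\<sigma> \<in> keys b" for \<sigma> using that by simp
    then show ?thesis using f by blast
  qed
  then obtain N where N: "\<And>\<sigma> \<rho>. \<sigma> \<in> keys b \<Longrightarrow> \<rho> \<in> keys (subdivided N m) \<Longrightarrow> \<exists>V\<in>\<C>.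
      \<forall>x\<in>standard_simplex m. \<rho> x \<in> standard_simplex m \<and> \<sigma> (\<rho> x) \<in> V" by blast
  obtain p :: "nat \<Rightarrow> (nat \<Rightarrow> real) chain" where p: "\<And>n. singular_chain (Suc n) (real_top (prism n)) (p n)"
    "chain_boundary 1 (p 0) = prism_sub 1 N 0 - prism_sub 0 0 0"
    "\<And>n. chain_boundary (Suc (Suc n)) (p (Suc n)) = prism_sub 1 N (Suc n) - prism_sub 0 0 (Suc n)
      - (\<Sum>k\<le>Suc n. frag_cmul ((-1) ^ k) (chain_map (Suc n) (prism_face k) (p n)))"
    by (rule prism_homotopy_exists[of N], rule that)
  define A where "A n = prism_op n (prism_sub 1 N n)" for n
  define P where "P n = prism_op (Suc n) (p n)" for n
  have sub: "singular_chain n (real_top (prism n)) (prism_sub 1 N n)" for n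
    by (rule singular_chain_prism_sub) simp
  show ?thesis
  proof (rule that[of A P])
    show "A n (c - d) = A n c - A n d" for n c d by (simp add: A_def prism_op_linear)
    fix n and c :: "('a, 'r) twisted_chain"
    show "twisted_boundary L (Suc n) (A (Suc n) c) = A n (twisted_boundary L (Suc n) c)"
      if "c \<in> twisted_chains (Suc n) X"
      using prism_op_boundary[OF sub that] prism_op_faces[OF sub that]
      by (simp add: A_def chain_boundary_prism_sub del: sum.atMost_Suc)
    assume c: "c \<in> twisted_chains n X"
    show "A n c \<in> twisted_chains n X" unfolding A_def by (rule prism_op_chain[OF sub c])
    show "P n c \<in> twisted_chains (Suc n) X" unfolding P_def by (rule prism_op_chain[OF p(1) c])
    show "carried_by_homotopy n (A n c) n c" unfolding A_def by (rule carried_by_homotopy_prism_op[OF sub])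
    show "carried_by_homotopy (Suc n) (P n c) n c" unfolding P_def by (rule carried_by_homotopy_prism_op[OF p(1)])
    show "twisted_boundary L (Suc n) (P n c) = A n c - c - (if n = 0 then 0 else P (n - 1) (twisted_boundary L n c))"
    proof (cases n)
      case 0
      then show ?thesis
        using prism_op_boundary[OF p(1) c] p(2) prism_op_bottom[OF c] by (simp add: A_def P_def prism_op_linear)
    next
      case (Suc k)
      then show ?thesis
        using prism_op_boundary[OF p(1) c] prism_op_bottom[OF c] prism_op_faces[OF p(1), of c k] c
        by (simp add: A_def P_def prism_op_linear p(3) del: sum.atMost_Suc)
    qed
  next
    fix \<tau> assume "\<tau> \<in> keys (A m b)"
    then obtain \<sigma> \<rho>' where *: "\<sigma> \<in> keys b" "\<rho>' \<in> keys (prism_sub 1 N m)" "\<tau> = simplex_map m (slide H \<sigma>) \<rho>'"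
      using keys_prism_op unfolding A_def by blast
    obtain \<rho> where \<rho>: "\<rho> \<in> keys (subdivided N m)" "\<rho>' = simplex_map m (prism_level 1) \<rho>"
      using *(2) keys_frag_extend unfolding prism_sub_def chain_map_def by fastforce
    obtain V where V: "V \<in> \<C>" "\<And>x. x \<in> standard_simplex m \<Longrightarrow> \<rho> x \<in> standard_simplex m \<and> \<sigma> (\<rho> x) \<in> V"
      using N[OF *(1) \<rho>(1)] by blast
    have "\<sigma> y \<in> topspace X" if "y \<in> standard_simplex m" for y
      using b *(1) that by (auto simp: twisted_chains_def intro: singular_simplex_topspace)
    then have "\<tau> ` standard_simplex m \<subseteq> H 1 ` (V \<inter> topspace X)"
      using V(2) by (auto simp: *(3) \<rho>(2) simplex_map_def slide_def)
    with V(1) show "\<exists>V\<in>\<C>. \<tau> ` standard_simplex m \<subseteq> H 1 ` (V \<inter> topspace X)" by blast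
  qed
qed

end

section \<open>Replacing chains by chains in small pieces\<close>

definition piecewise_chains :: "nat \<Rightarrow> 'a topology \<Rightarrow> 'a set set \<Rightarrow> ('a, 'r::comm_ring_1) twisted_chain set"
  where "piecewise_chains n X \<D> = {c \<in> twisted_chains n X. \<forall>\<sigma>\<in>keys c. \<exists>D\<in>\<D>. \<sigma> ` standard_simplex n \<subseteq> D}"

text \<open>The members of \<open>\<D>\<close> need not be open. Subdivided simplices are small with
  respect to the open cover \<open>\<C>\<close>, and \<open>H 1\<close> maps each member of it into
  a single piece.\<close>

locale retraction_to_pieces = homotopy_from_identity X L H
  for X :: "'a topology" and L :: "(real \<Rightarrow> 'a) \<Rightarrow> 'r::comm_ring_1" and H +
  fixes S :: "'a set" and \<C> \<D> :: "'a set set"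
  assumes cover: "V \<in> \<C> \<Longrightarrow> openin X V" "topspace X \<subseteq> \<Union>\<C>"
    and cover_pieces: "V \<in> \<C> \<Longrightarrow> \<exists>D\<in>\<D>. H 1 ` (V \<inter> topspace X) \<subseteq> D"
    and S_piece: "S \<in> \<D>"
    and invariant: "D \<in> \<D> \<Longrightarrow> s \<in> {0..1} \<Longrightarrow> x \<in> topspace X \<Longrightarrow> x \<in> D \<Longrightarrow> H s x \<in> D"
begin

text \<open>The subfamily \<open>\<E>\<close> is either the whole of \<open>\<D>\<close> or
  \<open>{S}\<close> alone; the second case keeps chains of \<open>S\<close> in
  \<open>S\<close>.\<close>

lemma carried_piecewise:
  assumes "carried_by_homotopy m d n c" "d \<in> twisted_chains m X" "c \<in> piecewise_chains n X \<E>" "\<E> \<subseteq> \<D>"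
  shows "d \<in> piecewise_chains m X \<E>"
proof -
  have "\<exists>D\<in>\<E>. \<tau> ` standard_simplex m \<subseteq> D" if "\<tau> \<in> keys d" for \<tau>
  proof -
    have "\<exists>\<sigma>\<in>keys c. \<forall>y\<in>standard_simplex m. \<exists>s\<in>{0..1}. \<exists>x\<in>standard_simplex n. \<tau> y = H s (\<sigma> x)"
      using assms(1)[unfolded carried_by_homotopy_def] that by (rule bspec)
    then obtain \<sigma> where \<sigma>: "\<sigma> \<in> keys c"
      "\<forall>y\<in>standard_simplex m. \<exists>s\<in>{0..1}. \<exists>x\<in>standard_simplex n. \<tau> y = H s (\<sigma> x)"
      by (rule bexE)
    obtain D where D: "D \<in> \<E>" "\<sigma> ` standard_simplex n \<subseteq> D" and sing: "singular_simplex n X \<sigma>"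
      using assms(3) \<sigma>(1) unfolding piecewise_chains_def twisted_chains_def by blast
    have "H s (\<sigma> x) \<in> D" if "s \<in> {0..1}" "x \<in> standard_simplex n" for s x
      by (rule invariant) (use that assms(4) D singular_simplex_topspace[OF sing] in auto)
    then have "\<tau> ` standard_simplex m \<subseteq> D" using \<sigma>(2) by fastforce
    then show ?thesis using D(1) by blast
  qed
  then show ?thesis using assms(2) by (simp add: piecewise_chains_def)
qed

lemma piecewise_S: "piecewise_chains n X {S} = twisted_chains n (subtopology X S)"
  by (simp add: set_eq_iff piecewise_chains_def twisted_chains_subtopology)

lemma piecewise_diff:
  "c \<in> piecewise_chains n X \<D> \<Longrightarrow> d \<in> piecewise_chains n X \<D> \<Longrightarrow> c - d \<in> piecewise_chains n X \<D>"
  using keys_diff[of c d] by (auto simp: piecewise_chains_def)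

lemma piecewise_small:
  assumes "d \<in> twisted_chains m X"
    and small: "\<And>\<tau>. \<tau> \<in> keys d \<Longrightarrow> \<exists>V\<in>\<C>. \<tau> ` standard_simplex m \<subseteq> H 1 ` (V \<inter> topspace X)"
  shows "d \<in> piecewise_chains m X \<D>"
proof -
  have "\<exists>D\<in>\<D>. \<tau> ` standard_simplex m \<subseteq> D" if "\<tau> \<in> keys d" for \<tau>
  proof -
    from small[OF that] obtain V where V: "V \<in> \<C>" "\<tau> ` standard_simplex m \<subseteq> H 1 ` (V \<inter> topspace X)"
      by (rule bexE)
    obtain D where "D \<in> \<D>" "H 1 ` (V \<inter> topspace X) \<subseteq> D"
      using cover_pieces[OF V(1)] by (rule bexE)
    with V(2) show ?thesis by (intro bexI[of _ D] order_trans[OF V(2)])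
  qed
  with assms(1) show ?thesis by (simp add: piecewise_chains_def)
qed

text \<open>The replacement is \<open>A n c\<close>. By the homotopy formula it differs from
  \<open>c\<close> by a boundary and by \<open>P\<close> of the boundary of \<open>c\<close>, which
  lies in \<open>S\<close> because \<open>S\<close> is preserved.\<close>

proposition relcycle_piecewise:
  assumes c: "c \<in> twisted_relcycles L n X S"
  shows "\<exists>c'\<in>piecewise_chains n X \<D>. \<exists>b\<in>twisted_chains (Suc n) X.
    c - c' - twisted_boundary L (Suc n) b \<in> twisted_chains n (subtopology X S)"
proof -
  have cX: "c \<in> twisted_chains n X" and cS: "twisted_boundary L n c \<in> twisted_chains (n - 1) (subtopology X S)"
    using c by (auto simp: twisted_relcycles_def)
  obtain A P :: "nat \<Rightarrow> ('a, 'r) twisted_chain \<Rightarrow> ('a, 'r) twisted_chain" where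
    A_diff: "\<And>k c d. A k (c - d) = A k c - A k d"
      and A: "\<And>k c. c \<in> twisted_chains k X \<Longrightarrow> A k c \<in> twisted_chains k X"
      and P: "\<And>k c. c \<in> twisted_chains k X \<Longrightarrow> P k c \<in> twisted_chains (Suc k) X"
      and carried: "\<And>k c. c \<in> twisted_chains k X \<Longrightarrow> carried_by_homotopy k (A k c) k c"
        "\<And>k c. c \<in> twisted_chains k X \<Longrightarrow> carried_by_homotopy (Suc k) (P k c) k c"
      and bd: "\<And>k c. c \<in> twisted_chains (Suc k) X \<Longrightarrow>
          twisted_boundary L (Suc k) (A (Suc k) c) = A k (twisted_boundary L (Suc k) c)"
        "\<And>k c. c \<in> twisted_chains k X \<Longrightarrow>
          twisted_boundary L (Suc k) (P k c) = A k c - c - (if k = 0 then 0 else P (k - 1) (twisted_boundary L k c))"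
      and small: "\<And>\<tau>. \<tau> \<in> keys (A n c) \<Longrightarrow> \<exists>V\<in>\<C>. \<tau> ` standard_simplex n \<subseteq> H 1 ` (V \<inter> topspace X)"
    by (rule subdivision_homotopy[OF cover cX], assumption, rule that)
  show ?thesis
  proof (intro bexI)
    show "A n c \<in> piecewise_chains n X \<D>"
      by (rule piecewise_small[OF A[OF cX] small])
    show "- P n c \<in> twisted_chains (Suc n) X" using P[OF cX] by simp
    have "c - A n c - twisted_boundary L (Suc n) (- P n c) = - (if n = 0 then 0 else P (n - 1) (twisted_boundary L n c))"
      by (simp add: twisted_boundary_linear bd(2)[OF cX])
    moreover have "P (n - 1) (twisted_boundary L n c) \<in> twisted_chains n (subtopology X S)" if "n \<noteq> 0"
    proof -
      have cX': "twisted_boundary L n c \<in> twisted_chains (n - 1) X" by (rule twisted_boundary_chain[OF cX])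
      show ?thesis
        using carried_piecewise[OF carried(2)[OF cX'] P[OF cX'], of "{S}"] cS S_piece that by (simp add: piecewise_S)
    qed
    ultimately show "c - A n c - twisted_boundary L (Suc n) (- P n c) \<in> twisted_chains n (subtopology X S)"
      by auto
  qed
qed

text \<open>\<open>A (Suc n) b\<close> alone would bound \<open>A n f\<close> instead of
  \<open>f\<close>. The correction \<open>P n f\<close> repairs this and is piecewise because
  \<open>f\<close> is. The new error is \<open>A\<close> of the given error minus \<open>P\<close>
  of the boundary of \<open>f\<close>, both in \<open>S\<close>.\<close>

proposition relboundary_piecewise:
  assumes f: "f \<in> piecewise_chains n X \<D>" and b: "b \<in> twisted_chains (Suc n) X"
    and fb: "f - twisted_boundary L (Suc n) b \<in> twisted_chains n (subtopology X S)"
  shows "\<exists>b'\<in>piecewise_chains (Suc n) X \<D>.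
    f - twisted_boundary L (Suc n) b' \<in> twisted_chains n (subtopology X S)"
proof -
  have fX: "f \<in> twisted_chains n X" using f by (simp add: piecewise_chains_def)
  obtain A P :: "nat \<Rightarrow> ('a, 'r) twisted_chain \<Rightarrow> ('a, 'r) twisted_chain" where
    A_diff: "\<And>k c d. A k (c - d) = A k c - A k d"
      and A: "\<And>k c. c \<in> twisted_chains k X \<Longrightarrow> A k c \<in> twisted_chains k X"
      and P: "\<And>k c. c \<in> twisted_chains k X \<Longrightarrow> P k c \<in> twisted_chains (Suc k) X"
      and carried: "\<And>k c. c \<in> twisted_chains k X \<Longrightarrow> carried_by_homotopy k (A k c) k c"
        "\<And>k c. c \<in> twisted_chains k X \<Longrightarrow> carried_by_homotopy (Suc k) (P k c) k c"
      and bd: "\<And>k c. c \<in> twisted_chains (Suc k) X \<Longrightarrow>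
          twisted_boundary L (Suc k) (A (Suc k) c) = A k (twisted_boundary L (Suc k) c)"
        "\<And>k c. c \<in> twisted_chains k X \<Longrightarrow>
          twisted_boundary L (Suc k) (P k c) = A k c - c - (if k = 0 then 0 else P (k - 1) (twisted_boundary L k c))"
      and small: "\<And>\<tau>. \<tau> \<in> keys (A (Suc n) b) \<Longrightarrow> \<exists>V\<in>\<C>. \<tau> ` standard_simplex (Suc n) \<subseteq> H 1 ` (V \<inter> topspace X)"
    by (rule subdivision_homotopy[OF cover b], assumption, rule that)
  let ?s = "f - twisted_boundary L (Suc n) b"
  have sX: "?s \<in> twisted_chains n X" using fb by (simp add: twisted_chains_subtopology)
  show ?thesis
  proof (intro bexI)
    have "A (Suc n) b \<in> piecewise_chains (Suc n) X \<D>"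
      by (rule piecewise_small[OF A[OF b] small])
    moreover have "P n f \<in> piecewise_chains (Suc n) X \<D>"
      by (rule carried_piecewise[OF carried(2)[OF fX] P[OF fX] f subset_refl])
    ultimately show "A (Suc n) b - P n f \<in> piecewise_chains (Suc n) X \<D>" by (rule piecewise_diff)
    have "f - twisted_boundary L (Suc n) (A (Suc n) b - P n f) =
        A n ?s - (if n = 0 then 0 else P (n - 1) (twisted_boundary L n f))"
      by (simp add: twisted_boundary_linear bd(1)[OF b] bd(2)[OF fX] A_diff)
    moreover have "A n ?s \<in> twisted_chains n (subtopology X S)"
      using carried_piecewise[OF carried(1)[OF sX] A[OF sX], of "{S}"] fb S_piece by (simp add: piecewise_S)
    moreover have "P (n - 1) (twisted_boundary L n f) \<in> twisted_chains n (subtopology X S)" if "n \<noteq> 0"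
    proof -
      have fX': "twisted_boundary L n f \<in> twisted_chains (n - 1) X" by (rule twisted_boundary_chain[OF fX])
      \<comment> \<open>\<open>f\<close> and the error \<open>?s\<close> differ by a boundary, so
        their boundaries agree, and that of \<open>?s\<close> lies in \<open>S\<close>.\<close>
      have "twisted_boundary L n f = twisted_boundary L n ?s"
        using twisted_boundary_boundary[OF local_system b] by (simp add: twisted_boundary_linear)
      then have "twisted_boundary L n f \<in> twisted_chains (n - 1) (subtopology X S)"
        using twisted_boundary_chain[OF fb] by simp
      then show ?thesis
        using carried_piecewise[OF carried(2)[OF fX'] P[OF fX'], of "{S}"] S_piece that by (simp add: piecewise_S)
    qed
    ultimately show "f - twisted_boundary L (Suc n) (A (Suc n) b - P n f) \<in> twisted_chains n (subtopology X S)"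
      by auto
  qed
qed

end

section \<open>Disjoint cells\<close>

definition pm_restrict :: "'a set \<Rightarrow> ('a \<Rightarrow>\<^sub>0 'r::comm_ring_1) \<Rightarrow> 'a \<Rightarrow>\<^sub>0 'r"
  where "pm_restrict K = pm_extend (\<lambda>a. if a \<in> K then single a 1 else 0)"

lemma lookup_pm_restrict: "lookup (pm_restrict K c) a = (if a \<in> K then lookup c a else 0)"
proof -
  have "lookup (pm_restrict K c) a = (\<Sum>b\<in>keys c. if b = a then (if a \<in> K then lookup c a else 0) else 0)"
    unfolding pm_restrict_def pm_extend_def lookup_sum
    by (rule sum.cong) (auto simp: lookup_single)
  then show ?thesis by (simp add: in_keys_iff)
qed

text \<open>Greedy splitting: the simplices inside \<open>D r\<close> are removed, and each
  remaining one lies in \<open>S\<close> or in a cell that is still to be treated.\<close>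

lemma piecewise_decompose:
  assumes "finite W" "c \<in> piecewise_chains n X (insert S (D ` W))"
  shows "\<exists>d. (\<forall>r\<in>W. d r \<in> twisted_chains n (subtopology X (D r))) \<and>
    c - (\<Sum>r\<in>W. d r) \<in> twisted_chains n (subtopology X S)"
  using assms
proof (induction W arbitrary: c rule: finite_induct)
  case empty
  then show ?case by (auto simp: piecewise_chains_def twisted_chains_subtopology)
next
  case (insert r W)
  define K where "K = {\<sigma>. \<sigma> ` standard_simplex n \<subseteq> D r}"
  let ?d = "pm_restrict K c"
  have keys: "keys ?d \<subseteq> keys c \<inter> K" "keys (c - ?d) \<subseteq> keys c - K"
    by (auto simp: in_keys_iff lookup_pm_restrict lookup_minus split: if_splits)
  have cX: "keys c \<subseteq> singular_simplex_set n X"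
    using insert.prems by (simp add: piecewise_chains_def twisted_chains_def)
  have "?d \<in> twisted_chains n X" "c - ?d \<in> twisted_chains n X"
    using keys cX by (auto simp: twisted_chains_def)
  moreover have "\<sigma> ` standard_simplex n \<subseteq> D r" if "\<sigma> \<in> keys ?d" for \<sigma>
    using that keys(1) unfolding K_def by blast
  ultimately have "?d \<in> twisted_chains n (subtopology X (D r))" "c - ?d \<in> twisted_chains n X"
    by (simp_all add: twisted_chains_subtopology)
  moreover have "\<exists>E\<in>insert S (D ` W). \<sigma> ` standard_simplex n \<subseteq> E" if "\<sigma> \<in> keys (c - ?d)" for \<sigma>
  proof -
    have "\<sigma> \<in> keys c" "\<sigma> \<notin> K" using that keys(2) by blast+
    moreover from this(1) obtain E where E: "E \<in> insert S (D ` insert r W)" "\<sigma> ` standard_simplex n \<subseteq> E"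
      using insert.prems unfolding piecewise_chains_def by blast
    ultimately have "E \<noteq> D r" by (auto simp: K_def)
    with E show ?thesis by blast
  qed
  ultimately have "?d \<in> twisted_chains n (subtopology X (D r))" "c - ?d \<in> piecewise_chains n X (insert S (D ` W))"
    by (simp_all add: piecewise_chains_def)
  moreover from this(2) obtain d where d: "\<forall>r\<in>W. d r \<in> twisted_chains n (subtopology X (D r))"
      "c - ?d - (\<Sum>r\<in>W. d r) \<in> twisted_chains n (subtopology X S)"
    using insert.IH by blast
  have "(\<Sum>q\<in>insert r W. (d(r := ?d)) q) = ?d + (\<Sum>r\<in>W. d r)"
    using insert.hyps by (simp add: sum.insert) (rule sum.cong, auto)
  then have "c - (\<Sum>q\<in>insert r W. (d(r := ?d)) q) \<in> twisted_chains n (subtopology X S)"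
    using d(2) by (simp add: algebra_simps)
  then show ?case
    using d(1) \<open>?d \<in> twisted_chains n (subtopology X (D r))\<close> insert.hyps by (intro exI[of _ "d(r := ?d)"]) auto
qed

text \<open>A simplex of \<open>d r\<close> that is not inside \<open>S\<close> occurs in no other
  summand, since it would lie in two cells. Its coefficient therefore survives in the sum.\<close>

lemma piecewise_separate:
  assumes W: "finite W" and d: "\<And>r. r \<in> W \<Longrightarrow> d r \<in> twisted_chains n (subtopology X (D r))"
    and disj: "\<And>r q. r \<in> W \<Longrightarrow> q \<in> W \<Longrightarrow> r \<noteq> q \<Longrightarrow> D r \<inter> D q \<subseteq> S"
    and sum: "(\<Sum>r\<in>W. d r) \<in> twisted_chains n (subtopology X S)" and r: "r \<in> W"
  shows "d r \<in> twisted_chains n (subtopology X S)"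
proof -
  have "\<sigma> ` standard_simplex n \<subseteq> S" if \<sigma>: "\<sigma> \<in> keys (d r)" for \<sigma>
  proof (rule ccontr)
    assume not: "\<not> \<sigma> ` standard_simplex n \<subseteq> S"
    have "lookup (d q) \<sigma> = 0" if "q \<in> W" "q \<noteq> r" for q
    proof (rule ccontr)
      assume "lookup (d q) \<sigma> \<noteq> 0"
      then have "\<sigma> ` standard_simplex n \<subseteq> D q" "\<sigma> ` standard_simplex n \<subseteq> D r"
        using d[OF that(1)] d[OF r] \<sigma> by (auto simp: twisted_chains_subtopology in_keys_iff)
      with disj[OF r that(1)] that not show False by blast
    qed
    then have "lookup (\<Sum>r\<in>W. d r) \<sigma> = (\<Sum>q\<in>W. if q = r then lookup (d r) \<sigma> else 0)"
      unfolding lookup_sum by (intro sum.cong) auto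
    then have "lookup (\<Sum>r\<in>W. d r) \<sigma> = lookup (d r) \<sigma>" using W r by simp
    then have "\<sigma> \<in> keys (\<Sum>r\<in>W. d r)" using \<sigma> by (simp add: in_keys_iff)
    with sum not show False by (auto simp: twisted_chains_subtopology)
  qed
  then show ?thesis using d[OF r] by (simp add: twisted_chains_subtopology)
qed

text \<open>Expresses that the homology of \<open>Q\<close> relative to \<open>B\<close> in degree \<open>n\<close> is free with basis the class of \<open>\<kappa>\<close>.
  The constant local system suffices, since all others are trivialised over a convex set.\<close>

definition fundamental_chain ::
    "nat \<Rightarrow> (nat \<Rightarrow> real) set \<Rightarrow> (nat \<Rightarrow> real) set \<Rightarrow> (nat \<Rightarrow> real, 'r::comm_ring_1) twisted_chain \<Rightarrow> bool"
  where "fundamental_chain n Q B \<kappa> \<longleftrightarrow>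
    \<kappa> \<in> twisted_relcycles (\<lambda>_. 1) n (real_top Q) B \<and>
    (\<forall>d \<in> twisted_relcycles (\<lambda>_. 1) n (real_top Q) B. \<exists>a. \<exists>b \<in> twisted_chains (Suc n) (real_top Q).
      d - pm_scale a \<kappa> - twisted_boundary (\<lambda>_. 1) (Suc n) b \<in> twisted_chains n (subtopology (real_top Q) B)) \<and>
    (\<forall>a. \<forall>b \<in> twisted_chains (Suc n) (real_top Q).
      pm_scale a \<kappa> - twisted_boundary (\<lambda>_. 1) (Suc n) b \<in> twisted_chains n (subtopology (real_top Q) B) \<longrightarrow> a = 0)"

lemma push_subtopology:
  assumes F: "continuous_map (real_top Z) X F" and FB: "F ` (Z \<inter> B) \<subseteq> S"
    and c: "c \<in> twisted_chains n (subtopology (real_top Z) B)"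
  shows "push L F z n c \<in> twisted_chains n (subtopology X S)"
proof -
  have "continuous_map (real_top (Z \<inter> B)) (subtopology X S) F"
    using continuous_map_from_subtopology[OF F, of B] FB
    by (auto simp: continuous_map_in_subtopology subtopology_subtopology)
  from push_chain[OF this] c show ?thesis by (simp add: subtopology_subtopology)
qed

text \<open>\<open>Q\<close> is a convex model of a cell, \<open>B\<close> the part of it mapped
  into \<open>S\<close>, and \<open>z\<close> the point at which the trivialisation of the system is
  normalised. The left inverse \<open>g\<close> allows chains in the image to be pulled
  back.\<close>

locale embedded_cell =
  fixes X :: "'a topology" and L :: "(real \<Rightarrow> 'a) \<Rightarrow> 'r::comm_ring_1" and S :: "'a set"
    and Q B :: "(nat \<Rightarrow> real) set" and z :: "nat \<Rightarrow> real" and s :: "(nat \<Rightarrow> real) \<Rightarrow> 'a" and g :: "'a \<Rightarrow> nat \<Rightarrow> real"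
  assumes cell_system: "rank_one_local_system X L"
    and Q: "seg_convex Q" "z \<in> Q" and s: "continuous_map (real_top Q) X s"
    and g: "continuous_map (subtopology X (s ` Q)) (real_top Q) g"
    and gs: "t \<in> Q \<Longrightarrow> g (s t) = t"
    and sB: "t \<in> Q \<Longrightarrow> s t \<in> S \<longleftrightarrow> t \<in> B"
begin

text \<open>The inverse of \<open>push\<close>: coefficients are transported from vertex 0 back to
  the base point.\<close>

definition pull where
  "pull n = pm_extend (\<lambda>\<sigma>. single (simplex_map n g \<sigma>) (L (s \<circ> seg (g (\<sigma> (vertex 0))) z)))"

lemma pull_chain:
  assumes "c \<in> twisted_chains n (subtopology X (s ` Q))"
  shows "pull n c \<in> twisted_chains n (real_top Q)"
  unfolding pull_def
proof (rule twisted_chains_extend)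
  fix \<sigma> assume "\<sigma> \<in> keys c"
  then have "singular_simplex n (real_top Q) (simplex_map n g \<sigma>)"
    using assms g by (intro singular_simplex_simplex_map) (auto simp: twisted_chains_def)
  then show "single (simplex_map n g \<sigma>) (L (s \<circ> seg (g (\<sigma> (vertex 0))) z)) \<in> twisted_chains n (real_top Q)"
    by (simp add: twisted_chains_single)
qed

lemma push_cell: "c \<in> twisted_chains n (real_top Q) \<Longrightarrow> push L s z n c \<in> twisted_chains n (subtopology X (s ` Q))"
  using push_subtopology[OF s, of UNIV "s ` Q"] by simp

lemma push_pull:
  assumes "c \<in> twisted_chains n (subtopology X (s ` Q))"
  shows "push L s z n (pull n c) = c"
proof -
  have "pm_extend (push_simplex L s z n) (single (simplex_map n g \<sigma>) (L (s \<circ> seg (g (\<sigma> (vertex 0))) z))) = single \<sigma> 1"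
    if "\<sigma> \<in> keys c" for \<sigma>
  proof -
    have \<sigma>: "singular_simplex n (subtopology X (s ` Q)) \<sigma>" using assms that by (auto simp: twisted_chains_def)
    then have im: "\<exists>t\<in>Q. \<sigma> x = s t" if "x \<in> standard_simplex n" for x
      using that by (auto simp: singular_simplex_subtopology)
    have sg: "simplex_map n s (simplex_map n g \<sigma>) = \<sigma>"
    proof
      fix x show "simplex_map n s (simplex_map n g \<sigma>) x = \<sigma> x"
      proof (cases "x \<in> standard_simplex n")
        case True
        then show ?thesis using im[OF True] gs by (auto simp: simplex_map_def)
      next
        case False
        then show ?thesis using \<sigma> by (simp add: simplex_map_def singular_simplex_def extensional_def)
      qed
    qed
    obtain t where t: "t \<in> Q" "\<sigma> (vertex 0) = s t" using im[of "vertex 0"] by auto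
    moreover have "simplex_map n g \<sigma> (vertex 0) = t" using t gs by (simp add: simplex_map_def)
    moreover have "L (s \<circ> seg t z) * L (s \<circ> seg z t) = 1"
      by (rule local_system_segment_inverse[OF cell_system s Q t(1)])
    ultimately show ?thesis
      by (simp add: push_simplex_def sg gs)
  qed
  then show ?thesis
    unfolding push_def pull_def pm_extend_extend
    by (subst pm_extend_cong[where g = "\<lambda>\<sigma>. single \<sigma> 1"]) auto
qed

lemma pull_push:
  assumes "c \<in> twisted_chains n (real_top Q)"
  shows "pull n (push L s z n c) = c"
proof -
  have "pull n (push_simplex L s z n \<tau>) = single \<tau> 1" if "\<tau> \<in> keys c" for \<tau>
  proof -
    have \<tau>: "singular_simplex n (real_top Q) \<tau>" using assms that by (auto simp: twisted_chains_def)
    then have im: "\<tau> x \<in> Q" if "x \<in> standard_simplex n" for x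
      using that by (auto simp: singular_simplex_def continuous_map_real_top Pi_iff)
    have gs_\<tau>: "simplex_map n g (simplex_map n s \<tau>) = \<tau>"
    proof
      fix x show "simplex_map n g (simplex_map n s \<tau>) x = \<tau> x"
      proof (cases "x \<in> standard_simplex n")
        case True
        then show ?thesis using im[OF True] gs by (auto simp: simplex_map_def)
      next
        case False
        then show ?thesis using \<tau> by (simp add: simplex_map_def singular_simplex_def extensional_def)
      qed
    qed
    have v: "\<tau> (vertex 0) \<in> Q" by (intro im) simp
    have "g (simplex_map n s \<tau> (vertex 0)) = \<tau> (vertex 0)" using v gs by (simp add: simplex_map_def)
    moreover have "L (s \<circ> seg (\<tau> (vertex 0)) z) * L (s \<circ> seg z (\<tau> (vertex 0))) = 1"
      by (rule local_system_segment_inverse[OF cell_system s Q v])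
    ultimately show ?thesis
      by (simp add: pull_def push_simplex_def gs_\<tau> mult.commute)
  qed
  then show ?thesis
    unfolding push_def pull_def pm_extend_extend
    by (subst pm_extend_cong[where g = "\<lambda>\<sigma>. single \<sigma> 1"]) auto
qed

text \<open>For the direction from \<open>S\<close> to \<open>B\<close>, no simplex of
  \<open>c\<close> can disappear from the push-forward by cancellation, because \<open>pull\<close>
  recovers \<open>c\<close> from it.\<close>

lemma push_in_S_iff:
  assumes "c \<in> twisted_chains n (real_top Q)"
  shows "push L s z n c \<in> twisted_chains n (subtopology X S) \<longleftrightarrow> c \<in> twisted_chains n (subtopology (real_top Q) B)"
proof
  assume "c \<in> twisted_chains n (subtopology (real_top Q) B)"
  then show "push L s z n c \<in> twisted_chains n (subtopology X S)"
    by (rule push_subtopology[OF s, rotated]) (use sB in auto)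
next
  assume S: "push L s z n c \<in> twisted_chains n (subtopology X S)"
  have "\<tau> x \<in> B" if \<tau>: "\<tau> \<in> keys c" and x: "x \<in> standard_simplex n" for \<tau> x
  proof -
    have "\<tau> \<in> keys (pull n (push L s z n c))" using \<tau> pull_push[OF assms] by simp
    then obtain \<sigma> where \<sigma>: "\<sigma> \<in> keys (push L s z n c)" "\<tau> = simplex_map n g \<sigma>"
      unfolding pull_def using keys_pm_extend by (fastforce split: if_splits)
    then have "\<sigma> x \<in> S" "\<sigma> x \<in> s ` Q"
      using S push_cell[OF assms] x unfolding twisted_chains_subtopology by blast+
    then show ?thesis using \<sigma>(2) x gs sB by (auto simp: simplex_map_def)
  qed
  then show "c \<in> twisted_chains n (subtopology (real_top Q) B)"
    using assms by (auto simp: twisted_chains_subtopology)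
qed

lemma cell_spanned:
  assumes \<kappa>: "fundamental_chain n Q B \<kappa>" and c: "c \<in> twisted_chains n (subtopology X (s ` Q))"
    and cS: "twisted_boundary L n c \<in> twisted_chains (n - 1) (subtopology X S)"
  shows "\<exists>a. \<exists>b\<in>twisted_chains (Suc n) X.
    c - pm_scale a (push L s z n \<kappa>) - twisted_boundary L (Suc n) b \<in> twisted_chains n (subtopology X S)"
proof -
  let ?d = "pull n c"
  have d: "?d \<in> twisted_chains n (real_top Q)" by (rule pull_chain[OF c])
  have bd: "twisted_boundary L n c = push L s z (n - 1) (twisted_boundary (\<lambda>_. 1) n ?d)"
    using push_boundary[OF cell_system s Q d] by (simp add: push_pull[OF c])
  have "?d \<in> twisted_relcycles (\<lambda>_. 1) n (real_top Q) B"
    using d cS push_in_S_iff[OF twisted_boundary_chain[OF d]] by (simp add: twisted_relcycles_def bd)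
  then obtain a b where b: "b \<in> twisted_chains (Suc n) (real_top Q)"
      and *: "?d - pm_scale a \<kappa> - twisted_boundary (\<lambda>_. 1) (Suc n) b \<in> twisted_chains n (subtopology (real_top Q) B)"
    using \<kappa> unfolding fundamental_chain_def by blast
  have "push L s z n (?d - pm_scale a \<kappa> - twisted_boundary (\<lambda>_. 1) (Suc n) b) \<in> twisted_chains n (subtopology X S)"
    using * push_in_S_iff by (auto simp: twisted_chains_subtopology)
  then have "c - pm_scale a (push L s z n \<kappa>) - twisted_boundary L (Suc n) (push L s z (Suc n) b) \<in> twisted_chains n (subtopology X S)"
    using push_boundary[OF cell_system s Q b] by (simp add: push_linear push_pull[OF c])
  then show ?thesis using push_chain[OF s b] by blast
qed

text \<open>The bounding chain has to lie in the cell so that it can be pulled back;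
  \<open>relboundary_piecewise\<close> and the splitting into cells provide such a chain.\<close>

lemma cell_free:
  assumes \<kappa>: "fundamental_chain n Q B \<kappa>" and b: "b \<in> twisted_chains (Suc n) (subtopology X (s ` Q))"
    and *: "pm_scale a (push L s z n \<kappa>) - twisted_boundary L (Suc n) b \<in> twisted_chains n (subtopology X S)"
  shows "a = 0"
proof -
  let ?b = "pull (Suc n) b"
  have d: "?b \<in> twisted_chains (Suc n) (real_top Q)" by (rule pull_chain[OF b])
  have "\<kappa> \<in> twisted_chains n (real_top Q)" using \<kappa> by (simp add: fundamental_chain_def twisted_relcycles_def)
  then have "pm_scale a \<kappa> - twisted_boundary (\<lambda>_. 1) (Suc n) ?b \<in> twisted_chains n (real_top Q)"
    using twisted_boundary_chain[OF d] by (intro twisted_chains_diff twisted_chains_scale) auto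
  moreover have "push L s z n (pm_scale a \<kappa> - twisted_boundary (\<lambda>_. 1) (Suc n) ?b) \<in> twisted_chains n (subtopology X S)"
    using * push_boundary[OF cell_system s Q d] by (simp add: push_linear push_pull[OF b])
  ultimately have "pm_scale a \<kappa> - twisted_boundary (\<lambda>_. 1) (Suc n) ?b \<in> twisted_chains n (subtopology (real_top Q) B)"
    by (simp add: push_in_S_iff)
  with \<kappa> d show ?thesis unfolding fundamental_chain_def by blast
qed

end

text \<open>All cells share the model \<open>Q\<close>, its subset \<open>B\<close> and the
  fundamental chain. It is instantiated with one cell per word in the configuration space, and with
  a single face, indexed by \<open>unit\<close>, in the frontier of a cube.\<close>

locale retraction_to_cells =
  retraction_to_pieces X L H S \<C> "insert S ((\<lambda>r. s r ` Q) ` W)"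
  for X :: "'a topology" and L :: "(real \<Rightarrow> 'a) \<Rightarrow> 'r::comm_ring_1" and H S \<C>
    and s :: "'w \<Rightarrow> (nat \<Rightarrow> real) \<Rightarrow> 'a" and Q and W :: "'w set" +
  fixes B z n and \<kappa> :: "(nat \<Rightarrow> real, 'r) twisted_chain" and g :: "'w \<Rightarrow> 'a \<Rightarrow> nat \<Rightarrow> real"
  assumes W: "finite W"
    and cells: "r \<in> W \<Longrightarrow> embedded_cell X L S Q B z (s r) (g r)"
    and disjoint_cells: "r \<in> W \<Longrightarrow> r' \<in> W \<Longrightarrow> r \<noteq> r' \<Longrightarrow> s r ` Q \<inter> s r' ` Q \<subseteq> S"
    and fundamental: "fundamental_chain n Q B \<kappa>"
begin

abbreviation "cell_chain r \<equiv> push L (s r) z n \<kappa>"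

lemma \<kappa>_chain: "\<kappa> \<in> twisted_chains n (real_top Q)"
  using fundamental by (simp add: fundamental_chain_def twisted_relcycles_def)

lemma cell_chain: "r \<in> W \<Longrightarrow> cell_chain r \<in> twisted_chains n (subtopology X (s r ` Q))"
  using embedded_cell.push_cell[OF cells \<kappa>_chain] .

lemma cell_chain_relcycle:
  assumes r: "r \<in> W" shows "cell_chain r \<in> twisted_relcycles L n X S"
proof -
  interpret embedded_cell X L S Q B z "s r" "g r" by (rule cells[OF r])
  have "push L (s r) z (n - 1) (twisted_boundary (\<lambda>_. 1) n \<kappa>) \<in> twisted_chains (n - 1) (subtopology X S)"
    using fundamental push_in_S_iff[OF twisted_boundary_chain[OF \<kappa>_chain]]
    by (simp add: fundamental_chain_def twisted_relcycles_def)
  then show ?thesis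
    using cell_chain[OF r] push_boundary[OF cell_system s Q \<kappa>_chain]
    by (simp add: twisted_relcycles_def twisted_chains_subtopology)
qed

lemma cells_span:
  assumes c: "c \<in> twisted_relcycles L n X S"
  shows "\<exists>a. \<exists>b\<in>twisted_chains (Suc n) X.
    c - (\<Sum>r\<in>W. pm_scale (a r) (cell_chain r)) - twisted_boundary L (Suc n) b \<in> twisted_chains n (subtopology X S)"
proof -
  obtain c' b where c': "c' \<in> piecewise_chains n X (insert S ((\<lambda>r. s r ` Q) ` W))"
    and b: "b \<in> twisted_chains (Suc n) X"
    and bc: "c - c' - twisted_boundary L (Suc n) b \<in> twisted_chains n (subtopology X S)"
    using relcycle_piecewise[OF c] by blast
  obtain d where d: "\<And>r. r \<in> W \<Longrightarrow> d r \<in> twisted_chains n (subtopology X (s r ` Q))"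
    and dc: "c' - (\<Sum>r\<in>W. d r) \<in> twisted_chains n (subtopology X S)"
    using piecewise_decompose[OF W c'] by blast
  let ?e = "c - (\<Sum>r\<in>W. d r) - twisted_boundary L (Suc n) b"
  have e: "?e \<in> twisted_chains n (subtopology X S)"
    using twisted_chains_add[OF bc dc] by (simp add: algebra_simps)
  \<comment> \<open>At first only the sum of the cell parts is known to be a relative cycle. Each
    boundary stays in its own cell, so separation yields the same for every part.\<close>
  have "(\<Sum>r\<in>W. twisted_boundary L n (d r)) = twisted_boundary L n c - twisted_boundary L n ?e"
    using twisted_boundary_boundary[OF local_system b]
    by (simp add: twisted_boundary_linear twisted_boundary_sum)
  also have "\<dots> \<in> twisted_chains (n - 1) (subtopology X S)"
    by (rule twisted_chains_diff[OF _ twisted_boundary_chain[OF e]]) (use c in \<open>simp add: twisted_relcycles_def\<close>)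
  finally have dsum: "(\<Sum>r\<in>W. twisted_boundary L n (d r)) \<in> twisted_chains (n - 1) (subtopology X S)" .
  have dS: "twisted_boundary L n (d r) \<in> twisted_chains (n - 1) (subtopology X S)" if "r \<in> W" for r
    by (rule piecewise_separate[OF W twisted_boundary_chain[OF d] disjoint_cells dsum that])
  have "\<exists>a. \<exists>b\<in>twisted_chains (Suc n) X.
      d r - pm_scale a (cell_chain r) - twisted_boundary L (Suc n) b \<in> twisted_chains n (subtopology X S)" if "r \<in> W" for r
    by (rule embedded_cell.cell_spanned[OF cells[OF that] fundamental d[OF that] dS[OF that]])
  then obtain a f where f: "\<And>r. r \<in> W \<Longrightarrow> f r \<in> twisted_chains (Suc n) X"
    and af: "\<And>r. r \<in> W \<Longrightarrow> d r - pm_scale (a r) (cell_chain r) - twisted_boundary L (Suc n) (f r) \<in> twisted_chains n (subtopology X S)"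
    by metis
  have "c - (\<Sum>r\<in>W. pm_scale (a r) (cell_chain r)) - twisted_boundary L (Suc n) (b + (\<Sum>r\<in>W. f r)) =
      ?e + (\<Sum>r\<in>W. d r - pm_scale (a r) (cell_chain r) - twisted_boundary L (Suc n) (f r))"
    by (simp add: twisted_boundary_linear twisted_boundary_sum sum_subtractf sum.distrib algebra_simps)
  also have "\<dots> \<in> twisted_chains n (subtopology X S)"
    by (intro twisted_chains_add e twisted_chains_sum af)
  finally show ?thesis
    using b f by (intro exI[of _ a] bexI[of _ "b + (\<Sum>r\<in>W. f r)"] twisted_chains_add twisted_chains_sum)
qed

lemma cells_independent:
  assumes b: "b \<in> twisted_chains (Suc n) X"
    and *: "(\<Sum>r\<in>W. pm_scale (a r) (cell_chain r)) - twisted_boundary L (Suc n) b \<in> twisted_chains n (subtopology X S)"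
    and r: "r \<in> W"
  shows "a r = 0"
proof -
  let ?\<D> = "insert S ((\<lambda>r. s r ` Q) ` W)"
  have cell: "pm_scale (a r) (cell_chain r) \<in> piecewise_chains n X ?\<D>" if "r \<in> W" for r
    using twisted_chains_scale[OF cell_chain[OF that], of "a r"] that
    by (auto simp: piecewise_chains_def twisted_chains_subtopology intro!: bexI[of _ "s r ` Q"])
  have "(\<Sum>r\<in>V. pm_scale (a r) (cell_chain r)) \<in> piecewise_chains n X ?\<D>" if "V \<subseteq> W" for V
    using finite_subset[OF that W] that
  proof (induction V rule: finite_induct)
    case (insert x F)
    have add: "p + q \<in> piecewise_chains n X ?\<D>" if "p \<in> piecewise_chains n X ?\<D>" "q \<in> piecewise_chains n X ?\<D>" for p q
      using that keys_add[of p q] unfolding piecewise_chains_def by blast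
    have "x \<in> W" "F \<subseteq> W" using insert.prems by auto
    from add[OF cell[OF this(1)] insert.IH[OF this(2)]] show ?case using insert.hyps by simp
  qed (simp add: piecewise_chains_def)
  \<comment> \<open>The given bounding chain may leave the cells; a piecewise one splits in the same
    way as the relation itself.\<close>
  from relboundary_piecewise[OF this[OF subset_refl] b *]
  obtain b' where b': "b' \<in> piecewise_chains (Suc n) X ?\<D>"
    and *: "(\<Sum>r\<in>W. pm_scale (a r) (cell_chain r)) - twisted_boundary L (Suc n) b' \<in> twisted_chains n (subtopology X S)"
    by blast
  obtain f where f: "\<And>r. r \<in> W \<Longrightarrow> f r \<in> twisted_chains (Suc n) (subtopology X (s r ` Q))"
    and e: "b' - (\<Sum>r\<in>W. f r) \<in> twisted_chains (Suc n) (subtopology X S)"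
    using piecewise_decompose[OF W b'] by blast
  let ?d = "\<lambda>r. pm_scale (a r) (cell_chain r) - twisted_boundary L (Suc n) (f r)"
  have d: "?d r \<in> twisted_chains n (subtopology X (s r ` Q))" if "r \<in> W" for r
    using twisted_boundary_chain[OF f[OF that]] that
    by (intro twisted_chains_diff twisted_chains_scale cell_chain) auto
  have "(\<Sum>r\<in>W. ?d r) = (\<Sum>r\<in>W. pm_scale (a r) (cell_chain r)) - twisted_boundary L (Suc n) b'
      + twisted_boundary L (Suc n) (b' - (\<Sum>r\<in>W. f r))"
    by (simp add: twisted_boundary_linear twisted_boundary_sum sum_subtractf sum.distrib algebra_simps)
  also have "\<dots> \<in> twisted_chains n (subtopology X S)"
    using * twisted_boundary_chain[OF e] by auto
  finally have dsum: "(\<Sum>r\<in>W. ?d r) \<in> twisted_chains n (subtopology X S)" .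
  have "?d r \<in> twisted_chains n (subtopology X S)"
    by (rule piecewise_separate[OF W d disjoint_cells dsum r])
  then show ?thesis
    by (rule embedded_cell.cell_free[OF cells[OF r] fundamental f[OF r]])
qed

end

section \<open>The relative homology of the cube\<close>

text \<open>The coordinates beyond the dimension are padded with \<open>1\<close>, which makes the cube of dimension \<open>n\<close>
  a face of the cube of dimension \<open>Suc n\<close>; the horn consists of the remaining faces.\<close>

definition cube :: "nat \<Rightarrow> (nat \<Rightarrow> real) set"
  where "cube n = {t. \<forall>j. 0 \<le> t j \<and> t j \<le> 1 \<and> (n \<le> j \<longrightarrow> t j = 1)}"

definition cube_frontier :: "nat \<Rightarrow> (nat \<Rightarrow> real) set"
  where "cube_frontier n = {t \<in> cube n. \<exists>j<n. t j = 0 \<or> t j = 1}"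

definition cube_horn :: "nat \<Rightarrow> (nat \<Rightarrow> real) set"
  where "cube_horn n = {t \<in> cube (Suc n). t n = 0 \<or> (\<exists>j<n. t j = 0 \<or> t j = 1)}"

lemma cube_face: "cube n = {t \<in> cube (Suc n). t n = 1}"
  by (auto simp: cube_def Suc_le_eq) (metis le_neq_implies_less)

lemma cube_frontier_Suc: "cube_frontier (Suc n) = cube_horn n \<union> cube n"
  unfolding cube_face[of n] by (auto simp: cube_frontier_def cube_horn_def less_Suc_eq)

lemma cube_Int_horn: "cube n \<inter> cube_horn n = cube_frontier n"
  unfolding cube_frontier_def cube_horn_def by (auto simp: cube_face[of n])

lemma cube_mem: "t \<in> cube n \<Longrightarrow> 0 \<le> t j \<and> t j \<le> 1" "t \<in> cube n \<Longrightarrow> n \<le> j \<Longrightarrow> t j = 1"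
  by (auto simp: cube_def)

lemma ones_in_cube [simp]: "(\<lambda>_. 1) \<in> cube n"
  by (simp add: cube_def)

lemma seg_convex_cube: "seg_convex (cube n)"
proof -
  have "seg x y u j \<in> {0..1}" if "x j \<in> {0..1}" "y j \<in> {0..1}" "u \<in> {0..1}" for x y u j
    using that convexD_alt[of "{0..1::real}" "x j" "y j" u] by (auto simp: seg_def convex_real_interval)
  moreover have "seg x y u j = 1" if "x j = 1" "y j = 1" for x y u j using that by (simp add: seg_def)
  ultimately show ?thesis by (force simp: seg_convex_def cube_def)
qed

section \<open>The standard triangulation of the cube and its boundary\<close>

definition integral_cube_chain :: "nat \<Rightarrow> (nat \<Rightarrow> real) chain"
  where "integral_cube_chain n = (\<Sum>\<pi> | \<pi> permutes {..<n}.
    frag_cmul ((-1) ^ n * sign \<pi>) (frag_of (restrict (cube_simplex \<pi>) (standard_simplex n))))"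

lemma cube_chain_integral: "cube_chain n (\<lambda>t. t) = pm_of_int (integral_cube_chain n)"
  by (simp add: cube_chain_def integral_cube_chain_def pm_of_int_sum restrict_def)

text \<open>Partial sums of barycentric coordinates lie between 0 and 1. For \<open>j\<close> at
  least \<open>n\<close> the permutation fixes \<open>j\<close> and the sum is complete, which
  yields the padding value 1.\<close>

lemma cube_simplex_in_cube:
  assumes "\<pi> permutes {..<n}" "x \<in> standard_simplex n"
  shows "cube_simplex \<pi> x \<in> cube n"
proof -
  have x: "\<And>i. 0 \<le> x i" "\<And>i. i > n \<Longrightarrow> x i = 0" "sum x {..n} = 1"
    using assms(2) by (auto simp: standard_simplex_def)
  have le: "sum x {..p} \<le> 1" for p
  proof -
    have "sum x {..p} \<le> sum x {..max p n}" by (intro sum_mono2) (auto simp: x)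
    also have "\<dots> = sum x {..n}" by (rule sum.mono_neutral_right) (auto simp: x)
    finally show ?thesis by (simp add: x)
  qed
  have "sum x {..p} = 1" if "n \<le> p" for p
    using sum.mono_neutral_right[of "{..p}" "{..n}" x] that by (auto simp: x)
  moreover have "n \<le> \<pi> j" if "n \<le> j" for j
    using permutes_not_in[OF assms(1), of j] that by simp
  ultimately show ?thesis using le by (auto simp: cube_def cube_simplex_def sum_nonneg x(1))
qed

lemma singular_simplex_cube:
  assumes "\<pi> permutes {..<n}"
  shows "singular_simplex n (real_top (cube n)) (restrict (cube_simplex \<pi>) (standard_simplex n))"
proof -
  have "continuous_map (real_top (standard_simplex n)) (real_top (cube n)) (cube_simplex \<pi>)"
    using cube_simplex_in_cube[OF assms]
    by (auto simp: continuous_map_real_top cube_simplex_def intro!: continuous_map_sum continuous_map_real_top_coord)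
  then show ?thesis
    by (simp add: singular_simplex_def)
qed

lemma singular_chain_cube: "singular_chain n (real_top (cube n)) (integral_cube_chain n)"
  unfolding integral_cube_chain_def
  by (intro singular_chain_sum singular_chain_cmul) (simp add: singular_chain_of singular_simplex_cube)

lemma simplical_face_sum:
  "(\<Sum>m\<le>p. simplical_face k x m) = (\<Sum>m<(if p < k then Suc p else p). x m :: real)"
  by (induction p) (auto simp: simplical_face_def less_Suc_eq)

text \<open>Closed form of a face: inserting a zero at position \<open>k\<close> only changes the
  lengths of the partial sums.\<close>

definition cube_simplex_face :: "nat \<Rightarrow> nat \<Rightarrow> (nat \<Rightarrow> nat) \<Rightarrow> (nat \<Rightarrow> real) \<Rightarrow> nat \<Rightarrow> real"
  where "cube_simplex_face n k \<pi> =
    restrict (\<lambda>x j. \<Sum>m<(if \<pi> j < k then Suc (\<pi> j) else \<pi> j). x m) (standard_simplex n)"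

lemma singular_face_cube_simplex:
  "singular_face (Suc n) k (cube_simplex \<pi>) = cube_simplex_face n k \<pi>"
  by (auto simp: singular_face_def cube_simplex_face_def cube_simplex_def simplical_face_sum fun_eq_iff)

lemma frag_eq_minus_self: "(c :: 'a \<Rightarrow>\<^sub>0 int) = - c \<Longrightarrow> c = 0"
proof -
  assume c: "c = - c"
  have "lookup c k = - lookup c k" for k using arg_cong[OF c, of "\<lambda>c. lookup c k"] by simp
  then show ?thesis by (intro poly_mapping_eqI) (metis add.inverse_neutral equal_neg_zero lookup_zero)
qed

text \<open>On face \<open>k\<close> the values \<open>k - 1\<close> and \<open>k\<close> of the
  permutation give partial sums of the same length \<open>k\<close>. Composing with their
  transposition thus keeps the face and reverses the sign, and an integral chain equal to its
  negative is zero.\<close>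

lemma cube_inner_faces_cancel:
  assumes "0 < k" "k \<le> n"
  shows "(\<Sum>\<pi> | \<pi> permutes {..<Suc n}. frag_cmul (a * sign \<pi>) (frag_of (cube_simplex_face n k \<pi>))) = 0"
    (is "sum ?f ?P = 0")
proof (rule frag_eq_minus_self)
  let ?\<tau> = "Transposition.transpose (k - 1) k"
  have \<tau>: "?\<tau> permutes {..<Suc n}" by (rule permutes_swap_id) (use assms in auto)
  have "sum ?f ?P = (\<Sum>\<pi>\<in>?P. ?f (?\<tau> \<circ> \<pi>))"
    by (rule setum_permutations_compose_left[OF \<tau>])
  also have "\<dots> = (\<Sum>\<pi>\<in>?P. - ?f \<pi>)"
  proof (rule sum.cong[OF refl])
    fix \<pi> assume "\<pi> \<in> ?P"
    then have "permutation \<pi>" using permutation_permutes by blast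
    then have "sign (?\<tau> \<circ> \<pi>) = - sign \<pi>"
      using assms sign_compose[OF permutation_swap_id, of \<pi> "k - 1" k] by (simp add: sign_swap_id)
    moreover have "(if ?\<tau> p < k then Suc (?\<tau> p) else ?\<tau> p) = (if p < k then Suc p else p)" for p
      using assms by (auto simp: Transposition.transpose_def)
    then have "cube_simplex_face n k (?\<tau> \<circ> \<pi>) = cube_simplex_face n k \<pi>"
      unfolding cube_simplex_face_def comp_apply by presburger
    ultimately show "?f (?\<tau> \<circ> \<pi>) = - ?f \<pi>" by simp
  qed
  also have "\<dots> = - sum ?f ?P" by (rule sum_negf)
  finally show "sum ?f ?P = - sum ?f ?P" .
qed

lemma singular_simplex_cube_face:
  assumes "\<pi> permutes {..<Suc n}" "k \<le> Suc n"
  shows "singular_simplex n (real_top (cube (Suc n))) (cube_simplex_face n k \<pi>)"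
  using singular_simplex_singular_face[OF singular_simplex_cube[OF assms(1)], of k] assms(2)
  by (simp add: singular_face_cube_simplex)

text \<open>On face 0 the coordinate with \<open>\<pi> j = 0\<close> is an empty sum. On the last
  face the coordinate with \<open>\<pi> j = n\<close> is the full sum 1, and \<open>j < n\<close>
  because \<open>\<pi>\<close> does not fix \<open>n\<close>.\<close>

lemma cube_simplex_face_horn:
  assumes \<pi>: "\<pi> permutes {..<Suc n}" and k: "k = 0 \<or> k = Suc n \<and> \<pi> n \<noteq> n"
  shows "singular_simplex n (real_top (cube_horn n)) (cube_simplex_face n k \<pi>)"
proof -
  have s: "singular_simplex n (real_top (cube (Suc n))) (cube_simplex_face n k \<pi>)"
    by (rule singular_simplex_cube_face[OF \<pi>]) (use k in auto)
  have "cube_simplex_face n k \<pi> x \<in> cube_horn n" if x: "x \<in> standard_simplex n" for x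
  proof -
    have "cube_simplex_face n k \<pi> x \<in> cube (Suc n)"
      using s x by (auto simp: singular_simplex_def continuous_map_real_top Pi_iff)
    moreover obtain j where j: "j < Suc n" "\<pi> j = (if k = 0 then 0 else n)"
    proof -
      have "(if k = 0 then 0 else n) \<in> \<pi> ` {..<Suc n}"
        using permutes_image[OF \<pi>] by simp
      then show thesis using that by (auto split: if_splits)
    qed
    have "cube_simplex_face n k \<pi> x n = 0 \<or> (\<exists>j<n. cube_simplex_face n k \<pi> x j = 0 \<or> cube_simplex_face n k \<pi> x j = 1)"
    proof (cases "k = 0")
      case True
      then have "cube_simplex_face n k \<pi> x j = 0" using j x by (simp add: cube_simplex_face_def)
      then show ?thesis using j(1) by (auto simp: less_Suc_eq)
    next
      case False
      then have "j < n" using k j by (auto simp: less_Suc_eq)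
      moreover have "(\<Sum>m<Suc n. x m) = 1" using x by (simp add: standard_simplex_def lessThan_Suc_atMost)
      then have "cube_simplex_face n k \<pi> x j = 1" using j x k False by (simp add: cube_simplex_face_def)
      ultimately show ?thesis by blast
    qed
    ultimately show ?thesis by (simp add: cube_horn_def)
  qed
  then have "singular_simplex n (subtopology (real_top (cube (Suc n))) (cube_horn n)) (cube_simplex_face n k \<pi>)"
    using s by (auto simp: singular_simplex_subtopology)
  moreover have "cube (Suc n) \<inter> cube_horn n = cube_horn n" by (auto simp: cube_horn_def)
  ultimately show ?thesis by (simp add: subtopology_subtopology)
qed

text \<open>The equality relies on the padding: coordinate \<open>n\<close> is the full sum, hence
  1, on both sides.\<close>

lemma cube_simplex_face_top:
  assumes \<pi>: "\<pi> permutes {..<n}"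
  shows "cube_simplex_face n (Suc n) \<pi> = restrict (cube_simplex \<pi>) (standard_simplex n)"
proof -
  have "(\<Sum>m<(if \<pi> j < Suc n then Suc (\<pi> j) else \<pi> j). x m) = (\<Sum>m\<le>\<pi> j. x m)"
    if "x \<in> standard_simplex n" for x j
  proof (cases "\<pi> j < Suc n")
    case False
    then have "x (\<pi> j) = 0" using that by (simp add: standard_simplex_def)
    then show ?thesis using False by (simp flip: lessThan_Suc_atMost)
  qed (simp add: lessThan_Suc_atMost)
  then show ?thesis by (auto simp: cube_simplex_face_def cube_simplex_def fun_eq_iff)
qed

lemma permutes_lessThan_Suc: "{\<pi>. \<pi> permutes {..<Suc n} \<and> \<pi> n = n} = {\<pi>. \<pi> permutes {..<n}}"
proof -
  have "\<pi> permutes {..<n}" if "\<pi> permutes {..<Suc n}" "\<pi> n = n" for \<pi>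
    using permutes_superset[OF that(1), of "{..<n}"] that(2) by (auto simp: less_Suc_eq)
  moreover have "\<pi> permutes {..<Suc n}" "\<pi> n = n" if "\<pi> permutes {..<n}" for \<pi>
    using permutes_subset[OF that] permutes_not_in[OF that] by auto
  ultimately show ?thesis by blast
qed

text \<open>Inner faces cancel in pairs. Of the last faces, those with \<open>\<pi> n = n\<close>
  triangulate the face \<open>cube n\<close>; all remaining faces lie in the horn.\<close>

lemma integral_cube_chain_boundary:
  "singular_chain n (real_top (cube_horn n))
    (chain_boundary (Suc n) (integral_cube_chain (Suc n)) - frag_cmul ((-1) ^ n) (integral_cube_chain n))"
proof -
  let ?P = "{\<pi>. \<pi> permutes {..<Suc n}}" and ?P' = "{\<pi>. \<pi> permutes {..<Suc n} \<and> \<pi> n \<noteq> n}"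
  define f where "f k \<pi> = frag_cmul ((-1) ^ k * (-1) ^ Suc n * sign \<pi>) (frag_of (cube_simplex_face n k \<pi>))" for k \<pi>
  have fin: "finite {\<pi>. \<pi> permutes {..<m}}" for m :: nat by (rule finite_permutations) simp
  have "chain_boundary (Suc n) (integral_cube_chain (Suc n)) = (\<Sum>\<pi>\<in>?P. \<Sum>k\<le>Suc n. f k \<pi>)"
    unfolding integral_cube_chain_def chain_boundary_sum o_def
    by (rule sum.cong[OF refl])
      (simp add: chain_boundary_cmul chain_boundary_of frag_cmul_sum f_def singular_face_cube_simplex mult_ac
        cong: sum.cong_simp del: sum.atMost_Suc)
  also have "\<dots> = (\<Sum>k\<le>Suc n. \<Sum>\<pi>\<in>?P. f k \<pi>)" by (rule sum.swap)
  also have "\<dots> = (\<Sum>k\<in>{0, Suc n}. \<Sum>\<pi>\<in>?P. f k \<pi>)"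
  proof (rule sum.mono_neutral_right)
    show "\<forall>k\<in>{..Suc n} - {0, Suc n}. (\<Sum>\<pi>\<in>?P. f k \<pi>) = 0"
    proof
      fix k assume "k \<in> {..Suc n} - {0, Suc n}"
      then have "0 < k" "k \<le> n" by auto
      then show "(\<Sum>\<pi>\<in>?P. f k \<pi>) = 0" unfolding f_def by (rule cube_inner_faces_cancel)
    qed
  qed auto
  also have "\<dots> = (\<Sum>\<pi>\<in>?P. f 0 \<pi>) + (\<Sum>\<pi>\<in>?P. f (Suc n) \<pi>)" by simp
  also have "(\<Sum>\<pi>\<in>?P. f (Suc n) \<pi>) = (\<Sum>\<pi>\<in>?P'. f (Suc n) \<pi>) + (\<Sum>\<pi> | \<pi> permutes {..<n}. f (Suc n) \<pi>)"
  proof -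
    have "?P = ?P' \<union> {\<pi>. \<pi> permutes {..<Suc n} \<and> \<pi> n = n}" by blast
    then have P: "?P = ?P' \<union> {\<pi>. \<pi> permutes {..<n}}" by (simp only: permutes_lessThan_Suc)
    have "?P' \<inter> {\<pi>. \<pi> permutes {..<n}} = {}" using permutes_lessThan_Suc[of n] by blast
    then show ?thesis
      by (subst P, intro sum.union_disjoint fin finite_subset[OF _ fin[of "Suc n"]]) auto
  qed
  also have "(\<Sum>\<pi> | \<pi> permutes {..<n}. f (Suc n) \<pi>) = frag_cmul ((-1) ^ n) (integral_cube_chain n)"
  proof -
    \<comment> \<open>The sign of the last face cancels the normalising sign of the larger cube.
      Writing 1 as the square of \<open>(-1) ^ n\<close> brings out the normalising sign of the
      smaller cube.\<close>
    have "(-1 :: int) ^ Suc n * (-1) ^ Suc n * a = (-1) ^ n * ((-1) ^ n * a)" for a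
      by (simp add: mult.assoc[symmetric] power_add[symmetric])
    then show ?thesis
      unfolding integral_cube_chain_def frag_cmul_sum f_def frag_cmul_cmul
      by (intro sum.cong[OF refl]) (simp add: cube_simplex_face_top del: power_Suc)
  qed
  finally have "chain_boundary (Suc n) (integral_cube_chain (Suc n)) - frag_cmul ((-1) ^ n) (integral_cube_chain n)
      = (\<Sum>\<pi>\<in>?P. f 0 \<pi>) + (\<Sum>\<pi>\<in>?P'. f (Suc n) \<pi>)" by simp
  moreover have "singular_chain n (real_top (cube_horn n)) \<dots>"
    unfolding f_def
    by (intro singular_chain_add singular_chain_sum singular_chain_cmul)
      (auto simp: singular_chain_of intro!: cube_simplex_face_horn)
  ultimately show ?thesis by metis
qed


section \<open>The fundamental class of the cube, by induction over the dimension\<close>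

lemma subtopology_real_top: "A \<subseteq> Z \<Longrightarrow> subtopology (real_top Z) A = real_top A"
  by (simp add: subtopology_subtopology Int_absorb1)

lemma twisted_chains_mono: "A \<subseteq> Z \<Longrightarrow> c \<in> twisted_chains n (real_top A) \<Longrightarrow> c \<in> twisted_chains n (real_top Z)"
  by (metis subtopology_real_top twisted_chains_subtopology)

lemma push_id:
  assumes "c \<in> twisted_chains n X" shows "push (\<lambda>_. 1) id z n c = c"
proof -
  have "push_simplex (\<lambda>_. 1) id z n \<tau> = single \<tau> 1" if "\<tau> \<in> keys c" for \<tau>
  proof -
    have "\<tau> \<in> extensional (standard_simplex n)" using assms that by (auto simp: twisted_chains_def singular_simplex_def)
    then show ?thesis by (simp add: push_simplex_def extensional_restrict)
  qed
  then show ?thesis unfolding push_def by (subst pm_extend_cong[where g = "\<lambda>\<tau>. single \<tau> 1"]) auto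
qed

abbreviation "standard_cube_chain n \<equiv> cube_chain n (\<lambda>t :: nat \<Rightarrow> real. t)"

lemma standard_cube_chain_boundary:
  "twisted_boundary (\<lambda>_. 1) (Suc n) (standard_cube_chain (Suc n)) - pm_scale ((-1) ^ n) (standard_cube_chain n)
    \<in> (twisted_chains n (real_top (cube_horn n)) :: (_, 'r::comm_ring_1) twisted_chain set)"
proof -
  have "pm_of_int (chain_boundary (Suc n) (integral_cube_chain (Suc n)) - frag_cmul ((-1) ^ n) (integral_cube_chain n))
      \<in> (twisted_chains n (real_top (cube_horn n)) :: (_, 'r) twisted_chain set)"
    by (rule twisted_chains_of_int[OF integral_cube_chain_boundary])
  then show ?thesis by (simp add: cube_chain_integral twisted_boundary_of_int)
qed

lemma standard_cube_chain: "standard_cube_chain n \<in> twisted_chains n (real_top (cube n))"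
  by (simp add: cube_chain_integral twisted_chains_of_int singular_chain_cube)

lemma continuous_map_prod_real_top:
  "continuous_map (prod_topology (top_of_set I) (real_top Z)) euclideanreal (\<lambda>p. snd p i)"
  "continuous_map (prod_topology (top_of_set I) (real_top Z)) euclideanreal (\<lambda>p. fst p)"
proof -
  show "continuous_map (prod_topology (top_of_set I) (real_top Z)) euclideanreal (\<lambda>p. snd p i)"
    using continuous_map_compose[OF continuous_map_snd continuous_map_real_top_coord] unfolding o_def .
  show "continuous_map (prod_topology (top_of_set I) (real_top Z)) euclideanreal (\<lambda>p. fst p)"
    using continuous_map_fst continuous_map_into_fulltopology by blast
qed

text \<open>Shrinking coordinate \<open>n\<close> to 0 preserves the horn and ends inside it. In the
  general scheme this is the case of one open set and of \<open>S\<close> as the only piece.\<close>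

lemma cube_horn_relcycle_bounds:
  assumes "c \<in> twisted_relcycles (\<lambda>_. 1 :: 'r::comm_ring_1) k (real_top (cube (Suc n))) (cube_horn n)"
  shows "\<exists>b\<in>twisted_chains (Suc k) (real_top (cube (Suc n))).
    c - twisted_boundary (\<lambda>_. 1) (Suc k) b \<in> twisted_chains k (real_top (cube_horn n))"
proof -
  let ?X = "real_top (cube (Suc n))"
  define K where "K s t = (\<lambda>j. if j = n then (1 - s) * t j else t j)" for s :: real and t :: "nat \<Rightarrow> real"
  have K_cube: "K s t \<in> cube (Suc n)" if "s \<in> {0..1}" "t \<in> cube (Suc n)" for s t
    using that by (auto simp: K_def cube_def mult_le_one)
  have K_horn: "K s t \<in> cube_horn n" if "s \<in> {0..1}" "t \<in> cube_horn n" for s t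
    using that K_cube[of s t] by (auto simp: cube_horn_def) (auto simp: K_def)
  interpret retraction_to_pieces ?X "\<lambda>_. 1 :: 'r" K "cube_horn n" "{topspace ?X}" "{cube_horn n}"
  proof unfold_locales
    have "continuous_map (prod_topology (top_of_set {0..1}) ?X) euclideanreal (\<lambda>p. K (fst p) (snd p) i)" for i
      unfolding K_def by (cases "i = n") (auto intro!: continuous_intros continuous_map_prod_real_top)
    then show "continuous_map (prod_topology (top_of_set {0..1}) ?X) ?X (\<lambda>(s, x). K s x)"
      using K_cube by (auto simp: continuous_map_real_top case_prod_unfold)
    show "K 0 x = x" for x by (auto simp: K_def)
    have "K 1 ` (topspace ?X \<inter> topspace ?X) \<subseteq> cube_horn n"
      using K_cube[of 1] by (auto simp: cube_horn_def) (simp add: K_def)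
    show "openin ?X V" if "V \<in> {topspace ?X}" for V using that by (metis openin_topspace singletonD)
    from \<open>K 1 ` (topspace ?X \<inter> topspace ?X) \<subseteq> cube_horn n\<close> show "\<exists>D\<in>{cube_horn n}. K 1 ` (V \<inter> topspace ?X) \<subseteq> D" if "V \<in> {topspace ?X}" for V using that by simp
  qed (use K_horn in \<open>auto simp: rank_one_trivial\<close>)
  obtain c' b where c': "c' \<in> twisted_chains k (subtopology ?X (cube_horn n))" and b: "b \<in> twisted_chains (Suc k) ?X"
    and *: "c - c' - twisted_boundary (\<lambda>_. 1) (Suc k) b \<in> twisted_chains k (subtopology ?X (cube_horn n))"
    using relcycle_piecewise[OF assms] unfolding piecewise_S by blast
  have "cube_horn n \<subseteq> cube (Suc n)" by (auto simp: cube_horn_def)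
  from subtopology_real_top[OF this] twisted_chains_add[OF * c'] b show ?thesis
    by (auto intro!: bexI[of _ b] simp: algebra_simps)
qed

text \<open>This replaces excision: stretching the first \<open>n\<close> coordinates away from the
  centre preserves the horn and pushes a neighbourhood of it into it, leaving only the face
  \<open>cube n\<close>.\<close>

lemma retraction_to_cube_face:
  assumes \<kappa>: "fundamental_chain n (cube n) (cube_frontier n) (\<kappa> :: (_, 'r::comm_ring_1) twisted_chain)"
  obtains H \<C> where "retraction_to_cells (real_top (cube_frontier (Suc n))) (\<lambda>_. 1 :: 'r) H (cube_horn n) \<C>
    (\<lambda>_ :: unit. id) (cube n) {()} (cube_frontier n) (\<lambda>_. 1) n \<kappa> (\<lambda>_. id)"
proof -
  let ?X = "real_top (cube_frontier (Suc n))"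
  \<comment> \<open>At time 1 the stretching factor is 2, so a coordinate below 1/4 or above 3/4 is
    clamped to 0 or 1. Coordinate \<open>n\<close> is kept, hence so is each of the two faces that
    it defines.\<close>
  define H where "H s t = (\<lambda>j. if j < n then max 0 (min 1 (1/2 + (1 + s) * (t j - 1/2))) else t j)"
    for s :: real and t :: "nat \<Rightarrow> real"
  define V1 where "V1 = {t \<in> cube_frontier (Suc n). t n < 1 \<or> (\<exists>j<n. t j < 1/4 \<or> t j > 3/4)}"
  \<comment> \<open>Inside the frontier these conditions force \<open>t n = 1\<close>: the set is
    the interior of the face \<open>cube n\<close>, described by strict inequalities to show that it
    is open.\<close>
  define V2 where "V2 = {t \<in> cube_frontier (Suc n). t n > 0 \<and> (\<forall>j<n. 0 < t j \<and> t j < 1)}"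
  have H_cube: "H s t \<in> cube m" if "t \<in> cube m" "n \<le> m" for s t m
    using that by (auto simp: H_def cube_def)
  have H_horn: "H s t \<in> cube_horn n" if s: "s \<in> {0..1}" and t: "t \<in> cube_horn n" for s t
  proof -
    have "H s t j = t j" if "j < n" "t j = 0 \<or> t j = 1" for j
      using that s by (auto simp: H_def field_simps)
    moreover have "H s t n = t n" by (simp add: H_def)
    ultimately show ?thesis using t H_cube[of t "Suc n" s] by (auto simp: cube_horn_def)
  qed
  have H_frontier: "H s t \<in> cube_frontier (Suc n)" if "s \<in> {0..1}" "t \<in> cube_frontier (Suc n)" for s t
    using that H_horn[of s t] H_cube[of t n s] by (auto simp: cube_frontier_Suc)
  have "retraction_to_cells ?X (\<lambda>_. 1 :: 'r) H (cube_horn n) {V1, V2}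
    (\<lambda>_ :: unit. id) (cube n) {()} (cube_frontier n) (\<lambda>_. 1) n \<kappa> (\<lambda>_. id)"
  proof (intro retraction_to_cells.intro retraction_to_pieces.intro homotopy_from_identity.intro
      retraction_to_pieces_axioms.intro retraction_to_cells_axioms.intro)
    show "rank_one_local_system ?X (\<lambda>_. 1 :: 'r)" by (rule rank_one_trivial)
    have "continuous_map (prod_topology (top_of_set {0..1}) ?X) euclideanreal (\<lambda>p. H (fst p) (snd p) i)" for i
      unfolding H_def
      by (cases "i < n") (auto intro!: continuous_intros continuous_map_real_max continuous_map_real_min continuous_map_prod_real_top)
    then show "continuous_map (prod_topology (top_of_set {0..1}) ?X) ?X (\<lambda>(s, x). H s x)"
      using H_frontier by (auto simp: continuous_map_real_top case_prod_unfold)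
    show "H 0 x = x" if "x \<in> topspace ?X" for x
      using that by (auto simp: H_def cube_frontier_def cube_def)
    have lt: "openin ?X {t \<in> cube_frontier (Suc n). t j < a}" "openin ?X {t \<in> cube_frontier (Suc n). a < t j}" for j a
    proof -
      have "openin ?X {t \<in> topspace ?X. t j \<in> {..<a}}" "openin ?X {t \<in> topspace ?X. t j \<in> {a<..}}"
        by (rule openin_continuous_map_preimage[OF continuous_map_real_top_coord]; simp)+
      then show "openin ?X {t \<in> cube_frontier (Suc n). t j < a}" "openin ?X {t \<in> cube_frontier (Suc n). a < t j}" by simp_all
    qed
    have "openin ?X V1"
    proof -
      have "V1 = {t \<in> cube_frontier (Suc n). t n < 1} \<union>
          (\<Union>j\<in>{..<n}. {t \<in> cube_frontier (Suc n). t j < 1/4} \<union> {t \<in> cube_frontier (Suc n). 3/4 < t j})"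
        by (auto simp: V1_def)
      then show ?thesis
        by (simp only:) (intro openin_Un lt openin_Union, elim imageE, simp only:, intro openin_Un lt)
    qed
    moreover have "openin ?X V2"
    proof -
      have "V2 = {t \<in> cube_frontier (Suc n). 0 < t n} \<inter>
          \<Inter> (insert (topspace ?X) ((\<lambda>j. {t \<in> cube_frontier (Suc n). 0 < t j} \<inter> {t \<in> cube_frontier (Suc n). t j < 1}) ` {..<n}))"
        by (auto simp: V2_def)
      moreover have "openin ?X \<dots>"
      proof (intro openin_Int openin_Inter lt)
        fix T assume "T \<in> insert (topspace ?X) ((\<lambda>j. {t \<in> cube_frontier (Suc n). 0 < t j} \<inter> {t \<in> cube_frontier (Suc n). t j < 1}) ` {..<n})"
        then show "openin ?X T" using openin_topspace[of ?X] lt by (auto simp del: topspace_subtopology topspace_product_topology)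
      qed auto
      ultimately show ?thesis by metis
    qed
    ultimately show "openin ?X V" if "V \<in> {V1, V2}" for V using that by auto
    have "t \<in> V1 \<union> V2" if "t \<in> cube_frontier (Suc n)" for t
    proof (cases "t \<in> V1")
      case False
      then have "\<not> t n < 1" "\<And>j. j < n \<Longrightarrow> \<not> t j < 1/4 \<and> \<not> t j > 3/4"
        using that unfolding V1_def by blast+
      then have "t n > 0" "\<And>j. j < n \<Longrightarrow> 0 < t j \<and> t j < 1" by fastforce+
      then show ?thesis using that unfolding V2_def by blast
    qed simp
    then show "topspace ?X \<subseteq> \<Union>{V1, V2}" by auto
    have "H 1 t \<in> cube_horn n" if "t \<in> V1" for t
    proof (cases "t \<in> cube_horn n")
      case True
      then show ?thesis by (intro H_horn) auto
    next
      case False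
      then have t: "t \<in> cube n" using that by (auto simp: V1_def cube_frontier_Suc)
      then obtain j where j: "j < n" "t j < 1/4 \<or> t j > 3/4"
        using \<open>t \<in> V1\<close> cube_mem(2)[OF t, of n] unfolding V1_def by fastforce
      then have "H 1 t j = 0 \<or> H 1 t j = 1" by (auto simp: H_def)
      moreover have "H 1 t \<in> cube (Suc n)" using t by (intro H_cube) (auto simp: cube_def)
      ultimately show ?thesis using j(1) by (auto simp: cube_horn_def)
    qed
    moreover have "H 1 t \<in> cube n" if "t \<in> V2" for t
    proof -
      have "t \<notin> cube_horn n" using that by (auto simp: V2_def cube_horn_def)
      then show ?thesis using that by (intro H_cube) (auto simp: V2_def cube_frontier_Suc)
    qed
    ultimately show "\<exists>D\<in>insert (cube_horn n) ((\<lambda>r. id ` cube n) ` {()}). H 1 ` (V \<inter> topspace ?X) \<subseteq> D"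
      if "V \<in> {V1, V2}" for V using that by auto
    show "H s x \<in> D" if "D \<in> insert (cube_horn n) ((\<lambda>r. id ` cube n) ` {()})" "s \<in> {0..1}" "x \<in> D" for D s x
      using that H_horn H_cube[of x n s] by auto
    show "embedded_cell ?X (\<lambda>_. 1 :: 'r) (cube_horn n) (cube n) (cube_frontier n) (\<lambda>_. 1) id id"
    proof unfold_locales
      show "continuous_map (real_top (cube n)) ?X id"
        by (auto simp: continuous_map_real_top continuous_map_real_top_coord cube_frontier_Suc)
      show "continuous_map (subtopology ?X (id ` cube n)) (real_top (cube n)) id"
        by (auto simp: continuous_map_real_top continuous_map_real_top_coord subtopology_subtopology)
      show "id t \<in> cube_horn n \<longleftrightarrow> t \<in> cube_frontier n" if "t \<in> cube n" for t
        using that cube_Int_horn[of n] by auto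
    qed (auto simp: rank_one_trivial seg_convex_cube)
    show "fundamental_chain n (cube n) (cube_frontier n) \<kappa>" by (rule \<kappa>)
  qed auto
  then show ?thesis by (rule that)
qed

text \<open>The cube is a point with empty frontier. A 1-simplex has two equal faces with opposite
  signs, so no nonzero multiple of the point bounds.\<close>

lemma fundamental_cube_0:
  "fundamental_chain 0 (cube 0) (cube_frontier 0) (standard_cube_chain 0 :: (_, 'r::comm_ring_1) twisted_chain)"
proof -
  let ?X = "real_top (cube 0)" and ?p = "\<lambda>n. restrict (\<lambda>x :: nat \<Rightarrow> real. \<lambda>_ :: nat. 1 :: real) (standard_simplex n)"
  have X: "topspace ?X = {\<lambda>_. 1}" by (auto simp: cube_def)
  have eq: "\<sigma> = ?p n" if "singular_simplex n ?X \<sigma>" for n \<sigma>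
    using that singular_simplex_singleton[OF X] by simp
  have "standard_cube_chain 0 = (single (restrict (cube_simplex id) (standard_simplex 0)) 1 :: (_, 'r) twisted_chain)"
    by (simp add: cube_chain_def restrict_def)
  also have "restrict (cube_simplex id) (standard_simplex 0) = ?p 0"
    using singular_simplex_cube[of id 0] by (intro eq) (simp add: permutes_id)
  finally have \<kappa>: "standard_cube_chain 0 = (single (?p 0) 1 :: (_, 'r) twisted_chain)" .
  have chain: "d = pm_scale (lookup d (?p 0)) (standard_cube_chain 0)"
    if "d \<in> twisted_chains 0 ?X" for d :: "(_, 'r) twisted_chain"
  proof -
    have "keys d \<subseteq> {?p 0}" using that eq by (auto simp: twisted_chains_def)
    then show ?thesis
      by (intro poly_mapping_eqI) (auto simp: \<kappa> lookup_single when_def in_keys_iff subset_iff)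
  qed
  have bd: "twisted_boundary (\<lambda>_. 1 :: 'r) 1 b = 0" if "b \<in> twisted_chains 1 ?X" for b
  proof -
    have "simplex_boundary (\<lambda>_. 1 :: 'r) 1 \<sigma> = 0" if \<sigma>: "singular_simplex 1 ?X \<sigma>" for \<sigma>
    proof -
      have "singular_face 1 k \<sigma> = ?p 0" if "k \<le> 1" for k
        using singular_simplex_singular_face[OF \<sigma> _ that] by (intro eq) simp
      then show ?thesis by (simp add: simplex_boundary_def flip: single_add)
    qed
    then have "pm_extend (simplex_boundary (\<lambda>_. 1 :: 'r) 1) b = pm_extend (\<lambda>_. 0) b"
      using that by (intro pm_extend_cong) (auto simp: twisted_chains_def)
    then show ?thesis by (simp add: twisted_boundary_extend) (simp add: pm_extend_def)
  qed
  have "a = 0" if "b \<in> twisted_chains (Suc 0) ?X"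
      "pm_scale a (standard_cube_chain 0) - twisted_boundary (\<lambda>_. 1) (Suc 0) b \<in> twisted_chains 0 (subtopology ?X (cube_frontier 0))"
    for a :: 'r and b
  proof (rule ccontr)
    assume "a \<noteq> 0"
    then have "singular_simplex 0 (subtopology ?X (cube_frontier 0)) (?p 0)"
      using that bd[of b] by (simp add: \<kappa> twisted_chains_def)
    moreover have "topspace (subtopology ?X (cube_frontier 0)) = {}" by (auto simp: cube_frontier_def)
    ultimately show False by (simp add: singular_simplex_empty)
  qed
  moreover have "\<exists>a. \<exists>b\<in>twisted_chains (Suc 0) ?X.
      d - pm_scale a (standard_cube_chain 0) - twisted_boundary (\<lambda>_. 1) (Suc 0) b \<in> twisted_chains 0 (subtopology ?X (cube_frontier 0))"
    if "d \<in> twisted_chains 0 ?X" for d :: "(_, 'r) twisted_chain"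
    using chain[OF that] by (intro exI[of _ "lookup d (?p 0)"] bexI[of _ 0]) (simp_all add: twisted_boundary_linear)
  ultimately show ?thesis
    using standard_cube_chain[of 0]
    by (auto simp: fundamental_chain_def twisted_relcycles_def twisted_boundary_def[of _ 0])
qed

text \<open>On chains this is the connecting map from (cube, frontier) to (frontier, horn),
  bijective because the cube retracts onto the horn, followed by the passage from (frontier, horn)
  to the cube of dimension \<open>n\<close> modulo its frontier.\<close>

theorem fundamental_cube:
  "fundamental_chain n (cube n) (cube_frontier n) (standard_cube_chain n :: (_, 'r::comm_ring_1) twisted_chain)"
proof (induction n)
  case 0
  show ?case by (rule fundamental_cube_0)
next
  case (Suc n)
  let ?N = "Suc n" and ?L = "\<lambda>_. 1 :: 'r"
  let ?X = "real_top (cube ?N)" and ?Y = "real_top (cube_frontier ?N)" and ?J = "real_top (cube_horn n)"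
  let ?\<kappa> = "standard_cube_chain ?N :: (_, 'r) twisted_chain" and ?\<kappa>' = "standard_cube_chain n :: (_, 'r) twisted_chain"
  let ?d = "twisted_boundary ?L"
  obtain H \<C> where "retraction_to_cells ?Y ?L H (cube_horn n) \<C>
    (\<lambda>_ :: unit. id) (cube n) {()} (cube_frontier n) (\<lambda>_. 1) n ?\<kappa>' (\<lambda>_. id)"
    by (rule retraction_to_cube_face[OF Suc.IH])
  then interpret cells: retraction_to_cells ?Y ?L H "cube_horn n" \<C>
    "\<lambda>_ :: unit. id" "cube n" "{()}" "cube_frontier n" "\<lambda>_. 1" n ?\<kappa>' "\<lambda>_. id" .
  have sub: "cube_horn n \<subseteq> cube_frontier ?N" "cube n \<subseteq> cube_frontier ?N" "cube_frontier ?N \<subseteq> cube ?N" "cube_horn n \<subseteq> cube ?N"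
    by (auto simp: cube_frontier_Suc) (auto simp: cube_horn_def cube_def)
  note top = subtopology_real_top[OF sub(3)] subtopology_real_top[OF sub(1)] subtopology_real_top[OF sub(4)]
  have push: "push ?L id (\<lambda>_. 1) n ?\<kappa>' = ?\<kappa>'" by (rule push_id[OF standard_cube_chain])
  have LX: "rank_one_local_system ?X ?L" by (rule rank_one_trivial)
  \<comment> \<open>The contribution of all other faces of the cube; it vanishes modulo the
    horn.\<close>
  define e where "e = ?d ?N ?\<kappa> - pm_scale ((-1) ^ n) ?\<kappa>'"
  have e: "e \<in> twisted_chains n ?J" unfolding e_def by (rule standard_cube_chain_boundary)
  have sgn: "(-1) ^ n * ((-1) ^ n * a) = a" for a :: 'r
    by (simp flip: mult.assoc power_add)
  have \<kappa>': "?\<kappa>' = pm_scale ((-1) ^ n) (?d ?N ?\<kappa> - e)"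
    using sgn[of 1] by (simp add: e_def)
  have \<kappa>X: "?\<kappa> \<in> twisted_chains ?N ?X" by (rule standard_cube_chain)
  have "?d ?N ?\<kappa> = e + pm_scale ((-1) ^ n) ?\<kappa>'" by (simp add: e_def)
  also have "\<dots> \<in> twisted_chains n ?Y"
    by (intro twisted_chains_add twisted_chains_scale twisted_chains_mono[OF sub(1) e] twisted_chains_mono[OF sub(2) standard_cube_chain])
  finally have "?\<kappa> \<in> twisted_relcycles ?L ?N ?X (cube_frontier ?N)"
    using \<kappa>X by (simp add: twisted_relcycles_def top)
  moreover have "\<exists>a. \<exists>b\<in>twisted_chains (Suc ?N) ?X. d - pm_scale a ?\<kappa> - ?d (Suc ?N) b \<in> twisted_chains ?N ?Y"
    if d: "d \<in> twisted_relcycles ?L ?N ?X (cube_frontier ?N)" for d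
  proof -
    have dX: "d \<in> twisted_chains ?N ?X" and dY: "?d ?N d \<in> twisted_chains n ?Y"
      using d by (simp_all add: twisted_relcycles_def top)
    have "?d n (?d ?N d) = 0" using twisted_boundary_boundary[OF LX dX] by simp
    with dY have "?d ?N d \<in> twisted_relcycles ?L n ?Y (cube_horn n)" by (simp add: twisted_relcycles_def)
    from cells.cells_span[OF this] obtain a b where b: "b \<in> twisted_chains ?N ?Y"
      and ab: "?d ?N d - pm_scale (a ()) ?\<kappa>' - ?d ?N b \<in> twisted_chains n ?J"
      by (auto simp: push top)
    define u where "u = (-1) ^ n * a ()"
    \<comment> \<open>The correction moves the boundary into the horn, and modulo the horn every
      relative cycle of the cube bounds.\<close>
    define d' where "d' = d - pm_scale u ?\<kappa> - b"
    have bX: "b \<in> twisted_chains ?N ?X" by (rule twisted_chains_mono[OF sub(3) b])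
    have "d' \<in> twisted_chains ?N ?X"
      unfolding d'_def by (intro twisted_chains_diff twisted_chains_scale dX \<kappa>X bX)
    moreover have "?d ?N d' = (?d ?N d - pm_scale (a ()) ?\<kappa>' - ?d ?N b) - pm_scale u e"
      by (simp add: d'_def twisted_boundary_linear u_def) (subst \<kappa>', simp add: pm_scale_distrib mult.commute)
    then have "?d ?N d' \<in> twisted_chains n ?J"
      using ab twisted_chains_scale[OF e, of u] by auto
    ultimately have "d' \<in> twisted_relcycles ?L ?N ?X (cube_horn n)" by (simp add: twisted_relcycles_def top)
    from cube_horn_relcycle_bounds[OF this] obtain b' where b': "b' \<in> twisted_chains (Suc ?N) ?X"
      and "d' - ?d (Suc ?N) b' \<in> twisted_chains ?N ?J" by blast
    then have "d' - ?d (Suc ?N) b' + b \<in> twisted_chains ?N ?Y"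
      by (intro twisted_chains_add twisted_chains_mono[OF sub(1)] b)
    then have "d - pm_scale u ?\<kappa> - ?d (Suc ?N) b' \<in> twisted_chains ?N ?Y" by (simp add: d'_def algebra_simps)
    with b' show ?thesis by blast
  qed
  moreover have "a = 0" if b: "b \<in> twisted_chains (Suc ?N) ?X"
      and ab: "pm_scale a ?\<kappa> - ?d (Suc ?N) b \<in> twisted_chains ?N ?Y" for a b
  proof -
    let ?f = "pm_scale a ?\<kappa> - ?d (Suc ?N) b"
    have "?d ?N (?d (Suc ?N) b) = 0" using twisted_boundary_boundary[OF LX b] by simp
    then have "pm_scale ((-1) ^ n * a) ?\<kappa>' - ?d ?N ?f = - pm_scale a e"
      by (simp add: twisted_boundary_linear e_def pm_scale_distrib mult.commute)
    \<comment> \<open>\<open>?f\<close> lies in the frontier, and its boundary shows that a multiple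
      of \<open>?\<kappa>'\<close> is zero modulo the horn. Independence for the single cell then
      kills the coefficient.\<close>
    then have "(\<Sum>r\<in>{()}. pm_scale ((\<lambda>_. (-1) ^ n * a) r) (push ?L id (\<lambda>_. 1) n ?\<kappa>')) - ?d (Suc n) ?f
        \<in> twisted_chains n (subtopology ?Y (cube_horn n))"
      using twisted_chains_scale[OF e, of a] by (simp add: push top)
    from cells.cells_independent[OF ab this] have "(-1) ^ n * a = 0" by simp
    then show ?thesis using sgn[of a] by simp
  qed
  ultimately show ?case by (simp add: fundamental_chain_def top)
qed

section \<open>Straightening finite sets of points\<close>

definition width :: "complex set \<Rightarrow> real"
  where "width Z = Max (insert 0 ((\<lambda>w. \<bar>Re w\<bar>) ` Z))"

text \<open>The inserted 1 is the value for at most one point. It also keeps the gap at most 1, the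
  width of a configuration touching a side; such configurations are therefore not moved at
  all.\<close>

definition gap :: "complex set \<Rightarrow> real"
  where "gap Z = Min (insert 1 ((\<lambda>(w, w'). \<bar>Im w - Im w'\<bar>) ` {(w, w'). w \<in> Z \<and> w' \<in> Z \<and> w \<noteq> w'}))"

text \<open>Counted from the top, in agreement with the arcs, whose heights decrease with their
  number.\<close>

definition height_rank :: "complex set \<Rightarrow> complex \<Rightarrow> nat"
  where "height_rank Z w = card {w' \<in> Z. Im w < Im w'}"

text \<open>Points which are narrow compared to their vertical gaps are moved to the prescribed heights, and
  the others are left at their heights; then all points are spread horizontally, until either one of
  them hits a vertical side or the factor \<open>3 / gap Z\<close> is reached.\<close>

definition straightening :: "complex set \<Rightarrow> real"
  where "straightening Z = min 1 (max 0 (2 * (gap Z - width Z) / max (gap Z) (width Z)))"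

definition spread :: "real \<Rightarrow> complex set \<Rightarrow> real"
  where "spread s Z = (1 - s) + s / max (width Z) (gap Z / 3)"

definition move :: "(nat \<Rightarrow> real) \<Rightarrow> real \<Rightarrow> complex set \<Rightarrow> complex \<Rightarrow> complex"
  where "move h s Z w = Complex (spread s Z * Re w)
    ((1 - s * straightening Z) * Im w + s * (straightening Z * h (height_rank Z w)))"

lemma finite_pairs: "finite Z \<Longrightarrow> finite {(w, w'). w \<in> Z \<and> w' \<in> Z \<and> w \<noteq> w'}"
  by (rule finite_subset[of _ "Z \<times> Z"]) auto

lemma width_ge: "finite Z \<Longrightarrow> w \<in> Z \<Longrightarrow> \<bar>Re w\<bar> \<le> width Z"
  unfolding width_def by (intro Max_ge) auto

lemma width_nonneg: "finite Z \<Longrightarrow> 0 \<le> width Z"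
  unfolding width_def by (intro Max_ge) auto

lemma width_attained:
  assumes "finite Z" "0 < width Z" obtains w where "w \<in> Z" "\<bar>Re w\<bar> = width Z"
proof -
  have "width Z \<in> insert 0 ((\<lambda>w. \<bar>Re w\<bar>) ` Z)"
    unfolding width_def by (rule Max_in) (use assms in auto)
  then show thesis using assms that by auto
qed

lemma width_le: "finite Z \<Longrightarrow> (\<And>w. w \<in> Z \<Longrightarrow> \<bar>Re w\<bar> \<le> a) \<Longrightarrow> 0 \<le> a \<Longrightarrow> width Z \<le> a"
  unfolding width_def by (subst Max_le_iff) auto

lemma gap_le: "finite Z \<Longrightarrow> w \<in> Z \<Longrightarrow> w' \<in> Z \<Longrightarrow> w \<noteq> w' \<Longrightarrow> gap Z \<le> \<bar>Im w - Im w'\<bar>"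
  unfolding gap_def by (intro Min_le) (auto simp: finite_pairs)

lemma gap_le_1: "finite Z \<Longrightarrow> gap Z \<le> 1"
  unfolding gap_def by (intro Min_le) (auto simp: finite_pairs)

lemma gap_cases:
  assumes "finite Z"
  shows "0 < gap Z \<or> gap Z = 0 \<and> (\<exists>w\<in>Z. \<exists>w'\<in>Z. w \<noteq> w' \<and> Im w = Im w')"
proof -
  have "gap Z \<in> insert 1 ((\<lambda>(w, w'). \<bar>Im w - Im w'\<bar>) ` {(w, w'). w \<in> Z \<and> w' \<in> Z \<and> w \<noteq> w'})"
    unfolding gap_def by (rule Min_in) (use finite_pairs[OF assms] in auto)
  then consider "gap Z = 1" | w w' where "w \<in> Z" "w' \<in> Z" "w \<noteq> w'" "gap Z = \<bar>Im w - Im w'\<bar>" by auto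
  then show ?thesis
  proof cases
    case 2
    then show ?thesis by (cases "Im w = Im w'") auto
  qed simp
qed

text \<open>If the gap vanishes, two distinct points have the same height, hence different real
  parts, and the width is positive. So the denominators in \<open>straightening\<close> and
  \<open>spread\<close> are positive.\<close>

lemma gap_or_width_pos:
  assumes "finite Z" shows "0 < max (gap Z) (width Z)" "0 < max (width Z) (gap Z / 3)"
proof -
  have "0 < gap Z \<or> 0 < width Z"
  proof (rule ccontr)
    assume *: "\<not> (0 < gap Z \<or> 0 < width Z)"
    then obtain w w' where "w \<in> Z" "w' \<in> Z" "w \<noteq> w'" "Im w = Im w'"
      using gap_cases[OF assms] by blast
    moreover from this(1,2) have "Re w = 0" "Re w' = 0" using width_ge[OF assms] * by fastforce+
    ultimately show False by (simp add: complex_eq_iff)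
  qed
  then show "0 < max (gap Z) (width Z)" "0 < max (width Z) (gap Z / 3)" by auto
qed

lemma straightening_bounds: "0 \<le> straightening Z" "straightening Z \<le> 1"
  by (auto simp: straightening_def)

text \<open>The condition holds throughout a neighbourhood of each configuration with coinciding
  heights, where ranks jump.\<close>

lemma straightening_0: "finite Z \<Longrightarrow> gap Z \<le> width Z \<Longrightarrow> straightening Z = 0"
proof -
  assume Z: "finite Z" "gap Z \<le> width Z"
  have "2 * (gap Z - width Z) / max (gap Z) (width Z) \<le> 0"
    using gap_or_width_pos(1)[OF Z(1)] Z(2) by (intro divide_nonpos_pos) auto
  then show ?thesis by (simp add: straightening_def)
qed

text \<open>The bound 1/2 exceeds the 1/3 in \<open>spread\<close>, so every configuration that
  spreading does not push into \<open>S\<close> is fully straightened.\<close>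

lemma straightening_1: "finite Z \<Longrightarrow> width Z \<le> gap Z / 2 \<Longrightarrow> straightening Z = 1"
proof -
  assume Z: "finite Z" "width Z \<le> gap Z / 2"
  have gap: "0 < gap Z" using gap_or_width_pos(1)[OF Z(1)] width_nonneg[OF Z(1)] Z(2) by linarith
  then have "max (gap Z) (width Z) = gap Z" using Z(2) by linarith
  moreover have "1 \<le> 2 * (gap Z - width Z) / gap Z"
    unfolding le_divide_eq_1_pos[OF gap] using Z(2) by simp
  ultimately have "1 \<le> 2 * (gap Z - width Z) / max (gap Z) (width Z)" by simp
  then show ?thesis unfolding straightening_def by linarith
qed

lemma spread_pos:
  assumes "finite Z" "s \<in> {0..1}" shows "0 < spread s Z"
proof (cases "s = 1")
  case True
  then show ?thesis using gap_or_width_pos(2)[OF assms(1)] by (simp add: spread_def)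
next
  case False
  then have "0 < 1 - s" "0 \<le> s / max (width Z) (gap Z / 3)"
    using assms gap_or_width_pos(2)[OF assms(1)] by (auto intro: divide_nonneg_nonneg)
  then show ?thesis by (simp add: spread_def)
qed

text \<open>The left side is a convex combination of \<open>width Z\<close> and of its quotient by
  the maximum in \<open>spread\<close>, both at most 1.\<close>

lemma spread_width_le:
  assumes "finite Z" "width Z \<le> 1" "s \<in> {0..1}" shows "spread s Z * width Z \<le> 1"
proof -
  let ?m = "max (width Z) (gap Z / 3)"
  have "width Z / ?m \<le> 1" using gap_or_width_pos(2)[OF assms(1)] by (simp add: divide_le_eq_1)
  then have "s * (width Z / ?m) \<le> s * 1" using assms(3) by (intro mult_left_mono) auto
  moreover have "(1 - s) * width Z \<le> (1 - s) * 1" using assms by (intro mult_left_mono) auto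
  ultimately show ?thesis by (simp add: spread_def algebra_simps)
qed

lemma rank_less: "finite Z \<Longrightarrow> w \<in> Z \<Longrightarrow> height_rank Z w < card Z"
  unfolding height_rank_def by (intro psubset_card_mono) auto

lemma rank_strict: "finite Z \<Longrightarrow> w' \<in> Z \<Longrightarrow> Im w < Im w' \<Longrightarrow> height_rank Z w' < height_rank Z w"
  unfolding height_rank_def by (intro psubset_card_mono) auto

lemma move_0 [simp]: "move h 0 Z w = w"
  by (simp add: move_def spread_def)

lemma move_wide:
  assumes "finite Z" "width Z = 1" shows "move h s Z w = w"
proof -
  have "max (width Z) (gap Z / 3) = 1" "straightening Z = 0"
    using gap_le_1[OF assms(1)] assms straightening_0[OF assms(1)] by auto
  then show ?thesis by (simp add: move_def spread_def complex_eq_iff)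
qed

text \<open>The new height is a convex combination of the old height and of \<open>h\<close> at the
  rank, both increasing with the old height. Points of equal height are told apart by their real
  parts, which are scaled by a positive factor.\<close>

lemma move_inj:
  assumes Z: "finite Z" and h: "\<And>i j. i < j \<Longrightarrow> j < card Z \<Longrightarrow> h j < h i" and s: "s \<in> {0..1}"
  shows "inj_on (move h s Z) Z"
proof (rule inj_onI)
  fix w w' assume w: "w \<in> Z" "w' \<in> Z" and eq: "move h s Z w = move h s Z w'"
  let ?\<mu> = "s * straightening Z"
  have \<mu>: "0 \<le> ?\<mu>" "?\<mu> \<le> 1" using s straightening_bounds[of Z] by (auto intro: mult_le_one)
  have less: "(1 - ?\<mu>) * Im u + ?\<mu> * h (height_rank Z u) < (1 - ?\<mu>) * Im v + ?\<mu> * h (height_rank Z v)"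
    if "u \<in> Z" "v \<in> Z" "Im u < Im v" for u v
  \<comment> \<open>With weight 1 strictness comes from \<open>h\<close>, otherwise from the old
    heights.\<close>
  proof (cases "?\<mu> = 1")
    case True
    show ?thesis using h[OF rank_strict[OF Z that(2,3)] rank_less[OF Z that(1)]] by (simp add: True)
  next
    case False
    have "(1 - ?\<mu>) * Im u < (1 - ?\<mu>) * Im v" using False \<mu> that(3) by (intro mult_strict_left_mono) auto
    moreover have "?\<mu> * h (height_rank Z u) \<le> ?\<mu> * h (height_rank Z v)"
      using h[OF rank_strict[OF Z that(2,3)] rank_less[OF Z that(1)]] \<mu> by (intro mult_left_mono) auto
    ultimately show ?thesis by linarith
  qed
  have "Im w = Im w'"
    using less[OF w] less[OF w(2,1)] arg_cong[OF eq, of Im] by (cases "Im w" "Im w'" rule: linorder_cases) (simp_all add: move_def mult.assoc)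
  moreover have "Re w = Re w'" using eq spread_pos[OF Z s] by (simp add: move_def)
  ultimately show "w = w'" by (simp add: complex_eq_iff)
qed

lemma move_disk:
  assumes Z: "finite Z" "Z \<subseteq> disk" and h: "\<And>j. j < card Z \<Longrightarrow> \<bar>h j\<bar> \<le> 1" and s: "s \<in> {0..1}" and w: "w \<in> Z"
  shows "move h s Z w \<in> disk"
proof -
  have W: "width Z \<le> 1" using Z by (intro width_le) (auto simp: disk_def)
  have "\<bar>spread s Z * Re w\<bar> \<le> spread s Z * width Z"
    using spread_pos[OF Z(1) s] width_ge[OF Z(1) w] by (simp add: abs_mult)
  then have "\<bar>spread s Z * Re w\<bar> \<le> 1" using spread_width_le[OF Z(1) W s] by linarith
  moreover have "\<bar>(1 - s * straightening Z) * Im w + s * (straightening Z * h (height_rank Z w))\<bar> \<le> 1"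
  proof -
    let ?\<mu> = "s * straightening Z"
    have \<mu>: "0 \<le> ?\<mu>" "?\<mu> \<le> 1" using s straightening_bounds[of Z] by (auto intro: mult_le_one)
    have scaled: "\<bar>a * b\<bar> \<le> a" if "0 \<le> a" "\<bar>b\<bar> \<le> 1" for a b :: real
      using mult_left_le[OF that(2,1)] that(1) by (simp add: abs_mult)
    have "\<bar>(1 - ?\<mu>) * Im w\<bar> \<le> 1 - ?\<mu>" "\<bar>?\<mu> * h (height_rank Z w)\<bar> \<le> ?\<mu>"
      using \<mu> w Z h[OF rank_less[OF Z(1) w]] by (auto simp: disk_def intro!: scaled)
    then show ?thesis unfolding mult.assoc[symmetric] by linarith
  qed
  ultimately show ?thesis by (simp add: disk_def move_def)
qed

section \<open>Continuity of the straightening\<close>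

lemma tendsto_Max_insert:
  fixes f :: "'i \<Rightarrow> 'x \<Rightarrow> real"
  assumes "finite I" "\<And>i. i \<in> I \<Longrightarrow> (f i \<longlongrightarrow> a i) F"
  shows "((\<lambda>x. Max (insert c ((\<lambda>i. f i x) ` I))) \<longlongrightarrow> Max (insert c (a ` I))) F"
  using assms
proof (induction I rule: finite_induct)
  case (insert i I)
  have eq: "Max (insert c ((\<lambda>i. b i) ` insert i I)) = max (b i) (Max (insert c ((\<lambda>i. b i) ` I)))" for b :: "'i \<Rightarrow> real"
    using insert.hyps(1) by (simp only: image_insert insert_commute[of c]) (subst Max_insert, auto)
  show ?case unfolding eq by (intro tendsto_max insert.prems insert.IH) auto
qed simp

lemma tendsto_Min_insert:
  fixes f :: "'i \<Rightarrow> 'x \<Rightarrow> real"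
  assumes "finite I" "\<And>i. i \<in> I \<Longrightarrow> (f i \<longlongrightarrow> a i) F"
  shows "((\<lambda>x. Min (insert c ((\<lambda>i. f i x) ` I))) \<longlongrightarrow> Min (insert c (a ` I))) F"
  using assms
proof (induction I rule: finite_induct)
  case (insert i I)
  have eq: "Min (insert c ((\<lambda>i. b i) ` insert i I)) = min (b i) (Min (insert c ((\<lambda>i. b i) ` I)))" for b :: "'i \<Rightarrow> real"
    using insert.hyps(1) by (simp only: image_insert insert_commute[of c]) (subst Min_insert, auto)
  show ?case unfolding eq by (intro tendsto_min insert.prems insert.IH) auto
qed simp

text \<open>Labelled distinct points that converge along a filter. It serves both the joint
  continuity in time and configuration and the openness of the cover, which live on different
  spaces.\<close>

locale converging_points =
  fixes P :: "'p set" and Z :: "'x \<Rightarrow> 'p \<Rightarrow> complex" and z :: "'p \<Rightarrow> complex" and F :: "'x filter"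
  assumes P: "finite P" and inj: "\<forall>\<^sub>F x in F. inj_on (Z x) P" "inj_on z P"
    and conv: "p \<in> P \<Longrightarrow> ((\<lambda>x. Z x p) \<longlongrightarrow> z p) F"
begin

lemma tendsto_width: "((\<lambda>x. width (Z x ` P)) \<longlongrightarrow> width (z ` P)) F"
  unfolding width_def image_image by (rule tendsto_Max_insert[OF P]) (auto intro!: tendsto_intros conv)

lemma gap_image:
  assumes "inj_on y P"
  shows "gap (y ` P) = Min (insert 1 ((\<lambda>(p, q). \<bar>Im (y p) - Im (y q)\<bar>) ` {(p, q). p \<in> P \<and> q \<in> P \<and> p \<noteq> q}))"
proof -
  have "{(w, w'). w \<in> y ` P \<and> w' \<in> y ` P \<and> w \<noteq> w'} = (\<lambda>(p, q). (y p, y q)) ` {(p, q). p \<in> P \<and> q \<in> P \<and> p \<noteq> q}"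
    using assms by (auto simp: inj_on_def)
  then show ?thesis by (simp add: gap_def image_image case_prod_unfold)
qed

lemma tendsto_gap: "((\<lambda>x. gap (Z x ` P)) \<longlongrightarrow> gap (z ` P)) F"
proof -
  let ?I = "{(p, q). p \<in> P \<and> q \<in> P \<and> p \<noteq> q}"
  have "((\<lambda>x. Min (insert 1 ((\<lambda>i. case i of (p, q) \<Rightarrow> \<bar>Im (Z x p) - Im (Z x q)\<bar>) ` ?I))) \<longlongrightarrow>
      Min (insert 1 ((\<lambda>(p, q). \<bar>Im (z p) - Im (z q)\<bar>) ` ?I))) F"
  proof (rule tendsto_Min_insert)
    show "finite ?I" by (rule finite_subset[of _ "P \<times> P"]) (use P in auto)
  qed (auto intro!: tendsto_intros conv)
  moreover have "\<forall>\<^sub>F x in F. Min (insert 1 ((\<lambda>i. case i of (p, q) \<Rightarrow> \<bar>Im (Z x p) - Im (Z x q)\<bar>) ` ?I)) = gap (Z x ` P)"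
    using inj(1) by eventually_elim (simp add: gap_image)
  ultimately show ?thesis unfolding gap_image[OF inj(2)] by (rule Lim_transform_eventually)
qed

lemma finite_image: "finite (y ` P)" using P by simp

lemma tendsto_straightening: "((\<lambda>x. straightening (Z x ` P)) \<longlongrightarrow> straightening (z ` P)) F"
  unfolding straightening_def
  using gap_or_width_pos(1)[OF finite_image, of z]
  by (intro tendsto_intros tendsto_min tendsto_max tendsto_gap tendsto_width) auto

lemma tendsto_spread:
  assumes "(S \<longlongrightarrow> s) F" shows "((\<lambda>x. spread (S x) (Z x ` P)) \<longlongrightarrow> spread s (z ` P)) F"
  unfolding spread_def
  using gap_or_width_pos(2)[OF finite_image, of z]
  by (intro tendsto_intros tendsto_max tendsto_gap tendsto_width assms) auto

text \<open>With a positive gap all heights are distinct, and finitely many strict inequalities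
  persist near the limit.\<close>

lemma eventually_rank:
  assumes "0 < gap (z ` P)" "p \<in> P"
  shows "\<forall>\<^sub>F x in F. height_rank (Z x ` P) (Z x p) = height_rank (z ` P) (z p)"
proof -
  have rank_image: "height_rank (y ` P) (y p) = card {q \<in> P. Im (y p) < Im (y q)}" if "inj_on y P" for y
  proof -
    have "{w' \<in> y ` P. Im (y p) < Im w'} = y ` {q \<in> P. Im (y p) < Im (y q)}" by auto
    moreover have "inj_on y {q \<in> P. Im (y p) < Im (y q)}" using that by (auto simp: inj_on_def)
    ultimately show ?thesis by (simp add: height_rank_def card_image)
  qed
  have "\<forall>\<^sub>F x in F. Im (Z x p) < Im (Z x q) \<longleftrightarrow> Im (z p) < Im (z q)" if q: "q \<in> P" for q
  proof (cases "q = p")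
    case False
    then have "z p \<noteq> z q" using assms(2) q inj(2) by (auto simp: inj_on_def)
    then have "Im (z p) \<noteq> Im (z q)"
      using gap_le[OF finite_image, of "z p" z "z q"] assms q by auto
    moreover have lim: "((\<lambda>x. Im (Z x q) - Im (Z x p)) \<longlongrightarrow> Im (z q) - Im (z p)) F"
      by (intro tendsto_intros conv q assms)
    ultimately consider "0 < Im (z q) - Im (z p)" | "Im (z q) - Im (z p) < 0" by linarith
    then show ?thesis
    proof cases
      case 1
      from order_tendstoD(1)[OF lim this] show ?thesis by eventually_elim (use 1 in auto)
    next
      case 2
      from order_tendstoD(2)[OF lim this] show ?thesis by eventually_elim (use 2 in auto)
    qed
  qed simp
  then have "\<forall>\<^sub>F x in F. \<forall>q\<in>P. Im (Z x p) < Im (Z x q) \<longleftrightarrow> Im (z p) < Im (z q)"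
    using P by (simp add: eventually_ball_finite_distrib)
  with inj(1) show ?thesis
  proof eventually_elim
    case (elim x)
    then have "{q \<in> P. Im (Z x p) < Im (Z x q)} = {q \<in> P. Im (z p) < Im (z q)}" by blast
    then show ?case by (simp only: rank_image[OF elim(1)] rank_image[OF inj(2)])
  qed
qed

text \<open>The rank is harmless where the gap is positive. Where the gap is zero the width exceeds
  it, so the factor \<open>straightening\<close> is zero nearby and hides the jump of the
  rank.\<close>

lemma tendsto_straightened_height:
  assumes p: "p \<in> P"
  shows "((\<lambda>x. straightening (Z x ` P) * h (height_rank (Z x ` P) (Z x p))) \<longlongrightarrow>
    straightening (z ` P) * h (height_rank (z ` P) (z p))) F"
proof (cases "0 < gap (z ` P)")
  case True
  then have "\<forall>\<^sub>F x in F. straightening (Z x ` P) * h (height_rank (z ` P) (z p)) =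
      straightening (Z x ` P) * h (height_rank (Z x ` P) (Z x p))"
    using eventually_rank[OF _ p] by (auto elim: eventually_mono)
  then show ?thesis
    by (rule Lim_transform_eventually[rotated]) (intro tendsto_intros tendsto_straightening)
next
  case False
  then have gw: "gap (z ` P) < width (z ` P)"
    using gap_cases[OF finite_image, of z] gap_or_width_pos(1)[OF finite_image, of z] by auto
  then have "straightening (z ` P) = 0" by (intro straightening_0 finite_image) simp
  moreover have "((\<lambda>x. width (Z x ` P) - gap (Z x ` P)) \<longlongrightarrow> width (z ` P) - gap (z ` P)) F"
    by (intro tendsto_intros tendsto_width tendsto_gap)
  from order_tendstoD(1)[OF this, of 0] gw have "\<forall>\<^sub>F x in F. 0 < width (Z x ` P) - gap (Z x ` P)" by simp
  then have "\<forall>\<^sub>F x in F. straightening (Z x ` P) * h (height_rank (Z x ` P) (Z x p)) = 0"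
    by eventually_elim (simp add: straightening_0 finite_image)
  ultimately show ?thesis by (simp add: tendsto_eventually)
qed

lemma tendsto_move:
  assumes "(S \<longlongrightarrow> s) F" "p \<in> P"
  shows "((\<lambda>x. move h (S x) (Z x ` P) (Z x p)) \<longlongrightarrow> move h s (z ` P) (z p)) F"
  unfolding move_def
  by (intro tendsto_Complex tendsto_intros tendsto_spread tendsto_straightening tendsto_straightened_height assms conv)

end

section \<open>Straightening configurations\<close>

lemma continuous_map_euclidean_atin:
  "continuous_map X euclidean f \<longleftrightarrow> (\<forall>x\<in>topspace X. (f \<longlongrightarrow> f x) (atin X x))"
  by (simp add: continuous_map_atin)

lemma eventually_topspace_atin: "\<forall>\<^sub>F y in atin X x. y \<in> topspace X"
  by (auto simp: eventually_atin)

lemma openin_eventually: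
  assumes "\<And>x. x \<in> V \<Longrightarrow> x \<in> topspace X" "\<And>x. x \<in> V \<Longrightarrow> \<forall>\<^sub>F y in atin X x. y \<in> V"
  shows "openin X V"
proof (subst openin_subopen, intro ballI)
  fix x assume x: "x \<in> V"
  then obtain U where "openin X U" "x \<in> U" "\<forall>y\<in>U - {x}. y \<in> V"
    using assms[OF x] by (auto simp: eventually_atin)
  with x show "\<exists>T. openin X T \<and> x \<in> T \<and> T \<subseteq> V" by blast
qed

lemma finite_point_labels [simp]: "finite (point_labels l c)"
  by (simp add: point_labels_def)

lemma card_point_labels: "card (point_labels l c) = num_points l c"
  by (simp add: point_labels_def num_points_def)

lemma topspace_ordered_conf:
  "topspace (ordered_conf l c) = {z \<in> point_labels l c \<rightarrow>\<^sub>E disk. inj_on z (point_labels l c)}"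
  by (auto simp: ordered_conf_def)

lemma quotient_map_forget_order: "quotient_map (ordered_conf l c) (conf l c) (forget_order l c)"
  unfolding conf_def by (rule quotient_map_quotient_topology)

lemma topspace_conf: "topspace (conf l c) = forget_order l c ` topspace (ordered_conf l c)"
  using quotient_imp_surjective_map[OF quotient_map_forget_order] by metis

definition conf_points :: "(nat \<Rightarrow> complex set) \<Rightarrow> complex set"
  where "conf_points \<zeta> = (\<Union>i. \<zeta> i)"

lemma conf_points_forget_order: "conf_points (forget_order l c z) = z ` point_labels l c"
  by (auto simp: conf_points_def forget_order_def)

lemma continuous_map_ordered_conf_coord:
  assumes "p \<in> point_labels l c"
  shows "continuous_map (ordered_conf l c) euclidean (\<lambda>z. z p)"
proof -
  have "continuous_map (product_topology (\<lambda>_. top_of_set disk) (point_labels l c)) (top_of_set disk) (\<lambda>z. z p)"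
    by (rule continuous_map_product_projection[OF assms])
  then show ?thesis
    unfolding ordered_conf_def by (metis continuous_map_from_subtopology continuous_map_into_fulltopology)
qed

lemma converging_points_ordered_conf:
  assumes z: "z \<in> topspace (ordered_conf l c)"
  shows "converging_points (point_labels l c) (\<lambda>z. z) z (atin (ordered_conf l c) z)"
proof
  show "\<forall>\<^sub>F y in atin (ordered_conf l c) z. inj_on y (point_labels l c)"
    using eventually_topspace_atin by (rule eventually_mono) (simp add: topspace_ordered_conf)
  show "((\<lambda>x. x p) \<longlongrightarrow> z p) (atin (ordered_conf l c) z)" if "p \<in> point_labels l c" for p
    using continuous_map_ordered_conf_coord[OF that] z by (simp add: continuous_map_euclidean_atin)
qed (use z in \<open>auto simp: topspace_ordered_conf\<close>)

text \<open>Each colour is moved according to the whole configuration, since points of different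
  colours must stay distinct too.\<close>

definition conf_move :: "(nat \<Rightarrow> real) \<Rightarrow> real \<Rightarrow> (nat \<Rightarrow> complex set) \<Rightarrow> nat \<Rightarrow> complex set"
  where "conf_move h s \<zeta> i = move h s (conf_points \<zeta>) ` \<zeta> i"

lemma conf_move_forget_order:
  "conf_move h s (forget_order l c z) =
    forget_order l c (\<lambda>p\<in>point_labels l c. move h s (z ` point_labels l c) (z p))"
  by (auto simp: fun_eq_iff conf_move_def conf_points_forget_order) (auto simp: forget_order_def image_iff)

lemma arc_heights_bounds:
  assumes "arc_heights m h"
  shows "j < m \<Longrightarrow> \<bar>h j\<bar> \<le> 1" "i < j \<Longrightarrow> j < m \<Longrightarrow> h j < h i" "i < m \<Longrightarrow> j < m \<Longrightarrow> h i = h j \<Longrightarrow> i = j"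
    "i < m \<Longrightarrow> j < m \<Longrightarrow> h i < h j \<longleftrightarrow> j < i"
proof -
  show *: "i < j \<Longrightarrow> j < m \<Longrightarrow> h j < h i" for i j using assms by (auto simp: arc_heights_def)
  show "j < m \<Longrightarrow> \<bar>h j\<bar> \<le> 1" using assms by (force simp: arc_heights_def)
  show "i < m \<Longrightarrow> j < m \<Longrightarrow> h i = h j \<Longrightarrow> i = j" using *[of i j] *[of j i] by (cases i j rule: linorder_cases) auto
  show "i < m \<Longrightarrow> j < m \<Longrightarrow> h i < h j \<longleftrightarrow> j < i" using *[of i j] *[of j i] by (cases i j rule: linorder_cases) auto
qed

lemma ordered_move_topspace:
  assumes h: "arc_heights (num_points l c) h" and s: "s \<in> {0..1}" and z: "z \<in> topspace (ordered_conf l c)"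
  shows "(\<lambda>p\<in>point_labels l c. move h s (z ` point_labels l c) (z p)) \<in> topspace (ordered_conf l c)"
proof -
  let ?P = "point_labels l c"
  have inj: "inj_on z ?P" and disk: "z ` ?P \<subseteq> disk" using z by (auto simp: topspace_ordered_conf)
  have card: "card (z ` ?P) = num_points l c" using card_image[OF inj] by (simp add: card_point_labels)
  have "inj_on (move h s (z ` ?P)) (z ` ?P)"
    by (rule move_inj) (use h s in \<open>auto simp: card arc_heights_bounds\<close>)
  with inj have "inj_on (\<lambda>p\<in>?P. move h s (z ` ?P) (z p)) ?P"
    by (auto simp: inj_on_def)
  moreover have "move h s (z ` ?P) (z p) \<in> disk" if "p \<in> ?P" for p
    by (rule move_disk) (use that h s disk in \<open>auto simp: card arc_heights_bounds\<close>)
  ultimately show ?thesis by (auto simp: topspace_ordered_conf)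
qed

lemma continuous_map_ordered_move:
  assumes h: "arc_heights (num_points l c) h"
  shows "continuous_map (prod_topology (top_of_set {0..1}) (ordered_conf l c)) (ordered_conf l c)
    (\<lambda>(s, z). \<lambda>p\<in>point_labels l c. move h s (z ` point_labels l c) (z p))"
proof -
  let ?P = "point_labels l c" and ?X = "prod_topology (top_of_set {0..1::real}) (ordered_conf l c)"
  have "continuous_map ?X euclidean (\<lambda>x. move h (fst x) (snd x ` ?P) (snd x p))" if p: "p \<in> ?P" for p
    unfolding continuous_map_euclidean_atin
  proof
    fix x assume x: "x \<in> topspace ?X"
    interpret converging_points ?P snd "snd x" "atin ?X x"
    proof
      show "\<forall>\<^sub>F y in atin ?X x. inj_on (snd y) ?P"
        using eventually_topspace_atin by (rule eventually_mono) (auto simp: topspace_ordered_conf)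
      show "((\<lambda>y. snd y q) \<longlongrightarrow> snd x q) (atin ?X x)" if "q \<in> ?P" for q
        using continuous_map_compose[OF continuous_map_snd continuous_map_ordered_conf_coord[OF that]] x
        unfolding o_def continuous_map_euclidean_atin by blast
    qed (use x in \<open>auto simp: topspace_ordered_conf\<close>)
    have "continuous_map ?X euclidean fst"
      using continuous_map_fst continuous_map_into_fulltopology by blast
    then have "(fst \<longlongrightarrow> fst x) (atin ?X x)" using x unfolding continuous_map_euclidean_atin by blast
    then show "((\<lambda>y. move h (fst y) (snd y ` ?P) (snd y p)) \<longlongrightarrow> move h (fst x) (snd x ` ?P) (snd x p)) (atin ?X x)"
      using p by (rule tendsto_move)
  qed
  moreover have "(\<lambda>p\<in>?P. move h (fst x) (snd x ` ?P) (snd x p)) \<in> topspace (ordered_conf l c)"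
    if "x \<in> topspace ?X" for x
    using that by (intro ordered_move_topspace h) auto
  ultimately show ?thesis
    unfolding case_prod_unfold
    by (subst (2) ordered_conf_def)
      (auto simp: continuous_map_in_subtopology continuous_map_componentwise topspace_ordered_conf Pi_iff PiE_iff)
qed

text \<open>Continuity is checked on ordered configurations and descends: the product of a quotient
  map with the locally compact Hausdorff interval is again a quotient map.\<close>

lemma continuous_map_conf_move:
  assumes h: "arc_heights (num_points l c) h"
  shows "continuous_map (prod_topology (top_of_set {0..1}) (conf l c)) (conf l c) (\<lambda>(s, \<zeta>). conf_move h s \<zeta>)"
proof -
  let ?I = "top_of_set {0..1::real}"
  have "locally_compact_space ?I" "Hausdorff_space ?I"
    by (simp_all add: compact_imp_locally_compact_space compact_space_subtopology compactin_euclidean_iff Hausdorff_space_subtopology)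
  then have q: "quotient_map (prod_topology ?I (ordered_conf l c)) (prod_topology ?I (conf l c)) (\<lambda>(s, z). (s, forget_order l c z))"
    by (intro quotient_map_prod_right quotient_map_forget_order) auto
  have "continuous_map (prod_topology ?I (ordered_conf l c)) (conf l c)
      (forget_order l c \<circ> (\<lambda>(s, z). \<lambda>p\<in>point_labels l c. move h s (z ` point_labels l c) (z p)))"
    by (intro continuous_map_compose[OF continuous_map_ordered_move[OF h]] quotient_imp_continuous_map quotient_map_forget_order)
  also have "forget_order l c \<circ> (\<lambda>(s, z). \<lambda>p\<in>point_labels l c. move h s (z ` point_labels l c) (z p)) =
      (\<lambda>(s, \<zeta>). conf_move h s \<zeta>) \<circ> (\<lambda>(s, z). (s, forget_order l c z))"
    by (auto simp: conf_move_forget_order)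
  finally show ?thesis by (rule continuous_compose_quotient_map[OF q])
qed

lemma finite_conf_points: "\<zeta> \<in> topspace (conf l c) \<Longrightarrow> finite (conf_points \<zeta>)"
  by (auto simp: topspace_conf conf_points_forget_order)

lemma conf_points_disk: "\<zeta> \<in> topspace (conf l c) \<Longrightarrow> conf_points \<zeta> \<subseteq> disk"
  by (auto simp: topspace_conf conf_points_forget_order topspace_ordered_conf)

lemma width_conf_le: "\<zeta> \<in> topspace (conf l c) \<Longrightarrow> width (conf_points \<zeta>) \<le> 1"
  using conf_points_disk[of \<zeta> l c] by (intro width_le finite_conf_points) (auto simp: disk_def)

text \<open>In the disk real parts are bounded by 1, and touching a side means attaining this bound.
  This expresses \<open>S\<close> by the quantity that governs the homotopy.\<close>

lemma conf_sides_iff: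
  assumes \<zeta>: "\<zeta> \<in> topspace (conf l c)"
  shows "\<zeta> \<in> conf_sides l c \<longleftrightarrow> width (conf_points \<zeta>) = 1"
proof -
  have fin: "finite (conf_points \<zeta>)" by (rule finite_conf_points[OF \<zeta>])
  have "(\<exists>i\<in>{1..l}. \<zeta> i \<inter> vertical_sides \<noteq> {}) \<longleftrightarrow> (\<exists>w\<in>conf_points \<zeta>. \<bar>Re w\<bar> = 1)"
  proof -
    obtain z where z: "z \<in> topspace (ordered_conf l c)" "\<zeta> = forget_order l c z"
      using \<zeta> by (auto simp: topspace_conf)
    then have "\<zeta> i = {}" if "i \<notin> {1..l}" for i using that by (auto simp: forget_order_def point_labels_def)
    then have "(\<exists>i\<in>{1..l}. \<zeta> i \<inter> vertical_sides \<noteq> {}) \<longleftrightarrow> conf_points \<zeta> \<inter> vertical_sides \<noteq> {}"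
      unfolding conf_points_def by blast
    then show ?thesis using conf_points_disk[OF \<zeta>] by (auto simp: vertical_sides_def)
  qed
  also have "\<dots> \<longleftrightarrow> width (conf_points \<zeta>) = 1"
    using width_ge[OF fin] width_conf_le[OF \<zeta>] by (metis antisym width_attained[OF fin] zero_less_one)
  finally show ?thesis using \<zeta> by (simp add: conf_sides_def)
qed

lemma conf_move_sides:
  assumes "\<zeta> \<in> topspace (conf l c)" "\<zeta> \<in> conf_sides l c"
  shows "conf_move h s \<zeta> = \<zeta>"
  using assms conf_sides_iff[OF assms(1)] move_wide[OF finite_conf_points[OF assms(1)]]
  by (auto simp: conf_move_def fun_eq_iff)

lemma conf_points_move: "conf_points (conf_move h s \<zeta>) = move h s (conf_points \<zeta>) ` conf_points \<zeta>"
  by (auto simp: conf_points_def conf_move_def)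

lemma conf_move_topspace:
  assumes "arc_heights (num_points l c) h" "s \<in> {0..1}" "\<zeta> \<in> topspace (conf l c)"
  shows "conf_move h s \<zeta> \<in> topspace (conf l c)"
  using Pi_mem[OF continuous_map_funspace[OF continuous_map_conf_move[OF assms(1)]], of "(s, \<zeta>)"] assms by simp

text \<open>At time 1 the spreading factor is the inverse of the width, which carries an outermost
  point to a vertical side.\<close>

lemma conf_move_wide:
  assumes h: "arc_heights (num_points l c) h" and \<zeta>: "\<zeta> \<in> topspace (conf l c)"
    and wide: "gap (conf_points \<zeta>) / 3 < width (conf_points \<zeta>)"
  shows "conf_move h 1 \<zeta> \<in> conf_sides l c"
proof -
  let ?Z = "conf_points \<zeta>"
  have fin: "finite ?Z" by (rule finite_conf_points[OF \<zeta>])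
  have top: "conf_move h 1 \<zeta> \<in> topspace (conf l c)" by (rule conf_move_topspace[OF h _ \<zeta>]) simp
  have pos: "0 < width ?Z" using wide gap_cases[OF fin] by linarith
  obtain w where w: "w \<in> ?Z" "\<bar>Re w\<bar> = width ?Z" by (rule width_attained[OF fin pos])
  have "Re (move h 1 ?Z w) = Re w / width ?Z" using wide by (simp add: move_def spread_def max_def)
  then have "\<bar>Re (move h 1 ?Z w)\<bar> = 1" using w pos by simp
  then have "1 \<le> width (conf_points (conf_move h 1 \<zeta>))"
    using width_ge[OF finite_conf_points[OF top], of "move h 1 ?Z w"] w(1) by (simp add: conf_points_move)
  then show ?thesis using conf_sides_iff[OF top] width_conf_le[OF top] by simp
qed

section \<open>The cells of arcs\<close>

lemma count_list_card: "count_list r i = card {j. j < length r \<and> r ! j = i}"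
proof -
  have "count_list r i = length (filter ((=) i) r)" by (rule count_list_eq_length_filter)
  then show ?thesis by (simp add: length_filter_conv_card eq_commute)
qed

text \<open>There are as many arcs of colour \<open>i\<close> as labels of that colour; any matching
  of them yields a lift of the arc cube to ordered configurations.\<close>

lemma colour_words_labelling:
  assumes r: "r \<in> colour_words l c"
  obtains \<rho> where "bij_betw \<rho> (point_labels l c) {..<num_points l c}" "\<And>p. p \<in> point_labels l c \<Longrightarrow> r ! \<rho> p = fst p"
proof -
  let ?A = "\<lambda>i. {j. j < length r \<and> r ! j = i}"
  have len: "length r = num_points l c" and cnt: "\<And>i. i \<in> {1..l} \<Longrightarrow> card (?A i) = c i" and "set r \<subseteq> {1..l}"
    using r by (auto simp: colour_words_def count_list_card)
  have "\<exists>f. bij_betw f {..<c i} (?A i)" if "i \<in> {1..l}" for i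
    using ex_bij_betw_nat_finite[of "?A i"] cnt[OF that] by (auto simp: atLeast0LessThan)
  then obtain f where f: "\<And>i. i \<in> {1..l} \<Longrightarrow> bij_betw (f i) {..<c i} (?A i)" by metis
  define \<rho> where "\<rho> p = f (fst p) (snd p)" for p
  have mem: "\<rho> p < length r \<and> r ! \<rho> p = fst p" if "p \<in> point_labels l c" for p
    using that bij_betwE[OF f[of "fst p"]] by (auto simp: point_labels_def \<rho>_def)
  have "inj_on \<rho> (point_labels l c)"
  proof (rule inj_onI)
    fix p q assume pq: "p \<in> point_labels l c" "q \<in> point_labels l c" "\<rho> p = \<rho> q"
    then have e: "fst p = fst q" using mem by metis
    moreover have "snd p = snd q"
      using pq e f[of "fst q"] by (auto simp: point_labels_def \<rho>_def bij_betw_def inj_on_def)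
    ultimately show "p = q" by (simp add: prod_eq_iff)
  qed
  moreover have "\<rho> ` point_labels l c \<subseteq> {..<num_points l c}" using mem len by auto
  then have "\<rho> ` point_labels l c = {..<num_points l c}"
    using card_image[OF calculation] by (intro card_subset_eq) (auto simp: card_point_labels)
  ultimately show thesis using mem that by (auto simp: bij_betw_def)
qed

lemma arc_cube_forget_order:
  assumes "bij_betw \<rho> (point_labels l c) {..<num_points l c}" "\<And>p. p \<in> point_labels l c \<Longrightarrow> r ! \<rho> p = fst p"
    and "length r = num_points l c"
  shows "arc_cube h r t = forget_order l c (\<lambda>p\<in>point_labels l c. Complex (-1 + 2 * t (\<rho> p)) (h (\<rho> p)))"
proof
  fix i
  have "{j. j < length r \<and> r ! j = i} = \<rho> ` {p \<in> point_labels l c. fst p = i}"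
  proof (intro equalityI subsetI)
    fix j assume j: "j \<in> {j. j < length r \<and> r ! j = i}"
    then have "j \<in> \<rho> ` point_labels l c" using bij_betw_imp_surj_on[OF assms(1)] assms(3) by simp
    then obtain p where p: "j = \<rho> p" "p \<in> point_labels l c" by (rule imageE)
    then have "fst p = i" using assms(2)[OF p(2)] j by simp
    with p show "j \<in> \<rho> ` {p \<in> point_labels l c. fst p = i}" by blast
  next
    fix j assume "j \<in> \<rho> ` {p \<in> point_labels l c. fst p = i}"
    then obtain p where "p \<in> point_labels l c" "fst p = i" "j = \<rho> p" by blast
    then show "j \<in> {j. j < length r \<and> r ! j = i}" using assms(2)[of p] bij_betwE[OF assms(1)] assms(3) by auto
  qed
  then have "arc_cube h r t i = (\<lambda>p. Complex (-1 + 2 * t (\<rho> p)) (h (\<rho> p))) ` {p \<in> point_labels l c. fst p = i}"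
    unfolding arc_cube_def by (simp add: setcompr_eq_image image_image)
  then show "arc_cube h r t i = forget_order l c (\<lambda>p\<in>point_labels l c. Complex (-1 + 2 * t (\<rho> p)) (h (\<rho> p))) i"
    by (auto simp: forget_order_def image_iff)
qed

lemma conf_points_arc_cube: "conf_points (arc_cube h r t) = (\<lambda>j. Complex (-1 + 2 * t j) (h j)) ` {..<length r}"
  by (auto simp: conf_points_def arc_cube_def)

lemma continuous_map_arc_cube:
  assumes h: "arc_heights (num_points l c) h" and r: "r \<in> colour_words l c"
  shows "continuous_map (real_top (cube (num_points l c))) (conf l c) (arc_cube h r)"
proof -
  let ?m = "num_points l c" and ?P = "point_labels l c"
  obtain \<rho> where \<rho>: "bij_betw \<rho> ?P {..<?m}" "\<And>p. p \<in> ?P \<Longrightarrow> r ! \<rho> p = fst p"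
    by (rule colour_words_labelling[OF r], rule that)
  define z where "z t = (\<lambda>p\<in>?P. Complex (-1 + 2 * t (\<rho> p)) (h (\<rho> p)))" for t
  have \<rho>m: "\<rho> p < ?m" if "p \<in> ?P" for p using \<rho>(1) that by (auto simp: bij_betw_def)
  have "inj_on (z t) ?P" for t
    using \<rho>(1) arc_heights_bounds(3)[OF h] \<rho>m by (auto simp: inj_on_def z_def bij_betw_def)
  moreover have "z t p \<in> disk" if "t \<in> cube ?m" "p \<in> ?P" for t p
    using that cube_mem(1)[OF that(1), of "\<rho> p"] arc_heights_bounds(1)[OF h \<rho>m] by (auto simp: z_def disk_def)
  moreover have "continuous_map (real_top (cube ?m)) euclidean (\<lambda>t. z t p)" if "p \<in> ?P" for p
  proof -
    have "((\<lambda>t. t j) \<longlongrightarrow> t j) (atin (real_top (cube ?m)) t)" if "t \<in> topspace (real_top (cube ?m))" for t and j :: nat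
      using continuous_map_real_top_coord[of "cube ?m" j] that unfolding continuous_map_euclidean_atin by blast
    then show ?thesis
      using that unfolding continuous_map_euclidean_atin z_def by (auto intro!: tendsto_intros)
  qed
  ultimately have "continuous_map (real_top (cube ?m)) (ordered_conf l c) z"
    unfolding ordered_conf_def
    by (auto simp: continuous_map_in_subtopology continuous_map_componentwise Pi_iff) (simp add: z_def)
  moreover have "arc_cube h r = forget_order l c \<circ> z"
    using arc_cube_forget_order[OF \<rho>, of h] r by (auto simp: z_def colour_words_def)
  ultimately show ?thesis
    using quotient_imp_continuous_map[OF quotient_map_forget_order] by (metis continuous_map_compose)
qed

text \<open>The Lagrange basis polynomial for the nodes \<open>h i\<close>. Evaluated at the height
  of a point on one of the arcs it tests for arc \<open>j\<close>, by a function that is continuous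
  everywhere.\<close>

definition lagrange_factor :: "nat \<Rightarrow> (nat \<Rightarrow> real) \<Rightarrow> nat \<Rightarrow> real \<Rightarrow> real"
  where "lagrange_factor m h j y = (\<Prod>i\<in>{..<m} - {j}. (y - h i) / (h j - h i))"

lemma lagrange_factor_height:
  assumes "arc_heights m h" "j < m" "i < m"
  shows "lagrange_factor m h j (h i) = (if i = j then 1 else 0)"
proof (cases "i = j")
  case True
  have "h j - h k \<noteq> 0" if "k \<in> {..<m} - {j}" for k
    using that arc_heights_bounds(3)[OF assms(1), of j k] assms(2) by auto
  then show ?thesis using True by (simp add: lagrange_factor_def)
next
  case False
  then have "\<exists>k\<in>{..<m} - {j}. (h i - h k) / (h j - h k) = 0" using assms(3) by (intro bexI[of _ i]) auto
  then show ?thesis using False by (simp add: lagrange_factor_def prod_zero)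
qed

text \<open>A left inverse of the cells which is defined and continuous on the whole configuration space.\<close>

definition arc_coords :: "nat \<Rightarrow> (nat \<Rightarrow> real) \<Rightarrow> (nat \<Rightarrow> complex set) \<Rightarrow> nat \<Rightarrow> real"
  where "arc_coords m h \<zeta> j =
    (if j < m then \<Sum>w\<in>conf_points \<zeta>. lagrange_factor m h j (Im w) * ((1 + Re w) / 2) else 1)"

lemma inj_on_arc_points:
  assumes "arc_heights m h" shows "inj_on (\<lambda>j. Complex (x j) (h j)) {..<m}"
  using arc_heights_bounds(3)[OF assms] by (auto simp: inj_on_def)

lemma arc_coords_arc_cube:
  assumes h: "arc_heights m h" and t: "t \<in> cube m" and r: "length r = m"
  shows "arc_coords m h (arc_cube h r t) = t"
proof
  fix j
  show "arc_coords m h (arc_cube h r t) j = t j"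
  proof (cases "j < m")
    case True
    have "arc_coords m h (arc_cube h r t) j = (\<Sum>i<m. lagrange_factor m h j (h i) * t i)"
      using True r by (simp add: arc_coords_def conf_points_arc_cube sum.reindex[OF inj_on_arc_points[OF h]])
    also have "\<dots> = (\<Sum>i<m. if i = j then t j else 0)"
      by (rule sum.cong) (use lagrange_factor_height[OF h True] in auto)
    finally show ?thesis using True by simp
  next
    case False
    then show ?thesis using cube_mem(2)[OF t, of j] by (simp add: arc_coords_def)
  qed
qed

text \<open>A symmetric function of the points: on ordered configurations it is a sum over the
  labels, by injectivity, and so it descends to the quotient.\<close>

lemma continuous_map_conf_sum:
  assumes F: "continuous_on UNIV (F :: complex \<Rightarrow> real)"
  shows "continuous_map (conf l c) euclideanreal (\<lambda>\<zeta>. \<Sum>w\<in>conf_points \<zeta>. F w)"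
proof (rule continuous_compose_quotient_map[OF quotient_map_forget_order])
  have "continuous_map (ordered_conf l c) euclideanreal (\<lambda>z. F (z p))" if "p \<in> point_labels l c" for p
    using continuous_map_compose[OF continuous_map_ordered_conf_coord[OF that], of euclideanreal F] F
    unfolding o_def by simp
  then have "continuous_map (ordered_conf l c) euclideanreal (\<lambda>z. \<Sum>p\<in>point_labels l c. F (z p))"
    by (intro continuous_map_sum) auto
  then show "continuous_map (ordered_conf l c) euclideanreal ((\<lambda>\<zeta>. \<Sum>w\<in>conf_points \<zeta>. F w) \<circ> forget_order l c)"
    by (rule continuous_map_eq) (auto simp: conf_points_forget_order topspace_ordered_conf sum.reindex)
qed

lemma continuous_map_arc_coord: "continuous_map (conf l c) euclideanreal (\<lambda>\<zeta>. arc_coords m h \<zeta> j)"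
proof (cases "j < m")
  case True
  have "continuous_on UNIV (\<lambda>w. lagrange_factor m h j (Im w) * ((1 + Re w) / 2))"
    unfolding lagrange_factor_def divide_inverse by (intro continuous_intros)
  from continuous_map_conf_sum[OF this] show ?thesis using True by (simp add: arc_coords_def)
qed (simp add: arc_coords_def)

lemma embedded_cell_arc_cube:
  assumes h: "arc_heights (num_points l c) h" and r: "r \<in> colour_words l c"
    and L: "rank_one_local_system (conf l c) L"
  shows "embedded_cell (conf l c) L (conf_sides l c) (cube (num_points l c)) (cube_frontier (num_points l c))
    (\<lambda>_. 1) (arc_cube h r) (arc_coords (num_points l c) h)"
proof
  let ?m = "num_points l c"
  have len: "length r = ?m" using r by (simp add: colour_words_def)
  show s: "continuous_map (real_top (cube ?m)) (conf l c) (arc_cube h r)" by (rule continuous_map_arc_cube[OF h r])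
  show gs: "arc_coords ?m h (arc_cube h r t) = t" if "t \<in> cube ?m" for t by (rule arc_coords_arc_cube[OF h that len])
  show "continuous_map (subtopology (conf l c) (arc_cube h r ` cube ?m)) (real_top (cube ?m)) (arc_coords ?m h)"
    using gs by (auto simp: continuous_map_real_top intro!: continuous_map_from_subtopology continuous_map_arc_coord)
  show "arc_cube h r t \<in> conf_sides l c \<longleftrightarrow> t \<in> cube_frontier ?m" if t: "t \<in> cube ?m" for t
  proof -
    have top: "arc_cube h r t \<in> topspace (conf l c)"
      using s t by (auto simp: continuous_map_def Pi_iff)
    let ?Z = "conf_points (arc_cube h r t)"
    have fin: "finite ?Z" by (rule finite_conf_points[OF top])
    have "width ?Z = 1 \<longleftrightarrow> (\<exists>w\<in>?Z. \<bar>Re w\<bar> = 1)"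
      using width_ge[OF fin] width_conf_le[OF top] by (metis antisym width_attained[OF fin] zero_less_one)
    also have "\<dots> \<longleftrightarrow> (\<exists>j<?m. \<bar>-1 + 2 * t j\<bar> = 1)" by (simp add: conf_points_arc_cube len Bex_def)
    also have "\<dots> \<longleftrightarrow> (\<exists>j<?m. t j = 0 \<or> t j = 1)" by (intro ex_cong1 conj_cong refl) auto
    finally show ?thesis using conf_sides_iff[OF top] t by (simp add: cube_frontier_def)
  qed
qed (auto simp: L seg_convex_cube)

text \<open>The height of a point determines its arc and its colour the letter of that arc, so the
  configuration determines the word.\<close>

lemma arc_cube_cells_disjoint:
  assumes h: "arc_heights m h" and r: "length r = m" "length r' = m" and eq: "arc_cube h r t = arc_cube h r' t'"
  shows "r = r'"
proof (rule nth_equalityI)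
  fix j assume j: "j < length r"
  then have "Complex (-1 + 2 * t j) (h j) \<in> arc_cube h r' t' (r ! j)"
    unfolding eq[symmetric] by (auto simp: arc_cube_def)
  then obtain i where i: "i < m" "r' ! i = r ! j" "h j = h i" using r by (auto simp: arc_cube_def)
  then show "r ! j = r' ! j" using arc_heights_bounds(3)[OF h, of j i] j r by simp
qed (use r in simp)

lemma height_rank_arc_points:
  assumes h: "arc_heights m h" and j: "j < m"
  shows "height_rank ((\<lambda>j. Complex (x j) (h j)) ` {..<m}) (Complex (x j) (h j)) = j"
proof -
  have "{w' \<in> (\<lambda>j. Complex (x j) (h j)) ` {..<m}. h j < Im w'} = (\<lambda>j. Complex (x j) (h j)) ` {..<j}"
    using arc_heights_bounds(4)[OF h j] j by auto
  moreover have "inj_on (\<lambda>j. Complex (x j) (h j)) {..<j}"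
    by (rule inj_on_subset[OF inj_on_arc_points[OF h]]) (use j in auto)
  ultimately show ?thesis by (simp add: height_rank_def card_image)
qed

text \<open>A point on arc \<open>j\<close> has rank \<open>j\<close> and already the height
  \<open>h j\<close>. Straightening leaves it there, and spreading moves it along its arc.\<close>

lemma conf_move_arc_cube:
  assumes h: "arc_heights (num_points l c) h" and r: "r \<in> colour_words l c" and t: "t \<in> cube (num_points l c)"
    and s: "s \<in> {0..1}"
  shows "conf_move h s (arc_cube h r t) \<in> arc_cube h r ` cube (num_points l c)"
proof -
  let ?m = "num_points l c" and ?Z = "conf_points (arc_cube h r t)"
  have len: "length r = ?m" using r by (simp add: colour_words_def)
  have top: "arc_cube h r t \<in> topspace (conf l c)"
    using continuous_map_arc_cube[OF h r] t by (auto simp: continuous_map_def Pi_iff)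
  note fin = finite_conf_points[OF top]
  define u where "u = (\<lambda>j. if j < ?m then (1 + spread s ?Z * (-1 + 2 * t j)) / 2 else 1)"
  have mv: "move h s ?Z (Complex (-1 + 2 * t j) (h j)) = Complex (-1 + 2 * u j) (h j)" if "j < ?m" for j
  proof -
    have "height_rank ?Z (Complex (-1 + 2 * t j) (h j)) = j"
      using height_rank_arc_points[OF h that] by (simp add: conf_points_arc_cube len)
    then show ?thesis using that by (simp add: move_def u_def algebra_simps)
  qed
  have "u j \<in> {0..1}" if "j < ?m" for j
  proof -
    have "Complex (-1 + 2 * t j) (h j) \<in> ?Z" using that len by (auto simp: conf_points_arc_cube)
    then have "\<bar>spread s ?Z * (-1 + 2 * t j)\<bar> \<le> spread s ?Z * width ?Z"
      using width_ge[OF fin, of "Complex (-1 + 2 * t j) (h j)"] spread_pos[OF fin s] by (simp add: abs_mult)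
    then have "\<bar>spread s ?Z * (-1 + 2 * t j)\<bar> \<le> 1"
      using spread_width_le[OF fin width_conf_le[OF top] s] by linarith
    then show ?thesis using that by (auto simp: u_def)
  qed
  then have u: "u \<in> cube ?m" by (auto simp: cube_def) (auto simp: u_def)
  have "conf_move h s (arc_cube h r t) i = arc_cube h r u i" for i
  proof -
    have "conf_move h s (arc_cube h r t) i = (\<lambda>j. move h s ?Z (Complex (-1 + 2 * t j) (h j))) ` {j. j < ?m \<and> r ! j = i}"
      by (auto simp: conf_move_def arc_cube_def len)
    also have "\<dots> = (\<lambda>j. Complex (-1 + 2 * u j) (h j)) ` {j. j < ?m \<and> r ! j = i}"
      by (intro image_cong refl, rule mv) simp
    also have "\<dots> = arc_cube h r u i" by (auto simp: arc_cube_def len)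
    finally show ?thesis .
  qed
  then have "conf_move h s (arc_cube h r t) = arc_cube h r u" by auto
  with u show ?thesis by blast
qed

section \<open>The open cover by wide and narrow configurations\<close>

definition wide_confs :: "nat \<Rightarrow> (nat \<Rightarrow> nat) \<Rightarrow> (nat \<Rightarrow> complex set) set"
  where "wide_confs l c = {\<zeta> \<in> topspace (conf l c). gap (conf_points \<zeta>) / 3 < width (conf_points \<zeta>)}"

text \<open>The bound \<open>gap / 2\<close> still gives complete straightening and exceeds the
  bound \<open>gap / 3\<close> of \<open>wide_confs\<close>, so both conditions can be strict and
  nevertheless cover. The word is read from top to bottom.\<close>

definition narrow_confs :: "nat \<Rightarrow> (nat \<Rightarrow> nat) \<Rightarrow> nat list \<Rightarrow> (nat \<Rightarrow> complex set) set"
  where "narrow_confs l c r = {\<zeta> \<in> topspace (conf l c). width (conf_points \<zeta>) < gap (conf_points \<zeta>) / 2 \<and>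
    (\<forall>i. \<forall>w\<in>\<zeta> i. r ! height_rank (conf_points \<zeta>) w = i)}"

lemma narrow_confs_forget_order:
  assumes "z \<in> topspace (ordered_conf l c)"
  shows "forget_order l c z \<in> narrow_confs l c r \<longleftrightarrow>
    width (z ` point_labels l c) < gap (z ` point_labels l c) / 2 \<and>
    (\<forall>p\<in>point_labels l c. r ! height_rank (z ` point_labels l c) (z p) = fst p)"
proof -
  have "forget_order l c z \<in> topspace (conf l c)" using assms by (auto simp: topspace_conf)
  moreover have "w \<in> forget_order l c z i \<longleftrightarrow> (\<exists>p\<in>point_labels l c. fst p = i \<and> w = z p)" for w i
    by (force simp: forget_order_def)
  then have "(\<forall>i. \<forall>w\<in>forget_order l c z i. r ! R w = i) \<longleftrightarrow> (\<forall>p\<in>point_labels l c. r ! R (z p) = fst p)"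
    for R :: "complex \<Rightarrow> nat"
    by auto
  ultimately show ?thesis by (simp add: narrow_confs_def conf_points_forget_order)
qed

lemma openin_conf:
  "openin (conf l c) V \<longleftrightarrow> V \<subseteq> topspace (conf l c) \<and>
    openin (ordered_conf l c) {z \<in> topspace (ordered_conf l c). forget_order l c z \<in> V}"
  by (simp add: topspace_conf) (simp add: conf_def openin_quotient_topology)

lemma openin_wide_confs: "openin (conf l c) (wide_confs l c)"
  unfolding openin_conf
proof
  let ?P = "point_labels l c"
  show "openin (ordered_conf l c) {z \<in> topspace (ordered_conf l c). forget_order l c z \<in> wide_confs l c}" (is "openin ?X ?V")
  proof (rule openin_eventually)
    fix z assume z: "z \<in> ?V"
    then interpret converging_points ?P "\<lambda>z. z" z "atin ?X z" by (intro converging_points_ordered_conf) auto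
    have "((\<lambda>z. width (z ` ?P) - gap (z ` ?P) / 3) \<longlongrightarrow> width (z ` ?P) - gap (z ` ?P) / 3) (atin ?X z)"
      by (intro tendsto_intros tendsto_width tendsto_gap) simp
    moreover have "0 < width (z ` ?P) - gap (z ` ?P) / 3"
      using z by (auto simp: wide_confs_def conf_points_forget_order)
    ultimately have "\<forall>\<^sub>F y in atin ?X z. 0 < width (y ` ?P) - gap (y ` ?P) / 3" by (rule order_tendstoD(1))
    with eventually_topspace_atin show "\<forall>\<^sub>F y in atin ?X z. y \<in> ?V"
      by eventually_elim (auto simp: wide_confs_def conf_points_forget_order topspace_conf)
  qed simp
qed (auto simp: wide_confs_def)

text \<open>Narrowness forces a positive gap, hence the ranks, and with them the colour condition,
  are locally constant.\<close>

lemma openin_narrow_confs: "openin (conf l c) (narrow_confs l c r)"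
  unfolding openin_conf
proof
  let ?P = "point_labels l c"
  show "openin (ordered_conf l c) {z \<in> topspace (ordered_conf l c). forget_order l c z \<in> narrow_confs l c r}" (is "openin ?X ?V")
  proof (rule openin_eventually)
    fix z assume z: "z \<in> ?V"
    then interpret converging_points ?P "\<lambda>z. z" z "atin ?X z" by (intro converging_points_ordered_conf) auto
    have zn: "width (z ` ?P) < gap (z ` ?P) / 2" "\<And>p. p \<in> ?P \<Longrightarrow> r ! height_rank (z ` ?P) (z p) = fst p"
      using z narrow_confs_forget_order[of z l c r] by auto
    have "((\<lambda>z. gap (z ` ?P) / 2 - width (z ` ?P)) \<longlongrightarrow> gap (z ` ?P) / 2 - width (z ` ?P)) (atin ?X z)"
      by (intro tendsto_intros tendsto_width tendsto_gap) simp
    moreover have "0 < gap (z ` ?P) / 2 - width (z ` ?P)" using zn(1) by simp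
    ultimately have "\<forall>\<^sub>F y in atin ?X z. 0 < gap (y ` ?P) / 2 - width (y ` ?P)" by (rule order_tendstoD(1))
    moreover have "0 < gap (z ` ?P)" using zn(1) width_nonneg[OF finite_image, of z] by linarith
    then have "\<forall>\<^sub>F y in atin ?X z. \<forall>p\<in>?P. height_rank (y ` ?P) (y p) = height_rank (z ` ?P) (z p)"
      using eventually_rank by (simp add: eventually_ball_finite_distrib)
    ultimately show "\<forall>\<^sub>F y in atin ?X z. y \<in> ?V"
      using eventually_topspace_atin by eventually_elim (auto simp: narrow_confs_forget_order zn(2))
  qed simp
qed (auto simp: narrow_confs_def)

lemma bij_betw_height_rank:
  assumes z: "z \<in> topspace (ordered_conf l c)" and gap: "0 < gap (z ` point_labels l c)"
  shows "bij_betw (\<lambda>p. height_rank (z ` point_labels l c) (z p)) (point_labels l c) {..<num_points l c}"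
proof -
  let ?P = "point_labels l c" and ?Z = "z ` point_labels l c"
  have inj: "inj_on z ?P" using z by (simp add: topspace_ordered_conf)
  have fin: "finite ?Z" by simp
  have inj': "inj_on (\<lambda>p. height_rank ?Z (z p)) ?P"
  proof (rule inj_onI, rule ccontr)
    fix p q assume pq: "p \<in> ?P" "q \<in> ?P" "height_rank ?Z (z p) = height_rank ?Z (z q)" "p \<noteq> q"
    then have "z p \<noteq> z q" using inj by (auto simp: inj_on_def)
    then have "Im (z p) \<noteq> Im (z q)" using gap_le[OF fin, of "z p" "z q"] pq gap by auto
    then show False
      using rank_strict[OF fin, of "z q" "z p"] rank_strict[OF fin, of "z p" "z q"] pq by fastforce
  qed
  moreover have "(\<lambda>p. height_rank ?Z (z p)) ` ?P \<subseteq> {..<num_points l c}"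
    using rank_less[OF fin] card_image[OF inj] by (auto simp: card_point_labels)
  then have "(\<lambda>p. height_rank ?Z (z p)) ` ?P = {..<num_points l c}"
    using card_image[OF inj'] by (intro card_subset_eq) (auto simp: card_point_labels)
  ultimately show ?thesis by (simp add: bij_betw_def)
qed

lemma conf_cover:
  assumes \<zeta>: "\<zeta> \<in> topspace (conf l c)"
  shows "\<zeta> \<in> wide_confs l c \<or> (\<exists>r\<in>colour_words l c. \<zeta> \<in> narrow_confs l c r)"
proof (cases "\<zeta> \<in> wide_confs l c")
  case False
  let ?P = "point_labels l c" and ?m = "num_points l c"
  obtain z where z: "z \<in> topspace (ordered_conf l c)" "\<zeta> = forget_order l c z"
    using \<zeta> by (auto simp: topspace_conf)
  let ?Z = "z ` ?P"
  have fin: "finite ?Z" by simp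
  have le: "width ?Z \<le> gap ?Z / 3" using False \<zeta> by (simp add: wide_confs_def z(2) conf_points_forget_order)
  then have gap: "0 < gap ?Z" using gap_or_width_pos(1)[OF fin] width_nonneg[OF fin] by linarith
  define \<rho> where "\<rho> p = height_rank ?Z (z p)" for p
  have \<rho>: "bij_betw \<rho> ?P {..<?m}" unfolding \<rho>_def by (rule bij_betw_height_rank[OF z(1) gap])
  \<comment> \<open>The word lists the colours of the points in the order of decreasing
    height.\<close>
  define r where "r = map (\<lambda>j. fst (inv_into ?P \<rho> j)) [0..<?m]"
  have r\<rho>: "r ! \<rho> p = fst p" if "p \<in> ?P" for p
    using that bij_betwE[OF \<rho>] bij_betw_inv_into_left[OF \<rho> that] by (auto simp: r_def)
  have len: "length r = ?m" by (simp add: r_def)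
  have "r \<in> colour_words l c"
  proof -
    have "set r \<subseteq> fst ` ?P"
      using bij_betwE[OF bij_betw_inv_into[OF \<rho>]] by (auto simp: r_def)
    then have "set r \<subseteq> {1..l}" by (auto simp: point_labels_def)
    moreover have "count_list r i = c i" if i: "i \<in> {1..l}" for i
    proof -
      have "{j. j < length r \<and> r ! j = i} = \<rho> ` {p \<in> ?P. fst p = i}"
      proof (intro equalityI subsetI)
        fix j assume j: "j \<in> {j. j < length r \<and> r ! j = i}"
        then have "j \<in> \<rho> ` ?P" using bij_betw_imp_surj_on[OF \<rho>] len by simp
        then obtain p where p: "j = \<rho> p" "p \<in> ?P" by (rule imageE)
        then have "fst p = i" using r\<rho>[OF p(2)] j by simp
        with p show "j \<in> \<rho> ` {p \<in> ?P. fst p = i}" by blast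
      qed (use r\<rho> bij_betwE[OF \<rho>] len in auto)
      moreover have "inj_on \<rho> {p \<in> ?P. fst p = i}"
        by (rule inj_on_subset[OF bij_betw_imp_inj_on[OF \<rho>]]) auto
      moreover have "{p \<in> ?P. fst p = i} = {i} \<times> {..<c i}" using i by (auto simp: point_labels_def)
      ultimately show ?thesis by (simp add: count_list_card card_image)
    qed
    ultimately show ?thesis using len by (simp add: colour_words_def)
  qed
  moreover have "\<zeta> \<in> narrow_confs l c r"
    unfolding z(2) narrow_confs_forget_order[OF z(1)] using le gap r\<rho> by (auto simp: \<rho>_def)
  ultimately show ?thesis by blast
qed simp

text \<open>Straightening is complete, so at time 1 each point sits at the height of the arc
  numbered by its rank, and \<open>narrow_confs\<close> ensures that this arc has its
  colour.\<close>

lemma conf_move_narrow: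
  assumes r: "r \<in> colour_words l c" and \<zeta>: "\<zeta> \<in> narrow_confs l c r"
  shows "conf_move h 1 \<zeta> \<in> arc_cube h r ` cube (num_points l c)"
proof -
  let ?P = "point_labels l c" and ?m = "num_points l c"
  have top: "\<zeta> \<in> topspace (conf l c)" using \<zeta> by (simp add: narrow_confs_def)
  then obtain z where z: "z \<in> topspace (ordered_conf l c)" "\<zeta> = forget_order l c z"
    by (auto simp: topspace_conf)
  let ?Z = "z ` ?P"
  have fin: "finite ?Z" by simp
  have le: "width ?Z < gap ?Z / 2" and col: "\<And>p. p \<in> ?P \<Longrightarrow> r ! height_rank ?Z (z p) = fst p"
    using \<zeta> narrow_confs_forget_order[OF z(1), of r] z(2) by auto
  have gap: "0 < gap ?Z" using le width_nonneg[OF fin] by linarith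
  define \<rho> where "\<rho> p = height_rank ?Z (z p)" for p
  have \<rho>: "bij_betw \<rho> ?P {..<?m}" unfolding \<rho>_def by (rule bij_betw_height_rank[OF z(1) gap])
  have len: "length r = ?m" using r by (simp add: colour_words_def)
  \<comment> \<open>Obtained by solving \<open>-1 + 2 * u j\<close> for the spread real part; the
    value 1 is the padding of the cube.\<close>
  define u where "u = (\<lambda>j. if j < ?m then (1 + spread 1 ?Z * Re (z (inv_into ?P \<rho> j))) / 2 else 1)"
  have u\<rho>: "u (\<rho> p) = (1 + spread 1 ?Z * Re (z p)) / 2" if "p \<in> ?P" for p
    using that bij_betwE[OF \<rho>] bij_betw_inv_into_left[OF \<rho> that] by (auto simp: u_def)
  have "u j \<in> {0..1}" if "j < ?m" for j
  proof -
    have "j \<in> \<rho> ` ?P" using bij_betw_imp_surj_on[OF \<rho>] that by simp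
    then obtain p where p: "j = \<rho> p" "p \<in> ?P" by (rule imageE)
    have "\<bar>spread 1 ?Z * Re (z p)\<bar> \<le> spread 1 ?Z * width ?Z"
      using width_ge[OF fin, of "z p"] spread_pos[OF fin, of 1] p(2) by (simp add: abs_mult)
    moreover have "width ?Z \<le> 1" using width_conf_le[OF top] by (simp add: z(2) conf_points_forget_order)
    ultimately have "\<bar>spread 1 ?Z * Re (z p)\<bar> \<le> 1"
      using spread_width_le[OF fin, of 1] by fastforce
    then show ?thesis unfolding p(1) u\<rho>[OF p(2)] by auto
  qed
  then have u: "u \<in> cube ?m" by (auto simp: cube_def) (auto simp: u_def)
  have "move h 1 ?Z (z p) = Complex (-1 + 2 * u (\<rho> p)) (h (\<rho> p))" if "p \<in> ?P" for p
  proof -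
    have "-1 + 2 * u (\<rho> p) = spread 1 ?Z * Re (z p)" unfolding u\<rho>[OF that] by (simp add: field_simps)
    then show ?thesis using straightening_1[OF fin] le by (simp add: move_def \<rho>_def)
  qed
  then have "conf_move h 1 \<zeta> = forget_order l c (\<lambda>p\<in>?P. Complex (-1 + 2 * u (\<rho> p)) (h (\<rho> p)))"
    unfolding z(2) conf_move_forget_order by (intro arg_cong[of _ _ "forget_order l c"] restrict_ext) simp
  also have "\<dots> = arc_cube h r u"
    by (rule arc_cube_forget_order[symmetric, OF \<rho> _ len]) (use col in \<open>simp add: \<rho>_def\<close>)
  finally show ?thesis using u by blast
qed

lemma finite_colour_words: "finite (colour_words l c)"
  by (rule finite_subset[OF _ finite_lists_length_eq[of "{1..l}" "num_points l c"]]) (auto simp: colour_words_def)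

proposition conf_retraction_to_cells:
  assumes h: "arc_heights (num_points l c) h" and L: "rank_one_local_system (conf l c) L"
  shows "retraction_to_cells (conf l c) L (conf_move h) (conf_sides l c)
    (insert (wide_confs l c) (narrow_confs l c ` colour_words l c))
    (arc_cube h) (cube (num_points l c)) (colour_words l c) (cube_frontier (num_points l c)) (\<lambda>_. 1)
    (num_points l c) (standard_cube_chain (num_points l c)) (\<lambda>_. arc_coords (num_points l c) h)"
proof (intro retraction_to_cells.intro retraction_to_pieces.intro homotopy_from_identity.intro
    retraction_to_pieces_axioms.intro retraction_to_cells_axioms.intro)
  let ?m = "num_points l c" and ?X = "conf l c"
  let ?\<C> = "insert (wide_confs l c) (narrow_confs l c ` colour_words l c)"
  let ?\<D> = "insert (conf_sides l c) ((\<lambda>r. arc_cube h r ` cube ?m) ` colour_words l c)"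
  show "rank_one_local_system ?X L" by (rule L)
  show "continuous_map (prod_topology (top_of_set {0..1}) ?X) ?X (\<lambda>(s, x). conf_move h s x)"
    by (rule continuous_map_conf_move[OF h])
  show "conf_move h 0 x = x" for x by (auto simp: conf_move_def)
  show "openin ?X V" if "V \<in> ?\<C>" for V using that openin_wide_confs openin_narrow_confs by blast
  show "topspace ?X \<subseteq> \<Union>?\<C>"
  proof
    fix \<zeta> assume "\<zeta> \<in> topspace ?X"
    from conf_cover[OF this] show "\<zeta> \<in> \<Union>?\<C>" by auto
  qed
  show "\<exists>D\<in>?\<D>. conf_move h 1 ` (V \<inter> topspace ?X) \<subseteq> D" if "V \<in> ?\<C>" for V
  proof -
    from that consider "V = wide_confs l c" | r where "r \<in> colour_words l c" "V = narrow_confs l c r" by blast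
    then show ?thesis
    proof cases
      case 1
      then have "conf_move h 1 ` (V \<inter> topspace ?X) \<subseteq> conf_sides l c"
        using conf_move_wide[OF h] by (auto simp: wide_confs_def)
      then show ?thesis by blast
    next
      case 2
      then have "conf_move h 1 ` (V \<inter> topspace ?X) \<subseteq> arc_cube h r ` cube ?m"
        using conf_move_narrow[OF 2(1)] by blast
      with 2(1) show ?thesis by blast
    qed
  qed
  show "conf_sides l c \<in> ?\<D>" by simp
  show "conf_move h s x \<in> D" if "D \<in> ?\<D>" "s \<in> {0..1}" "x \<in> topspace ?X" "x \<in> D" for D s x
  proof -
    from that(1) consider "D = conf_sides l c" | r where "r \<in> colour_words l c" "D = arc_cube h r ` cube ?m" by blast
    then show ?thesis
    proof cases
      case 1
      then show ?thesis using conf_move_sides[OF that(3)] that(4) by simp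
    next
      case 2
      then show ?thesis using conf_move_arc_cube[OF h 2(1) _ that(2)] that(4) by blast
    qed
  qed
  show "finite (colour_words l c)" by (rule finite_colour_words)
  show "embedded_cell ?X L (conf_sides l c) (cube ?m) (cube_frontier ?m) (\<lambda>_. 1) (arc_cube h r) (arc_coords ?m h)"
    if "r \<in> colour_words l c" for r by (rule embedded_cell_arc_cube[OF h that L])
  show "arc_cube h r ` cube ?m \<inter> arc_cube h r' ` cube ?m \<subseteq> conf_sides l c"
    if "r \<in> colour_words l c" "r' \<in> colour_words l c" "r \<noteq> r'" for r r'
  proof
    fix \<zeta> assume "\<zeta> \<in> arc_cube h r ` cube ?m \<inter> arc_cube h r' ` cube ?m"
    then obtain t t' where "arc_cube h r t = arc_cube h r' t'" by (metis IntE imageE)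
    moreover have "length r = ?m" "length r' = ?m" using that by (simp_all add: colour_words_def)
    ultimately have "r = r'" using arc_cube_cells_disjoint[OF h] by metis
    with that(3) show "\<zeta> \<in> conf_sides l c" by contradiction
  qed
  show "fundamental_chain ?m (cube ?m) (cube_frontier ?m) (standard_cube_chain ?m)" by (rule fundamental_cube)
qed

section \<open>The local system on the configuration space\<close>

lemma norm_dir_sq: "z \<noteq> w \<Longrightarrow> norm (dir_sq z w) = 1"
  by (simp add: dir_sq_def norm_power norm_divide)

lemma tendsto_dir_sq:
  assumes "(f \<longlongrightarrow> z) F" "(g \<longlongrightarrow> w) F" "z \<noteq> w"
  shows "((\<lambda>x. dir_sq (f x) (g x)) \<longlongrightarrow> dir_sq z w) F"
  unfolding dir_sq_def using assms(3) by (intro tendsto_intros assms) auto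

lemma forget_order_image:
  "i \<in> {1..l} \<Longrightarrow> forget_order l c z i = (\<lambda>k. z (i, k)) ` {..<c i}"
  by (auto simp: forget_order_def point_labels_def)

lemma inj_on_colour_points:
  assumes z: "z \<in> topspace (ordered_conf l c)" and i: "i \<in> {1..l}"
  shows "inj_on (\<lambda>k. \<i> * z (i, k)) {..<c i}"
proof (rule inj_onI)
  have inj: "inj_on z (point_labels l c)" using z by (simp add: topspace_ordered_conf)
  fix k k' assume "k \<in> {..<c i}" "k' \<in> {..<c i}" "\<i> * z (i, k) = \<i> * z (i, k')"
  then have "z (i, k) = z (i, k')" "(i, k) \<in> point_labels l c" "(i, k') \<in> point_labels l c"
    using i by (simp_all add: point_labels_def)
  from inj_onD[OF inj this] show "k = k'" by simp
qed

lemma rotate_conf_forget_order: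
  "i \<in> {1..l} \<Longrightarrow> rotate_conf (forget_order l c z) i = (\<lambda>k. \<i> * z (i, k)) ` {..<c i}"
  by (simp add: rotate_conf_def forget_order_image image_image)

lemma f_map_rotate:
  assumes z: "z \<in> topspace (ordered_conf l c)" and i: "i \<in> {1..l}"
  shows "f_map (rotate_conf (forget_order l c z) i) =
    (\<Prod>(a, b)\<in>{(a, b). a < b \<and> b < c i}. dir_sq (\<i> * z (i, a)) (\<i> * z (i, b)))"
  by (rule f_map_enumeration)
    (simp only: bij_betw_def rotate_conf_forget_order[OF i] inj_on_colour_points[OF z i] simp_thms)

lemma g_map_rotate:
  assumes z: "z \<in> topspace (ordered_conf l c)" and i: "i \<in> {1..l}" "j \<in> {1..l}"
  shows "g_map (rotate_conf (forget_order l c z) i) (rotate_conf (forget_order l c z) j) =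
    (\<Prod>a<c i. \<Prod>b<c j. dir_sq (\<i> * z (i, a)) (\<i> * z (j, b)))"
  by (simp add: g_map_def rotate_conf_forget_order[OF i(1)] rotate_conf_forget_order[OF i(2)]
      prod.reindex[OF inj_on_colour_points[OF z i(1)]] prod.reindex[OF inj_on_colour_points[OF z i(2)]])

text \<open>The lexicographic order in \<open>f_map\<close> changes abruptly as points move. By
  \<open>f_map_enumeration\<close> the order of the labels can be used instead, and then every
  factor is continuous and of norm 1 on ordered configurations.\<close>

lemma continuous_map_W_map: "continuous_map (conf l c) (torus (torus_coords l)) (W_map l)"
proof (rule continuous_compose_quotient_map[OF quotient_map_forget_order])
  let ?X = "ordered_conf l c" and ?P = "point_labels l c"
  define D where "D z p q = dir_sq (\<i> * z p) (\<i> * z q)" for z :: "nat \<times> nat \<Rightarrow> complex" and p q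
  have D_lim: "((\<lambda>y. D y p q) \<longlongrightarrow> D z p q) (atin ?X z)" and D_norm: "norm (D z p q) = 1"
    if z: "z \<in> topspace ?X" and pq: "p \<in> ?P" "q \<in> ?P" "p \<noteq> q" for z p q
  proof -
    interpret converging_points ?P "\<lambda>z. z" z "atin ?X z" by (rule converging_points_ordered_conf[OF z])
    have "z p \<noteq> z q" using inj(2) pq by (auto simp: inj_on_def)
    then show "norm (D z p q) = 1" unfolding D_def by (intro norm_dir_sq) auto
    show "((\<lambda>y. D y p q) \<longlongrightarrow> D z p q) (atin ?X z)"
      unfolding D_def using \<open>z p \<noteq> z q\<close> by (intro tendsto_dir_sq tendsto_intros conv pq) auto
  qed
  have fm: "f_map (rotate_conf (forget_order l c z) i) =
      (\<Prod>p\<in>{(a, b). a < b \<and> b < c i}. D z (i, fst p) (i, snd p))"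
    if "z \<in> topspace ?X" "i \<in> {1..l}" for z i
    using f_map_rotate[OF that] by (simp add: D_def case_prod_unfold)
  have gm: "g_map (rotate_conf (forget_order l c z) i) (rotate_conf (forget_order l c z) j) =
      (\<Prod>a<c i. \<Prod>b<c j. D z (i, a) (j, b))"
    if "z \<in> topspace ?X" "i \<in> {1..l}" "j \<in> {1..l}" for z i j
    using g_map_rotate[OF that] by (simp add: D_def)
  have "continuous_map ?X (top_of_set (sphere 0 1)) (\<lambda>z. (W_map l \<circ> forget_order l c) z e)"
    if e: "e \<in> torus_coords l" for e
  proof -
    obtain i j where ij: "e = (i, j)" "i \<in> {1..l}" "j \<in> {1..l}" "i \<le> j"
      using e by (auto simp: torus_coords_def)
    define G where "G z = (if i = j then \<Prod>p\<in>{(a, b). a < b \<and> b < c i}. D z (i, fst p) (i, snd p)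
      else \<Prod>a<c i. \<Prod>b<c j. D z (i, a) (j, b))" for z
    have W: "(W_map l \<circ> forget_order l c) z e = G z" if "z \<in> topspace ?X" for z
      using e fm[OF that ij(2)] gm[OF that ij(2,3)] by (cases "i = j") (simp_all add: W_map_def Phi_def G_def ij(1))
    have "(G \<longlongrightarrow> G z) (atin ?X z) \<and> norm (G z) = 1" if z: "z \<in> topspace ?X" for z
    proof (cases "i = j")
      case True
      let ?A = "{(a, b). a < b \<and> b < c i}"
      have G: "G y = (\<Prod>p\<in>?A. D y (i, fst p) (i, snd p))" for y using True by (simp add: G_def)
      have mem: "(i, fst p) \<in> ?P" "(i, snd p) \<in> ?P" "(i, fst p) \<noteq> (i, snd p)" if "p \<in> ?A" for p
        using that ij(2) by (auto simp: point_labels_def)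
      have "((\<lambda>y. \<Prod>p\<in>?A. D y (i, fst p) (i, snd p)) \<longlongrightarrow> (\<Prod>p\<in>?A. D z (i, fst p) (i, snd p))) (atin ?X z)"
        by (rule tendsto_prod, rule D_lim[OF z mem])
      moreover have "norm (\<Prod>p\<in>?A. D z (i, fst p) (i, snd p)) = 1"
        unfolding prod_norm[symmetric] by (rule prod.neutral, rule ballI, rule D_norm[OF z mem])
      ultimately show ?thesis unfolding G ..
    next
      case False
      have G: "G y = (\<Prod>a<c i. \<Prod>b<c j. D y (i, a) (j, b))" for y using False by (simp add: G_def)
      have mem: "(i, a) \<in> ?P" "(j, b) \<in> ?P" "(i, a) \<noteq> (j, b)" if "a \<in> {..<c i}" "b \<in> {..<c j}" for a b
        using that ij False by (auto simp: point_labels_def)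
      have "((\<lambda>y. \<Prod>a<c i. \<Prod>b<c j. D y (i, a) (j, b)) \<longlongrightarrow> (\<Prod>a<c i. \<Prod>b<c j. D z (i, a) (j, b))) (atin ?X z)"
        by (rule tendsto_prod, rule tendsto_prod, rule D_lim[OF z mem])
      moreover have "norm (\<Prod>a<c i. \<Prod>b<c j. D z (i, a) (j, b)) = 1"
        unfolding prod_norm[symmetric]
        by (rule prod.neutral, rule ballI, rule prod.neutral, rule ballI, rule D_norm[OF z mem])
      ultimately show ?thesis unfolding G ..
    qed
    then have "continuous_map ?X (top_of_set (sphere 0 1)) G"
      by (auto simp: continuous_map_in_subtopology continuous_map_euclidean_atin)
    then show ?thesis by (rule continuous_map_eq[of ?X _ G "\<lambda>z. (W_map l \<circ> forget_order l c) z e"]) (rule W[symmetric])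
  qed
  moreover have "(W_map l \<circ> forget_order l c) z \<in> extensional (torus_coords l)" for z
    by (simp add: W_map_def Phi_def)
  ultimately show "continuous_map ?X (torus (torus_coords l)) (W_map l \<circ> forget_order l c)"
    unfolding torus_def continuous_map_componentwise by auto
qed

lemma rank_one_pullback:
  fixes X :: "'x topology"
  assumes L: "rank_one_local_system Y L" and w: "continuous_map X Y w"
  shows "rank_one_local_system X (pullback_local_system w L)"
  unfolding rank_one_local_system_def pullback_local_system_def
proof (intro conjI ballI allI impI)
  fix x assume "x \<in> topspace X"
  then have "w x \<in> topspace Y" using w by (auto simp: continuous_map_def Pi_iff)
  then show "L (w \<circ> (\<lambda>_. x)) = 1" using local_system_const[OF L] by (simp add: o_def)
next
  fix g k assume gk: "pathin X g" "pathin X k" "g 1 = k 0"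
  have "w \<circ> concat_path g k = concat_path (w \<circ> g) (w \<circ> k)" by (auto simp: concat_path_def)
  then show "L (w \<circ> concat_path g k) = L (w \<circ> k) * L (w \<circ> g)"
    using L pathin_compose[OF gk(1) w] pathin_compose[OF gk(2) w] gk(3)
    unfolding rank_one_local_system_def by simp
next
  fix g k :: "real \<Rightarrow> 'x"
  assume "homotopic_with (\<lambda>k. k 0 = g 0 \<and> k 1 = g 1) (top_of_set {0..1}) X g k"
  then have "homotopic_with (\<lambda>k. k 0 = (w \<circ> g) 0 \<and> k 1 = (w \<circ> g) 1) (top_of_set {0..1}) Y (w \<circ> g) (w \<circ> k)"
    by (rule homotopic_with_compose_continuous_map_left[OF _ w]) auto
  then show "L (w \<circ> g) = L (w \<circ> k)" using L unfolding rank_one_local_system_def by blast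
qed

text \<open>Every simplex of the triangulation starts at the vertex with all coordinates 1, which is
  the base point, so no transport occurs. Thus the handle of the arc classes agrees with the
  trivialisation of the cells.\<close>

lemma push_standard_cube_chain:
  assumes L: "rank_one_local_system X L" and F: "continuous_map (real_top (cube n)) X F"
  shows "push L F (\<lambda>_. 1) n (standard_cube_chain n) = cube_chain n F"
proof -
  have "push_simplex L F (\<lambda>_. 1) n (restrict (cube_simplex \<pi>) (standard_simplex n)) =
      single (restrict (\<lambda>x. F (cube_simplex \<pi> x)) (standard_simplex n)) 1" for \<pi>
  proof -
    have "cube_simplex \<pi> (vertex 0) = (\<lambda>_. 1)" by (simp add: cube_simplex_def vertex_def fun_eq_iff)
    then have "restrict (cube_simplex \<pi>) (standard_simplex n) (vertex 0) = (\<lambda>_. 1)" by simp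
    moreover have "simplex_map n F (restrict (cube_simplex \<pi>) (standard_simplex n)) =
        restrict (\<lambda>x. F (cube_simplex \<pi> x)) (standard_simplex n)"
      by (auto simp: simplex_map_def fun_eq_iff)
    moreover have "L (F \<circ> seg (\<lambda>_. 1) (\<lambda>_. 1)) = 1"
      by (rule local_system_segment_self[OF L F]) simp
    ultimately show ?thesis
      by (simp add: push_simplex_def)
  qed
  then show ?thesis by (simp add: push_def cube_chain_def pm_extend_sum restrict_def)
qed

section \<open>Quotients of modules of chains\<close>

text \<open>Coset arithmetic for a submodule \<open>N\<close> of \<open>Z\<close>, to be applied to
  relative cycles and relative boundaries.\<close>

locale chain_quotient =
  fixes Z N :: "('k \<Rightarrow>\<^sub>0 laurent) set"
  assumes Z_add: "x \<in> Z \<Longrightarrow> y \<in> Z \<Longrightarrow> x + y \<in> Z" and Z_scale: "x \<in> Z \<Longrightarrow> pm_scale r x \<in> Z"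
    and N_zero: "0 \<in> N" and N_Z: "N \<subseteq> Z" and N_add: "x \<in> N \<Longrightarrow> y \<in> N \<Longrightarrow> x + y \<in> N"
    and N_scale: "x \<in> N \<Longrightarrow> pm_scale r x \<in> N"
begin

definition M :: "(laurent, 'k \<Rightarrow>\<^sub>0 laurent) module"
  where "M = \<lparr>carrier = Z, monoid.mult = (\<lambda>_ _. undefined), one = undefined,
     zero = 0, add = (+), smult = (\<lambda>r. Poly_Mapping.map ((*) r))\<rparr>"

abbreviation "Q \<equiv> quotient_module M N"

definition cls :: "('k \<Rightarrow>\<^sub>0 laurent) \<Rightarrow> ('k \<Rightarrow>\<^sub>0 laurent) set"
  where "cls x = N +>\<^bsub>M\<^esub> x"

lemma cls_eq: "cls x = (\<lambda>n. n + x) ` N"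
  by (auto simp: cls_def a_r_coset_def r_coset_def M_def)

lemma N_minus: "x \<in> N \<Longrightarrow> - x \<in> N"
  using N_scale[of x "- 1"] by (simp add: pm_scale_minus_one)

lemma N_diff: "x \<in> N \<Longrightarrow> y \<in> N \<Longrightarrow> x - y \<in> N"
  using N_add[of x "- y"] N_minus by simp

lemma cls_eq_iff: "cls x = cls y \<longleftrightarrow> x - y \<in> N"
proof
  assume "cls x = cls y"
  moreover have "x \<in> cls x" using N_zero by (force simp: cls_eq)
  ultimately show "x - y \<in> N" by (auto simp: cls_eq)
next
  assume xy: "x - y \<in> N"
  have "n + x \<in> cls y" if "n \<in> N" for n
    unfolding cls_eq using N_add[OF that xy] by (rule rev_image_eqI) simp
  moreover have "n + y \<in> cls x" if "n \<in> N" for n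
    unfolding cls_eq using N_diff[OF that xy] by (rule rev_image_eqI) simp
  ultimately show "cls x = cls y" by (auto simp: cls_eq)
qed

lemma carrier_Q: "carrier Q = cls ` Z"
  by (auto simp: quotient_module_def A_RCOSETS_def RCOSETS_def cls_def a_r_coset_def M_def)

lemma set_add_M: "A <+>\<^bsub>M\<^esub> B = {a + b | a b. a \<in> A \<and> b \<in> B}"
  by (auto simp: set_add_def set_mult_def M_def)

lemma add_Q: "cls x \<oplus>\<^bsub>Q\<^esub> cls y = cls (x + y)"
proof -
  have "cls x \<oplus>\<^bsub>Q\<^esub> cls y = {(n + x) + (n' + y) | n n'. n \<in> N \<and> n' \<in> N}"
    by (auto simp: quotient_module_def set_add_M cls_eq)
  also have "\<dots> = cls (x + y)"
  proof (intro equalityI subsetI)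
    fix u assume "u \<in> {(n + x) + (n' + y) | n n'. n \<in> N \<and> n' \<in> N}"
    then obtain n n' where "u = (n + n') + (x + y)" "n \<in> N" "n' \<in> N" by (auto simp: algebra_simps)
    then show "u \<in> cls (x + y)" using N_add by (auto simp: cls_eq)
  next
    fix u assume "u \<in> cls (x + y)"
    then obtain n where "n \<in> N" "u = (n + x) + (0 + y)" by (auto simp: cls_eq algebra_simps)
    then show "u \<in> {(n + x) + (n' + y) | n n'. n \<in> N \<and> n' \<in> N}" using N_zero by blast
  qed
  finally show ?thesis .
qed

lemma zero_Q: "\<zero>\<^bsub>Q\<^esub> = cls 0"
  by (simp add: quotient_module_def cls_eq)

text \<open>Scaling a coset elementwise may give only a part of a coset; the summand
  \<open>N\<close> in \<open>quotient_module\<close> fills it up.\<close>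

lemma smult_Q: "r \<odot>\<^bsub>Q\<^esub> cls x = cls (pm_scale r x)"
proof -
  have "r \<odot>\<^bsub>Q\<^esub> cls x = {n + pm_scale r (n' + x) | n n'. n \<in> N \<and> n' \<in> N}"
    by (auto simp: quotient_module_def set_add_M cls_eq) (auto simp: M_def pm_scale_def)
  also have "\<dots> = cls (pm_scale r x)"
  proof (intro equalityI subsetI)
    fix u assume "u \<in> {n + pm_scale r (n' + x) | n n'. n \<in> N \<and> n' \<in> N}"
    then obtain n n' where "u = (n + pm_scale r n') + pm_scale r x" "n \<in> N" "n' \<in> N"
      by (auto simp: pm_scale_distrib algebra_simps)
    then show "u \<in> cls (pm_scale r x)" using N_add N_scale by (auto simp: cls_eq)
  next
    fix u assume "u \<in> cls (pm_scale r x)"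
    then obtain n where "n \<in> N" "u = n + pm_scale r (0 + x)" by (auto simp: cls_eq)
    then show "u \<in> {n + pm_scale r (n' + x) | n n'. n \<in> N \<and> n' \<in> N}" using N_zero by blast
  qed
  finally show ?thesis .
qed

lemma abelian_group_Q: "abelian_group Q"
proof (rule abelian_groupI)
  show "\<exists>y\<in>carrier Q. y \<oplus>\<^bsub>Q\<^esub> x = \<zero>\<^bsub>Q\<^esub>" if x: "x \<in> carrier Q" for x
  proof -
    obtain c where "c \<in> Z" "x = cls c" using x by (auto simp: carrier_Q)
    then have "cls (- c) \<in> carrier Q" "cls (- c) \<oplus>\<^bsub>Q\<^esub> x = \<zero>\<^bsub>Q\<^esub>"
      using Z_scale[of c "- 1"] by (auto simp: carrier_Q add_Q zero_Q pm_scale_minus_one)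
    then show ?thesis by blast
  qed
qed (use N_zero N_Z in \<open>auto simp: carrier_Q add_Q zero_Q algebra_simps intro: Z_add\<close>)

lemma module_Q: "Module.module laurent_ring Q"
proof (rule moduleI)
  show "cring laurent_ring" by (rule cring_laurent_ring)
  show "abelian_group Q" by (rule abelian_group_Q)
qed (auto simp: carrier_Q add_Q smult_Q pm_scale_distrib laurent_ring_def intro: Z_scale)

lemma finsum_Q:
  assumes "finite A" "\<And>i. i \<in> A \<Longrightarrow> x i \<in> Z"
  shows "(\<Oplus>\<^bsub>Q\<^esub>i\<in>A. cls (x i)) = cls (\<Sum>i\<in>A. x i)"
proof -
  interpret abelian_group Q by (rule abelian_group_Q)
  show ?thesis
    using assms
  proof (induction A rule: finite_induct)
    case empty
    then show ?case by (simp only: finsum_empty zero_Q sum.empty)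
  next
    case (insert a A)
    have "(\<lambda>i. cls (x i)) \<in> A \<rightarrow> carrier Q" "cls (x a) \<in> carrier Q" using insert.prems by (auto simp: carrier_Q)
    from finsum_insert[OF insert.hyps this] show ?case
      using insert.IH insert.prems insert.hyps by (simp add: add_Q)
  qed
qed

text \<open>A basis is a set of classes, while span and independence are indexed by
  \<open>W\<close>. Injectivity, which follows from independence, translates between the
  two.\<close>

lemma cls_basis:
  assumes W: "finite W" and f: "\<And>r. r \<in> W \<Longrightarrow> f r \<in> Z"
    and span: "\<And>x. x \<in> Z \<Longrightarrow> \<exists>a. x - (\<Sum>r\<in>W. pm_scale (a r) (f r)) \<in> N"
    and indep: "\<And>a r. (\<Sum>r\<in>W. pm_scale (a r) (f r)) \<in> N \<Longrightarrow> r \<in> W \<Longrightarrow> a r = 0"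
  shows "inj_on (\<lambda>r. cls (f r)) W \<and> module_basis laurent_ring Q ((\<lambda>r. cls (f r)) ` W)"
proof
  let ?F = "\<lambda>r. cls (f r)" and ?lc = "\<lambda>a. \<Sum>r\<in>W. pm_scale (a r) (f r)"
  show inj: "inj_on ?F W"
  proof (rule inj_onI, rule ccontr)
    fix r q assume rq: "r \<in> W" "q \<in> W" "cls (f r) = cls (f q)" "r \<noteq> q"
    have delta: "?lc (\<lambda>p. if p = s then 1 else 0) = f s" if "s \<in> W" for s
    proof -
      have "?lc (\<lambda>p. if p = s then 1 else 0) = (\<Sum>p\<in>W. if p = s then f p else 0)" by (rule sum.cong) auto
      then show ?thesis using W that by simp
    qed
    \<comment> \<open>Equal classes would give a relation with coefficients 1 and -1.\<close>
    have "?lc (\<lambda>p. (if p = r then 1 else 0) - (if p = q then 1 else 0)) = f r - f q"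
      using delta[OF rq(1)] delta[OF rq(2)] by (simp add: pm_scale_distrib sum_subtractf)
    then have "?lc (\<lambda>p. (if p = r then 1 else 0) - (if p = q then 1 else 0)) \<in> N"
      using rq(3) by (simp add: cls_eq_iff)
    from indep[OF this rq(1)] rq(4) show False by simp
  qed
  have lc: "(\<Oplus>\<^bsub>Q\<^esub>b\<in>{b \<in> ?F ` W. u b \<noteq> \<zero>\<^bsub>laurent_ring\<^esub>}. u b \<odot>\<^bsub>Q\<^esub> b) = cls (?lc (\<lambda>r. u (?F r)))"
    for u :: "('k \<Rightarrow>\<^sub>0 laurent) set \<Rightarrow> laurent"
  proof -
    define g where "g b = pm_scale (u b) (f (inv_into W ?F b))" for b
    let ?B = "{b \<in> ?F ` W. u b \<noteq> 0}"
    have g: "g b \<in> Z" "u b \<odot>\<^bsub>Q\<^esub> b = cls (g b)" if "b \<in> ?F ` W" for b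
      using that inv_into_into[OF that] f_inv_into_f[OF that] f smult_Q[of "u b" "f (inv_into W ?F b)"]
      by (auto simp: g_def Z_scale)
    interpret abelian_group Q by (rule abelian_group_Q)
    have "(\<Oplus>\<^bsub>Q\<^esub>b\<in>?B. u b \<odot>\<^bsub>Q\<^esub> b) = (\<Oplus>\<^bsub>Q\<^esub>b\<in>?B. cls (g b))"
      by (rule finsum_cong') (use g in \<open>auto simp: carrier_Q\<close>)
    also have "\<dots> = cls (\<Sum>b\<in>?B. g b)" by (rule finsum_Q) (use W g in auto)
    also have "(\<Sum>b\<in>?B. g b) = (\<Sum>b\<in>?F ` W. g b)"
      by (rule sum.mono_neutral_left) (use W in \<open>auto simp: g_def\<close>)
    also have "\<dots> = ?lc (\<lambda>r. u (?F r))"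
      by (subst sum.reindex[OF inj]) (auto simp: g_def inv_into_f_f[OF inj] intro!: sum.cong)
    finally show ?thesis by (simp add: laurent_ring_def)
  qed
  show "module_basis laurent_ring Q (?F ` W)"
    unfolding module_basis_def
  proof (intro conjI ballI)
    show "?F ` W \<subseteq> carrier Q" using f by (auto simp: carrier_Q)
    fix x assume "x \<in> carrier Q"
    then obtain c where c: "c \<in> Z" "x = cls c" by (auto simp: carrier_Q)
    let ?P = "\<lambda>u. u \<in> ?F ` W \<rightarrow>\<^sub>E carrier laurent_ring \<and> finite {b \<in> ?F ` W. u b \<noteq> \<zero>\<^bsub>laurent_ring\<^esub>} \<and>
       x = (\<Oplus>\<^bsub>Q\<^esub>b \<in> {b \<in> ?F ` W. u b \<noteq> \<zero>\<^bsub>laurent_ring\<^esub>}. u b \<odot>\<^bsub>Q\<^esub> b)"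
    have P: "?P u \<longleftrightarrow> u \<in> extensional (?F ` W) \<and> c - ?lc (\<lambda>r. u (?F r)) \<in> N" for u
      using W unfolding lc c(2) cls_eq_iff by (auto simp: laurent_ring_def PiE_def)
    obtain a where a: "c - ?lc a \<in> N" using span[OF c(1)] by blast
    \<comment> \<open>The restriction makes the coefficient family extensional, as the uniqueness in
      \<open>module_basis\<close> demands.\<close>
    define u where "u = restrict (\<lambda>b. a (inv_into W ?F b)) (?F ` W)"
    have "?lc (\<lambda>r. u (?F r)) = ?lc a"
      by (rule sum.cong) (auto simp: u_def inv_into_f_f[OF inj])
    then have "?P u" unfolding P using a by (simp add: u_def)
    moreover have "v = u" if "?P v" for v
    proof (rule extensionalityI)
      show "v \<in> extensional (?F ` W)" "u \<in> extensional (?F ` W)" using that \<open>?P u\<close> unfolding P by blast+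
      have "c - ?lc (\<lambda>r. u (?F r)) \<in> N" "c - ?lc (\<lambda>r. v (?F r)) \<in> N"
        using that \<open>?P u\<close> unfolding P by blast+
      then have "(c - ?lc (\<lambda>r. u (?F r))) - (c - ?lc (\<lambda>r. v (?F r))) \<in> N" by (rule N_diff)
      then have "?lc (\<lambda>r. v (?F r) - u (?F r)) \<in> N"
        by (simp add: pm_scale_distrib sum_subtractf)
      from indep[OF this] show "v b = u b" if "b \<in> ?F ` W" for b using that by auto
    qed
    ultimately show "\<exists>!u. ?P u" by (rule ex1I)
  qed
qed

end

theorem proposition2p17:
  fixes l :: nat
    and a :: "nat \<Rightarrow> nat \<Rightarrow> int"
    and d :: "nat \<Rightarrow> nat"
    and c :: "nat \<Rightarrow> nat"
    and L :: "(real \<Rightarrow> nat \<times> nat \<Rightarrow> complex) \<Rightarrow> laurent"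
    and h :: "nat \<Rightarrow> real"
  assumes "cartan_datum l a d"
    and "torus_local_system (torus_coords l) (monodromy a d) L"
    and "arc_heights (num_points l c) h"
  shows "free_module laurent_ring (conf_homology l c L) \<and>
    inj_on (F_class l c L h) (colour_words l c) \<and>
    module_basis laurent_ring (conf_homology l c L) (F_class l c L h ` colour_words l c)"
proof -
  let ?m = "num_points l c" and ?X = "conf l c" and ?S = "conf_sides l c" and ?W = "colour_words l c"
  let ?L = "pullback_local_system (W_map l) L"
  let ?Z = "twisted_relcycles ?L ?m ?X ?S" and ?N = "twisted_relboundaries ?L ?m ?X ?S"
  have L: "rank_one_local_system ?X ?L"
    using assms(2) continuous_map_W_map unfolding torus_local_system_def by (intro rank_one_pullback) auto
  interpret cells: retraction_to_cells ?X ?L "conf_move h" ?S "insert (wide_confs l c) (narrow_confs l c ` ?W)"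
    "arc_cube h" "cube ?m" ?W "cube_frontier ?m" "\<lambda>_. 1" ?m "standard_cube_chain ?m" "\<lambda>_. arc_coords ?m h"
    by (rule conf_retraction_to_cells[OF assms(3) L])
  interpret chain_quotient ?Z ?N
  proof
    show "x + y \<in> ?Z" if "x \<in> ?Z" "y \<in> ?Z" for x y
      using that by (auto simp: twisted_relcycles_def twisted_boundary_linear)
    show "pm_scale r x \<in> ?Z" if "x \<in> ?Z" for r x
      using that by (auto simp: twisted_relcycles_def twisted_boundary_linear intro: twisted_chains_scale)
    show "0 \<in> ?N"
      unfolding twisted_relboundaries_def by (auto simp: twisted_boundary_linear intro!: bexI[of _ 0])
    \<comment> \<open>A relative boundary is a boundary up to a chain in \<open>S\<close>, and the
      boundary of that chain stays in \<open>S\<close>.\<close>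
    show "?N \<subseteq> ?Z"
    proof
      fix x assume "x \<in> ?N"
      then obtain b where b: "b \<in> twisted_chains (Suc ?m) ?X"
        and s: "twisted_boundary ?L (Suc ?m) b - x \<in> twisted_chains ?m (subtopology ?X ?S)" (is "?s \<in> _")
        by (auto simp: twisted_relboundaries_def)
      have "x = twisted_boundary ?L (Suc ?m) b - ?s" by simp
      also have "\<dots> \<in> twisted_chains ?m ?X"
        using twisted_boundary_chain[OF b] s[unfolded twisted_chains_subtopology] by (intro twisted_chains_diff[of _ _ _ "?s"]) simp_all
      finally have "x \<in> twisted_chains ?m ?X" .
      moreover have "twisted_boundary ?L ?m x = - twisted_boundary ?L ?m ?s"
        using twisted_boundary_boundary[OF L b] by (simp add: twisted_boundary_linear)
      then have "twisted_boundary ?L ?m x \<in> twisted_chains (?m - 1) (subtopology ?X ?S)"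
        using twisted_boundary_chain[OF s] by simp
      ultimately show "x \<in> ?Z" by (simp add: twisted_relcycles_def)
    qed
    show "x + y \<in> ?N" if xy: "x \<in> ?N" "y \<in> ?N" for x y
    proof -
      obtain b b' where b: "b \<in> twisted_chains (Suc ?m) ?X" "b' \<in> twisted_chains (Suc ?m) ?X"
        and s: "twisted_boundary ?L (Suc ?m) b - x \<in> twisted_chains ?m (subtopology ?X ?S)"
          "twisted_boundary ?L (Suc ?m) b' - y \<in> twisted_chains ?m (subtopology ?X ?S)"
        using xy by (auto simp: twisted_relboundaries_def)
      show ?thesis
        using twisted_chains_add[OF s] twisted_chains_add[OF b]
        by (auto simp: twisted_relboundaries_def twisted_boundary_linear algebra_simps intro!: bexI[of _ "b + b'"])
    qed
    show "pm_scale r x \<in> ?N" if x: "x \<in> ?N" for r x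
    proof -
      obtain b where b: "b \<in> twisted_chains (Suc ?m) ?X"
        and s: "twisted_boundary ?L (Suc ?m) b - x \<in> twisted_chains ?m (subtopology ?X ?S)"
        using x by (auto simp: twisted_relboundaries_def)
      show ?thesis
        using twisted_chains_scale[OF s, of r] twisted_chains_scale[OF b, of r]
        by (auto simp: twisted_relboundaries_def twisted_boundary_linear pm_scale_distrib intro!: bexI[of _ "pm_scale r b"])
    qed
  qed
  have M: "M = twisted_relcycle_module ?L ?m ?X ?S" by (simp add: M_def twisted_relcycle_module_def)
  \<comment> \<open>The cube of the arcs is the push-forward of the fundamental chain of the
    standard cube, so the classes in question are those of the cell chains.\<close>
  have F: "F_class l c L h r = cls (cells.cell_chain r)" if "r \<in> ?W" for r
    using that push_standard_cube_chain[OF L continuous_map_arc_cube[OF assms(3) that]]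
    by (simp add: F_class_def homology_class_def cls_def M colour_words_def)
  \<comment> \<open>Only the sign of the difference changes, to match the form of
    \<open>cells_span\<close> and \<open>cells_independent\<close>.\<close>
  have N_iff: "x \<in> ?N \<longleftrightarrow> (\<exists>b\<in>twisted_chains (Suc ?m) ?X.
      x - twisted_boundary ?L (Suc ?m) b \<in> twisted_chains ?m (subtopology ?X ?S))" for x
    unfolding twisted_relboundaries_def mem_Collect_eq by (metis minus_diff_eq twisted_chains_minus)
  have "inj_on (\<lambda>r. cls (cells.cell_chain r)) ?W \<and>
      module_basis laurent_ring Q ((\<lambda>r. cls (cells.cell_chain r)) ` ?W)"
  proof (rule cls_basis[OF cells.W])
    show "cells.cell_chain r \<in> ?Z" if "r \<in> ?W" for r by (rule cells.cell_chain_relcycle[OF that])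
    show "\<exists>a. x - (\<Sum>r\<in>?W. pm_scale (a r) (cells.cell_chain r)) \<in> ?N" if "x \<in> ?Z" for x
      using cells.cells_span[OF that] unfolding N_iff .
    show "a r = 0" if "(\<Sum>r\<in>?W. pm_scale (a r) (cells.cell_chain r)) \<in> ?N" "r \<in> ?W" for a r
      using that cells.cells_independent unfolding N_iff by blast
  qed
  moreover have "inj_on (F_class l c L h) ?W \<longleftrightarrow> inj_on (\<lambda>r. cls (cells.cell_chain r)) ?W"
    by (rule inj_on_cong) (rule F)
  moreover have "F_class l c L h ` ?W = (\<lambda>r. cls (cells.cell_chain r)) ` ?W"
    by (rule image_cong[OF refl F])
  moreover have "conf_homology l c L = Q" by (simp add: twisted_homology_def M)
  ultimately show ?thesis using module_Q unfolding free_module_def by metis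
qed

end
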